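(* Let $n=n_1 n_2$ with integers $n_1,n_2>1$. For $L\geq 1$, let $f=X^n+a_{n-1}X^{n-1}+\cdots+a_0$ be a random monic polynomial whose coefficients are chosen independently and uniformly from $[-L,L]\cap\mathbb{Z}$. Define $m = \frac{n}{2}-\frac{2}{n}+1$ if $n_2=2$ and $n\geq 10$, and \[ m = \max\Big\{n_2+\frac{1}{2}+\frac{1}{n_1},\ n_1+\Big(1-\frac{1}{n_1}\Big)(n_2-1),\ n_1+\frac{n_2}{2}\Big\} \] otherwise. Then for every $\epsilon>0$ there is a constant $C>0$ depending on $n_1,n_2,\epsilon$ such that for all $L\ge 1$, \[ \textnormal{Prob}(G_f \mbox{ is transitive $(n_1,n_2)$-imprimitive}) \leq C\, L^{-n+m+\epsilon}. \]
   Context: For a separable $f\in\mathbb{Q}[X]$ of degree $n$, $G_f$ is its Galois group over $\mathbb{Q}$, viewed as a subgroup of $S_n$ via its action on the roots (up to conjugation). A subgroup $G\leq S_n$ with $n=n_1n_2$ is called transitive $(n_1,n_2)$-imprimitive if $G$ is transitive on $\{1,\ldots,n\}$ and there is a partition of $\{1,\ldots,n\}$ into $n_1$ blocks $\Lambda_1,\ldots,\Lambda_{n_1}$ (necessarily each of size $n_2$) such that for every $g\in G$ and every $i$ there is $j$ with $g\Lambda_i=\Lambda_j$. *)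

theory Defs
  imports
    "HOL-Probability.Probability"
    "HOL-Algebra.Algebraic_Closure_Type"
    "HOL-Algebra.Generated_Fields"
    "HOL-Combinatorics.Permutations"
    "HOL-Library.Disjoint_Sets"
begin

definition complex_roots :: "rat poly \<Rightarrow> complex set" where
  "complex_roots f = {z. poly (map_poly of_rat f) z = 0}"

text \<open>All roots in the algebraically closed field of complex numbers are simple.\<close>
definition separable_poly :: "rat poly \<Rightarrow> bool" where
  "separable_poly f \<longleftrightarrow> rsquarefree (map_poly of_rat f :: complex poly)"

definition splitting_field :: "rat poly \<Rightarrow> complex ring" where
  "splitting_field f =
     ring_of_type_algebra\<lparr>carrier := generate_field ring_of_type_algebra (\<rat> \<union> complex_roots f)\<rparr>"

text \<open>
  Elements of \<^const>\<open>ring_iso\<close> are total functions whose values off the carrier are unconstrained;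
  this is harmless because only their action on the roots is used below.
\<close>
definition galois_automorphisms :: "rat poly \<Rightarrow> (complex \<Rightarrow> complex) set" where
  "galois_automorphisms f =
     {\<sigma> \<in> ring_iso (splitting_field f) (splitting_field f). \<forall>q\<in>\<rat>. \<sigma> q = q}"

text \<open>
  The Galois group as a permutation group on the set of roots. It is not transported to
  \<open>{1..n}\<close>: this would need a choice of labelling of the roots, on which the group depends only
  up to conjugation. Permutations are the identity off the roots, as usual for \<^const>\<open>permutes\<close>.
\<close>
definition galois_group :: "rat poly \<Rightarrow> (complex \<Rightarrow> complex) set" where
  "galois_group f =
     {\<pi>. \<pi> permutes complex_roots f \<and>
         (\<exists>\<sigma>\<in>galois_automorphisms f. \<forall>z\<in>complex_roots f. \<pi> z = \<sigma> z)}"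

definition transitive_on :: "'a set \<Rightarrow> ('a \<Rightarrow> 'a) set \<Rightarrow> bool" where
  "transitive_on \<Omega> G \<longleftrightarrow> (\<forall>x\<in>\<Omega>. \<forall>y\<in>\<Omega>. \<exists>g\<in>G. g x = y)"

text \<open>
  For a group \<open>G\<close> of permutations of an arbitrary set \<open>\<Omega>\<close> with \<open>n\<^sub>1 n\<^sub>2\<close> elements; the case
  \<open>\<Omega> = {1..n\<^sub>1 n\<^sub>2}\<close> is that of a subgroup of the symmetric group, and the notion is invariant
  under relabelling of \<open>\<Omega>\<close>.
\<close>
definition transitive_imprimitive ::
    "nat \<Rightarrow> nat \<Rightarrow> 'a set \<Rightarrow> ('a \<Rightarrow> 'a) set \<Rightarrow> bool" where
  "transitive_imprimitive n1 n2 \<Omega> G \<longleftrightarrow>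
     card \<Omega> = n1 * n2 \<and> transitive_on \<Omega> G \<and>
     (\<exists>P. partition_on \<Omega> P \<and> card P = n1 \<and> (\<forall>g\<in>G. \<forall>B\<in>P. g ` B \<in> P))"

definition random_monic_poly :: "nat \<Rightarrow> real \<Rightarrow> rat poly pmf" where
  "random_monic_poly n L =
     map_pmf (\<lambda>a. Polynomial.monom 1 n + (\<Sum>i<n. Polynomial.monom (of_int (a i)) i))
       (Pi_pmf {..<n} 0 (\<lambda>_. pmf_of_set {k::int. real_of_int k \<in> {-L..L}}))"

definition imprimitive_exponent :: "nat \<Rightarrow> nat \<Rightarrow> real" where
  "imprimitive_exponent n1 n2 =
     (let n = n1 * n2 in
      if n2 = 2 \<and> n \<ge> 10 then real n / 2 - 2 / real n + 1
      else Max {real n2 + 1 / 2 + 1 / real n1,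
                real n1 + (1 - 1 / real n1) * (real n2 - 1),
                real n1 + real n2 / 2})"

end

theory Submission
  imports Defs "Jordan_Normal_Form.Char_Poly"
begin

text \<open>
  If the Galois group of \<open>f\<close> permutes \<open>N\<close> blocks of \<open>M\<close> roots, then \<open>f\<close> is the product of the \<open>N\<close>
  conjugates of a monic polynomial of degree \<open>M\<close> over the ring of integers \<open>\<O>\<close> of a number field of
  degree \<open>N\<close>. The Mahler measure of \<open>f\<close> is of order at most \<open>L\<close>, so after a dyadic subdivision, which
  costs \<open>L\<^sup>\<epsilon>\<close>, the coefficients of this polynomial, embedded in \<open>\<complex>\<^sup>N\<close>, lie in a polydisc with product
  of radii \<open>P\<close>, where \<open>P\<close> is of order at most \<open>L\<close>.

  If \<open>\<O>\<close> has at most about \<open>P\<^bsup>1-1/N\<^esup>\<close> points in the polydisc, choose a generator among the small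
  combinations of the coefficients: there are about \<open>P\<^sup>N\<close> characteristic polynomials for it, and
  \<open>M - 1\<close> further coefficients remain, which gives the exponent \<open>N + (1 - 1/N)(M - 1)\<close>. Otherwise the
  pigeonhole principle yields a generator of \<open>\<O>\<close> with all conjugates bounded by some \<open>h\<close> of order at
  most \<open>P\<^bsup>1/N\<^esup>\<close>, while \<open>\<O>\<close> has at most about \<open>P/h\<close> points in the polydisc. There are few such generators,
  and summing over \<open>h\<close> gives exponents that are no larger than the claimed one. No discriminants or
  successive minima are needed.
\<close>

text \<open>A generator determines its order as \<open>integral_span N u\<close>, so orders are
  never enumerated: characteristic polynomials of generators are, with at most \<open>N ^ N\<close>
  tuples for each. This is why elements are represented by their tuples of conjugates, indexed by
  the blocks; Galois theory serves to place the coefficients of the block polynomials in such a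
  ring.

  The threshold comes from the pigeonhole cells. They are long only in one real direction, taken at
  the largest radius, which is at least \<open>P powr (1 / N)\<close>; removing that radius from the
  product leaves at most \<open>P powr (1 - 1 / N)\<close>. The conjugates of the resulting
  generator lie in the unit disc, except for one or for a complex conjugate pair. Hence its trace is
  of order \<open>h\<close> and its other coefficients are of order at most \<open>h ^ 2\<close>, so
  there are at most about \<open>h ^ (2 * N - 1)\<close> generators, each with about
  \<open>(P / h) ^ M\<close> coefficient tuples. Summed over \<open>h\<close>, this is of order at
  most \<open>P powr (M + 1 / N)\<close> plus \<open>P powr (M + (2 * N - M) / N)\<close>; these two
  exponents and that of the other case are what has to be compared with the claim.\<close>

hide_const (open) Polynomials.lead_coeff Polynomials.degree up_ring.coeff up_ring.monom Coset.order Module.module.smult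

section \<open>Algebraic integers form a ring\<close>

text \<open>The vector \<open>u\<close> is an eigenvector of the integer matrix \<open>B\<close>
  with eigenvalue \<open>t\<close>, even if its entries are linearly dependent; so \<open>t\<close>
  is a root of the monic integral characteristic polynomial.\<close>

lemma algebraic_int_of_int_action:
  fixes t :: complex and u :: "nat \<Rightarrow> complex" and B :: "nat \<Rightarrow> nat \<Rightarrow> int"
  assumes act: "\<And>k. k < m \<Longrightarrow> t * u k = (\<Sum>l<m. of_int (B k l) * u l)"
    and nz: "k0 < m" "u k0 \<noteq> 0"
  shows "algebraic_int t"
proof -
  define A :: "int mat" where "A = Matrix.mat m m (\<lambda>(i,j). B i j)"
  have A: "A \<in> carrier_mat m m" by (simp add: A_def)
  define A' :: "complex mat" where "A' = map_mat of_int A"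
  have A': "A' \<in> carrier_mat m m" using A by (simp add: A'_def)
  define v where "v = Matrix.vec m u"
  have "eigenvector A' v t"
    unfolding eigenvector_def
  proof (intro conjI)
    show "v \<in> carrier_vec (dim_row A')" using A' by (simp add: v_def)
    show "v \<noteq> 0\<^sub>v (dim_row A')"
    proof
      assume "v = 0\<^sub>v (dim_row A')"
      hence "Matrix.vec_index v k0 = Matrix.vec_index (0\<^sub>v (dim_row A')) k0" by simp
      thus False using nz A' by (simp add: v_def)
    qed
    show "A' *\<^sub>v v = t \<cdot>\<^sub>v v"
    proof (rule Matrix.eq_vecI)
      fix i assume "i < dim_vec (t \<cdot>\<^sub>v v)"
      hence i: "i < m" by (simp add: v_def)
      show "Matrix.vec_index (A' *\<^sub>v v) i = Matrix.vec_index (t \<cdot>\<^sub>v v) i"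
        using i A' act[OF i] 
        by (simp add: v_def A'_def A_def Matrix.scalar_prod_def lessThan_atLeast0)
    qed (use A' in \<open>simp add: v_def\<close>)
  qed
  hence "eigenvalue A' t" unfolding eigenvalue_def by blast
  hence "poly (char_poly A') t = 0" using eigenvalue_root_char_poly[OF A'] by simp
  moreover have "char_poly A' = map_poly of_int (char_poly A)"
    unfolding A'_def by (rule of_int_hom.char_poly_hom[OF A])
  ultimately have "poly (map_poly of_int (char_poly A)) t = 0" by simp
  moreover have "lead_coeff (char_poly A) = 1"
    using degree_monic_char_poly[OF A] by auto
  ultimately show ?thesis unfolding algebraic_int_altdef_ipoly by blast
qed

text \<open>The monomials in \<open>x\<close> and \<open>y\<close> below the two degrees span a
  finitely generated subgroup of the complex numbers that is stable under multiplication by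
  \<open>x\<close> and by \<open>y\<close>, hence by \<open>x + y\<close> and
  \<open>x * y\<close>.\<close>

lemma
  fixes x y :: complex
  assumes x: "algebraic_int x" and y: "algebraic_int y"
  shows algebraic_int_add: "algebraic_int (x + y)"
    and algebraic_int_mult: "algebraic_int (x * y)"
proof -
  obtain p where p: "poly (map_poly of_int p) x = 0" "lead_coeff p = (1::int)"
    using x unfolding algebraic_int_altdef_ipoly by blast
  obtain q where q: "poly (map_poly of_int q) y = 0" "lead_coeff q = (1::int)"
    using y unfolding algebraic_int_altdef_ipoly by blast
  define a b where "a = degree p" and "b = degree q"
  have red: "\<exists>c. z ^ degree r = (\<Sum>i<degree r. of_int (c i) * z ^ i)"
    if "poly (map_poly of_int r) z = 0" "lead_coeff r = 1" for r :: "int poly" and z :: complex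
  proof -
    have "0 = (\<Sum>i\<le>degree r. of_int (coeff r i) * z ^ i)"
      using that(1) by (simp add: poly_altdef degree_map_poly coeff_map_poly)
    also have "\<dots> = (\<Sum>i<degree r. of_int (coeff r i) * z ^ i) + z ^ degree r"
      using that(2) by (simp add: lessThan_Suc_atMost[symmetric])
    finally have "z ^ degree r = - (\<Sum>i<degree r. of_int (coeff r i) * z ^ i)"
      by (simp add: eq_neg_iff_add_eq_0 add.commute)
    also have "\<dots> = (\<Sum>i<degree r. of_int (- coeff r i) * z ^ i)"
      by (simp add: sum_negf)
    finally show ?thesis by (rule exI[of _ "\<lambda>i. - coeff r i"])
  qed
  have apos: "a > 0" unfolding a_def using p by (intro Nat.gr0I) (auto elim!: degree_eq_zeroE)
  have bpos: "b > 0" unfolding b_def using q by (intro Nat.gr0I) (auto elim!: degree_eq_zeroE)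
  \<comment> \<open>The exponents (i, j) are coded as \<open>i * b + j\<close>, which turns the
    monomials into one list of length \<open>m\<close>. \<open>T\<close> consists of the multipliers
    that map the integral span \<open>Sp\<close> of this list into itself.\<close>
  define m where "m = a * b"
  define u where "u k = x ^ (k div b) * y ^ (k mod b)" for k
  define T where "T = {t. \<forall>k<m. \<exists>c::nat\<Rightarrow>int. t * u k = (\<Sum>l<m. of_int (c l) * u l)}"
  have uel: "\<exists>c::nat\<Rightarrow>int. u k = (\<Sum>l<m. of_int (c l) * u l)" if "k < m" for k
    by (rule exI[of _ "\<lambda>l. if l = k then 1 else 0"]) (use that in \<open>simp add: if_distrib if_distribR sum.If_cases\<close>)
  define Sp where "Sp = {w. \<exists>c::nat\<Rightarrow>int. w = (\<Sum>l<m. of_int (c l) * u l)}"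
  have Sp_add: "v + w \<in> Sp" if H: "v \<in> Sp" "w \<in> Sp" for v w
  proof -
    obtain c d :: "nat \<Rightarrow> int" where "v = (\<Sum>l<m. of_int (c l) * u l)" "w = (\<Sum>l<m. of_int (d l) * u l)"
      using H unfolding Sp_def mem_Collect_eq by blast
    hence "v + w = (\<Sum>l<m. of_int (c l + d l) * u l)" by (simp add: sum.distrib algebra_simps)
    thus ?thesis unfolding Sp_def mem_Collect_eq by (rule exI[of _ "\<lambda>l. c l + d l"])
  qed
  have Sp_smult: "of_int n * w \<in> Sp" if H: "w \<in> Sp" for w n
  proof -
    obtain c :: "nat \<Rightarrow> int" where "w = (\<Sum>l<m. of_int (c l) * u l)"
      using H unfolding Sp_def mem_Collect_eq by blast
    hence "of_int n * w = (\<Sum>l<m. of_int (n * c l) * u l)" by (simp add: sum_distrib_left mult_ac)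
    thus ?thesis unfolding Sp_def mem_Collect_eq by (rule exI[of _ "\<lambda>l. n * c l"])
  qed
  have Sp_0: "0 \<in> Sp" unfolding Sp_def by (auto intro: exI[of _ "\<lambda>_. 0"])
  have Sp_sum: "(\<Sum>i\<in>I. g i) \<in> Sp" if "\<And>i. i \<in> I \<Longrightarrow> g i \<in> Sp" for I :: "nat set" and g
    using that by (induction I rule: infinite_finite_induct) (auto intro: Sp_add Sp_0)
  have T_alt: "t \<in> T \<longleftrightarrow> (\<forall>k<m. t * u k \<in> Sp)" for t by (auto simp: T_def Sp_def)
  have u_Sp: "u k \<in> Sp" if "k < m" for k using uel[OF that] by (auto simp: Sp_def)
  have TSp: "t * w \<in> Sp" if H: "t \<in> T" "w \<in> Sp" for t w
  proof -
    obtain c :: "nat \<Rightarrow> int" where "w = (\<Sum>l<m. of_int (c l) * u l)"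
      using H unfolding Sp_def mem_Collect_eq by blast
    hence "t * w = (\<Sum>l<m. of_int (c l) * (t * u l))" by (simp add: sum_distrib_left mult_ac)
    also have "\<dots> \<in> Sp" using H(1) by (intro Sp_sum Sp_smult) (auto simp: T_alt)
    finally show ?thesis .
  qed
  have mon: "x ^ i * y ^ j \<in> Sp" if "i < a" "j < b" for i j
  proof -
    have "i * b + j < m"
    proof -
      have "i * b + j < i * b + b" using that by simp
      also have "\<dots> = Suc i * b" by simp
      also have "\<dots> \<le> a * b" using that by (intro mult_right_mono) auto
      finally show ?thesis by (simp add: m_def)
    qed
    moreover have "u (i * b + j) = x ^ i * y ^ j" using that by (simp add: u_def)
    ultimately show ?thesis using u_Sp by metis
  qed
  obtain cx where cx: "x ^ a = (\<Sum>i<a. of_int (cx i) * x ^ i)" using red[OF p] a_def by blast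
  obtain cy where cy: "y ^ b = (\<Sum>i<b. of_int (cy i) * y ^ i)" using red[OF q] b_def by blast
  have ku: "k div b < a" "k mod b < b" if "k < m" for k
    using that bpos by (auto simp: m_def less_mult_imp_div_less)
  have xT: "x \<in> T" unfolding T_alt
  proof (intro allI impI)
    fix k assume k: "k < m"
    show "x * u k \<in> Sp"
    proof (cases "Suc (k div b) < a")
      case True
      hence "x ^ Suc (k div b) * y ^ (k mod b) \<in> Sp" using ku[OF k] by (intro mon)
      thus ?thesis by (simp add: u_def mult_ac)
    next
      case False
      hence "Suc (k div b) = a" using ku[OF k] by simp
      hence "x * u k = x ^ a * y ^ (k mod b)" by (simp add: u_def flip: power_Suc mult.assoc)
      also have "\<dots> = (\<Sum>i<a. of_int (cx i) * (x ^ i * y ^ (k mod b)))"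
        by (simp add: cx sum_distrib_right mult.assoc)
      also have "\<dots> \<in> Sp" using ku[OF k] by (intro Sp_sum Sp_smult mon) auto
      finally show ?thesis .
    qed
  qed
  have yT: "y \<in> T" unfolding T_alt
  proof (intro allI impI)
    fix k assume k: "k < m"
    show "y * u k \<in> Sp"
    proof (cases "Suc (k mod b) < b")
      case True
      hence "x ^ (k div b) * y ^ Suc (k mod b) \<in> Sp" using ku[OF k] by (intro mon)
      thus ?thesis by (simp add: u_def mult_ac)
    next
      case False
      hence "Suc (k mod b) = b" using ku[OF k] by simp
      hence "y * u k = x ^ (k div b) * y ^ b" by (metis power_Suc u_def mult.left_commute)
      also have "\<dots> = (\<Sum>i<b. of_int (cy i) * (x ^ (k div b) * y ^ i))"
        by (simp add: cy sum_distrib_left mult.left_commute)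
      also have "\<dots> \<in> Sp" using ku[OF k] by (intro Sp_sum Sp_smult mon) auto
      finally show ?thesis .
    qed
  qed
  have T_int: "algebraic_int t" if "t \<in> T" for t
  proof -
    have "\<forall>k. \<exists>c::nat\<Rightarrow>int. k < m \<longrightarrow> t * u k = (\<Sum>l<m. of_int (c l) * u l)"
      using that by (auto simp: T_def)
    then obtain B :: "nat \<Rightarrow> nat \<Rightarrow> int"
      where "\<And>k. k < m \<Longrightarrow> t * u k = (\<Sum>l<m. of_int (B k l) * u l)" by metis
    moreover have "0 < m" "u 0 \<noteq> 0" using apos bpos by (auto simp: m_def u_def)
    ultimately show ?thesis by (rule algebraic_int_of_int_action)
  qed
  have "x + y \<in> T" using xT yT by (auto simp: T_alt algebra_simps intro: Sp_add)
  thus "algebraic_int (x + y)" by (rule T_int)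
  have "x * y \<in> T" using xT yT TSp by (auto simp: T_alt mult.assoc)
  thus "algebraic_int (x * y)" by (rule T_int)
qed

lemma algebraic_int_diff:
  "algebraic_int x \<Longrightarrow> algebraic_int y \<Longrightarrow> algebraic_int (x - y)" for x y :: complex
  using algebraic_int_add[of x "-y"] by auto

section \<open>Extending field homomorphisms\<close>

text \<open>Plain sets of complex numbers make towers of fields mere inclusions and give all
  homomorphisms the same algebraically closed codomain. As \<open>inverse 0 = 0\<close>, the clause
  on inverses covers 0.\<close>

definition csubfield :: "complex set \<Rightarrow> bool" where
  "csubfield E \<longleftrightarrow> 0 \<in> E \<and> 1 \<in> E \<and> (\<forall>x\<in>E. \<forall>y\<in>E. x + y \<in> E \<and> x * y \<in> E) \<and> (\<forall>x\<in>E. - x \<in> E \<and> inverse x \<in> E)"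

text \<open>\<open>\<tau>\<close> is total but constrained on \<open>E\<close> only. The value at 1
  excludes the zero map and makes \<open>\<tau>\<close> injective on a subfield.\<close>

definition hom_on :: "complex set \<Rightarrow> (complex \<Rightarrow> complex) \<Rightarrow> bool" where
  "hom_on E \<tau> \<longleftrightarrow> \<tau> 1 = 1 \<and> (\<forall>x\<in>E. \<forall>y\<in>E. \<tau> (x + y) = \<tau> x + \<tau> y \<and> \<tau> (x * y) = \<tau> x * \<tau> y)"

definition poly_over :: "complex set \<Rightarrow> complex poly \<Rightarrow> bool" where
  "poly_over E p \<longleftrightarrow> (\<forall>k. coeff p k \<in> E)"

lemma csubfieldD:
  assumes "csubfield E"
  shows "0 \<in> E" "1 \<in> E" "x \<in> E \<Longrightarrow> y \<in> E \<Longrightarrow> x + y \<in> E" "x \<in> E \<Longrightarrow> y \<in> E \<Longrightarrow> x * y \<in> E"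
    "x \<in> E \<Longrightarrow> - x \<in> E" "x \<in> E \<Longrightarrow> inverse x \<in> E" "x \<in> E \<Longrightarrow> y \<in> E \<Longrightarrow> x - y \<in> E"
    "x \<in> E \<Longrightarrow> y \<in> E \<Longrightarrow> x / y \<in> E"
  using assms unfolding csubfield_def diff_conv_add_uminus divide_inverse by blast+

lemma csubfield_sum: "csubfield E \<Longrightarrow> (\<And>i. i \<in> I \<Longrightarrow> g i \<in> E) \<Longrightarrow> (\<Sum>i\<in>I. g i) \<in> E"
  by (induction I rule: infinite_finite_induct) (auto intro: csubfieldD)

lemma csubfield_power: "csubfield E \<Longrightarrow> x \<in> E \<Longrightarrow> x ^ k \<in> E"
  by (induction k) (auto intro: csubfieldD)

lemma csubfield_Inter: "(\<And>F. F \<in> \<F> \<Longrightarrow> csubfield F) \<Longrightarrow> csubfield (\<Inter>\<F>)"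
  unfolding csubfield_def by blast

lemma csubfield_Rats: "csubfield \<rat>"
  unfolding csubfield_def by auto

lemma Rats_subset_csubfield:
  assumes "csubfield E" shows "\<rat> \<subseteq> E"
proof
  fix x :: complex assume "x \<in> \<rat>"
  then obtain a b where x: "x = of_int a / of_int b" by (metis Rats_cases')
  have nat: "of_nat n \<in> E" for n
    by (induction n) (use assms in \<open>auto intro: csubfieldD\<close>)
  have "of_int a \<in> E" for a
    by (cases a rule: int_cases2) (use nat assms in \<open>auto intro: csubfieldD\<close>)
  thus "x \<in> E" unfolding x using assms by (intro csubfieldD) auto
qed

lemma poly_over_intros:
  assumes "csubfield E"
  shows "poly_over E 0" "poly_over E 1" "c \<in> E \<Longrightarrow> poly_over E [:c:]" "c \<in> E \<Longrightarrow> poly_over E (Polynomial.monom c k)"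
    "c \<in> E \<Longrightarrow> d \<in> E \<Longrightarrow> poly_over E [:c, d:]"
    "poly_over E p \<Longrightarrow> poly_over E q \<Longrightarrow> poly_over E (p + q)"
    "poly_over E p \<Longrightarrow> poly_over E q \<Longrightarrow> poly_over E (p - q)"
    "poly_over E p \<Longrightarrow> poly_over E (- p)"
    "poly_over E p \<Longrightarrow> poly_over E q \<Longrightarrow> poly_over E (p * q)"
    "c \<in> E \<Longrightarrow> poly_over E p \<Longrightarrow> poly_over E (Polynomial.smult c p)"
proof -
  show "poly_over E (p * q)" if "poly_over E p" "poly_over E q"
    using that unfolding poly_over_def coeff_mult
    by (auto intro!: csubfield_sum[OF assms] csubfieldD(4)[OF assms])
qed (use csubfieldD[OF assms] in \<open>auto simp: poly_over_def coeff_pCons split: nat.splits\<close>)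

lemma poly_over_prod:
  "csubfield E \<Longrightarrow> (\<And>i. i \<in> I \<Longrightarrow> poly_over E (p i)) \<Longrightarrow> poly_over E (\<Prod>i\<in>I. p i)"
  by (induction I rule: infinite_finite_induct) (auto intro: poly_over_intros)

lemma poly_over_eval: "csubfield E \<Longrightarrow> poly_over E p \<Longrightarrow> x \<in> E \<Longrightarrow> poly p x \<in> E"
  unfolding poly_altdef poly_over_def
  by (intro csubfield_sum csubfieldD(4) csubfield_power) auto

lemma poly_over_mono: "poly_over E p \<Longrightarrow> E \<subseteq> F \<Longrightarrow> poly_over F p"
  by (auto simp: poly_over_def)

lemma hom_onD:
  assumes "csubfield E" "hom_on E \<tau>"
  shows "\<tau> 0 = 0" "\<tau> 1 = 1" "x \<in> E \<Longrightarrow> y \<in> E \<Longrightarrow> \<tau> (x + y) = \<tau> x + \<tau> y"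
    "x \<in> E \<Longrightarrow> y \<in> E \<Longrightarrow> \<tau> (x * y) = \<tau> x * \<tau> y"
    "x \<in> E \<Longrightarrow> \<tau> (- x) = - \<tau> x" "x \<in> E \<Longrightarrow> \<tau> (inverse x) = inverse (\<tau> x)"
    "x \<in> E \<Longrightarrow> y \<in> E \<Longrightarrow> \<tau> (x - y) = \<tau> x - \<tau> y"
    "x \<in> E \<Longrightarrow> y \<in> E \<Longrightarrow> \<tau> (x / y) = \<tau> x / \<tau> y"
    "x \<in> E \<Longrightarrow> \<tau> x = 0 \<Longrightarrow> x = 0"
proof -
  note E = csubfieldD[OF assms(1)]
  show 1: "\<tau> 1 = 1" using assms by (simp add: hom_on_def)
  show add: "\<tau> (x + y) = \<tau> x + \<tau> y" if "x \<in> E" "y \<in> E" for x y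
    using assms that by (simp add: hom_on_def)
  show mult: "\<tau> (x * y) = \<tau> x * \<tau> y" if "x \<in> E" "y \<in> E" for x y
    using assms that by (simp add: hom_on_def)
  show 0: "\<tau> 0 = 0" using add[of 0 0] E(1) by simp
  show neg: "\<tau> (- x) = - \<tau> x" if "x \<in> E" for x
    using add[of x "- x"] that E(5)[of x] 0 by (simp add: eq_neg_iff_add_eq_0 add.commute)
  show inv: "\<tau> (inverse x) = inverse (\<tau> x)" if "x \<in> E" for x
  proof (cases "x = 0")
    case False
    hence "\<tau> x * \<tau> (inverse x) = 1" using mult[of x "inverse x"] that E(6)[of x] 1 by simp
    thus ?thesis by (simp add: inverse_unique)
  qed (simp add: 0)
  show diff: "\<tau> (x - y) = \<tau> x - \<tau> y" if "x \<in> E" "y \<in> E" for x y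
    using add[of x "-y"] neg[of y] that E(5) by simp
  show "\<tau> (x / y) = \<tau> x / \<tau> y" if "x \<in> E" "y \<in> E" for x y
    using mult[of x "inverse y"] inv[of y] that E(6) by (simp add: divide_inverse)
  show "x = 0" if "x \<in> E" "\<tau> x = 0" for x
  proof (rule ccontr)
    assume "x \<noteq> 0"
    hence "\<tau> x * \<tau> (inverse x) = 1" using mult[of x "inverse x"] that E(6)[of x] 1 by simp
    thus False using that by simp
  qed
qed

lemma hom_on_inj: "csubfield E \<Longrightarrow> hom_on E \<tau> \<Longrightarrow> inj_on \<tau> E"
  by (rule inj_onI) (metis hom_onD(7,9) csubfieldD(7) eq_iff_diff_eq_0)

lemma hom_on_sum:
  "csubfield E \<Longrightarrow> hom_on E \<tau> \<Longrightarrow> (\<And>i. i \<in> I \<Longrightarrow> g i \<in> E) \<Longrightarrow> \<tau> (\<Sum>i\<in>I. g i) = (\<Sum>i\<in>I. \<tau> (g i))"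
  by (induction I rule: infinite_finite_induct) (auto simp: hom_onD csubfield_sum)

lemma hom_on_power: "csubfield E \<Longrightarrow> hom_on E \<tau> \<Longrightarrow> x \<in> E \<Longrightarrow> \<tau> (x ^ k) = \<tau> x ^ k"
  by (induction k) (auto simp: hom_onD csubfield_power)

lemma hom_on_id: "hom_on E (\<lambda>x. x)" and hom_on_cnj: "hom_on E cnj"
  by (auto simp: hom_on_def)

lemma hom_on_fixed_field:
  assumes "csubfield E" "hom_on E \<tau>" shows "csubfield {x\<in>E. \<tau> x = x}"
  using assms by (auto simp: csubfield_def hom_onD[OF assms])

lemma hom_on_Rats:
  assumes "csubfield E" "hom_on E \<tau>" "q \<in> \<rat>" shows "\<tau> q = q"
  using Rats_subset_csubfield[OF hom_on_fixed_field[OF assms(1,2)]] assms(3) by auto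

lemma hom_on_map_poly:
  assumes E: "csubfield E" and h: "hom_on E \<tau>" and p: "poly_over E p" and q: "poly_over E q"
  shows "map_poly \<tau> (p + q) = map_poly \<tau> p + map_poly \<tau> q"
    "map_poly \<tau> (p - q) = map_poly \<tau> p - map_poly \<tau> q"
    "map_poly \<tau> (p * q) = map_poly \<tau> p * map_poly \<tau> q"
proof -
  note [simp] = hom_onD[OF E h]
  have [simp]: "coeff p k \<in> E" "coeff q k \<in> E" for k using p q by (auto simp: poly_over_def)
  show "map_poly \<tau> (p + q) = map_poly \<tau> p + map_poly \<tau> q"
    "map_poly \<tau> (p - q) = map_poly \<tau> p - map_poly \<tau> q"
    by (rule poly_eqI; simp add: coeff_map_poly)+
  show "map_poly \<tau> (p * q) = map_poly \<tau> p * map_poly \<tau> q"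
    by (rule poly_eqI) (simp add: coeff_map_poly coeff_mult hom_on_sum[OF E h] csubfieldD(4)[OF E])
qed

lemma hom_on_degree:
  assumes E: "csubfield E" and h: "hom_on E \<tau>" and p: "poly_over E p"
  shows "degree (map_poly \<tau> p) = degree p"
proof (rule antisym)
  show "degree (map_poly \<tau> p) \<le> degree p" by (rule degree_map_poly_le)
  show "degree p \<le> degree (map_poly \<tau> p)"
  proof (cases "p = 0")
    case False
    hence "\<tau> (lead_coeff p) \<noteq> 0" using hom_onD(9)[OF E h, of "lead_coeff p"] p by (auto simp: poly_over_def)
    thus ?thesis by (intro le_degree) (simp add: coeff_map_poly hom_onD(1)[OF E h])
  qed simp
qed

lemma hom_on_map_const:
  "csubfield E \<Longrightarrow> hom_on E \<tau> \<Longrightarrow> map_poly \<tau> [:x:] = [:\<tau> x:]"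
  by (rule poly_eqI) (simp add: coeff_map_poly coeff_pCons hom_onD split: nat.splits)

lemma hom_on_poly:
  assumes E: "csubfield E" and h: "hom_on E \<tau>" and p: "poly_over E p" and x: "x \<in> E"
  shows "\<tau> (poly p x) = poly (map_poly \<tau> p) (\<tau> x)"
proof -
  have dg: "degree (map_poly \<tau> p) = degree p"
    by (rule hom_on_degree[OF E h p])
  have c: "coeff p k \<in> E" for k using p by (auto simp: poly_over_def)
  show ?thesis
    by (simp add: poly_altdef dg coeff_map_poly hom_onD[OF E h] hom_on_sum[OF E h] c x
        csubfieldD(4)[OF E] csubfield_power[OF E] hom_on_power[OF E h])
qed

lemma map_poly_prod_linear:
  assumes E: "csubfield E" and h: "hom_on E \<tau>" and z: "\<And>i. i \<in> I \<Longrightarrow> z i \<in> E"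
  shows "map_poly \<tau> (\<Prod>i\<in>I. [:- z i, 1:]) = (\<Prod>i\<in>I. [:- \<tau> (z i), 1:])"
  using z
proof (induction I rule: infinite_finite_induct)
  case (insert i I)
  have "map_poly \<tau> ([:- z i, 1:] * (\<Prod>i\<in>I. [:- z i, 1:])) = map_poly \<tau> [:- z i, 1:] * map_poly \<tau> (\<Prod>i\<in>I. [:- z i, 1:])"
    using insert E h by (intro hom_on_map_poly(3)[OF E h] poly_over_prod[OF E] poly_over_intros[OF E]) (auto intro: csubfieldD)
  thus ?case using insert hom_onD[OF E h] by (simp add: map_poly_pCons)
qed (auto simp: hom_onD[OF E h])

section \<open>Division with remainder, minimal polynomials and simple extensions\<close>

lemma poly_over_division:
  assumes E: "csubfield E" and q: "poly_over E q" "q \<noteq> 0" and h: "poly_over E h"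
  shows "\<exists>s r. poly_over E s \<and> poly_over E r \<and> h = q * s + r \<and> (r = 0 \<or> degree r < degree q)"
  using h
\<comment> \<open>The measure puts the zero polynomial strictly below the nonzero constants; both
  have degree 0.\<close>
proof (induction "if h = 0 then 0 else Suc (degree h)" arbitrary: h rule: less_induct)
  case (less h)
  note I = poly_over_intros[OF E]
  show ?case
  proof (cases "h = 0 \<or> degree h < degree q")
    case True
    thus ?thesis using less.prems I by (intro exI[of _ 0] exI[of _ h]) auto
  next
    case False
    define c where "c = lead_coeff h / lead_coeff q"
    define m where "m = Polynomial.monom c (degree h - degree q)"
    define h' where "h' = h - q * m"
    have c: "c \<in> E" unfolding c_def using less.prems q by (intro csubfieldD(8)[OF E]) (auto simp: poly_over_def)
    hence m: "poly_over E m" unfolding m_def by (rule I)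
    have h'o: "poly_over E h'" unfolding h'_def using less.prems m q by (intro I)
    have c0: "c \<noteq> 0" using False q by (auto simp: c_def)
    have dqm: "degree (q * m) = degree h" 
      using False q c0 by (subst degree_mult_eq) (auto simp: m_def degree_monom_eq)
    have lqm: "coeff (q * m) (degree h) = lead_coeff h"
    proof -
      have "coeff (q * m) (degree h) = lead_coeff (q * m)" by (simp add: dqm)
      also have "\<dots> = lead_coeff q * c" by (simp add: lead_coeff_mult m_def degree_monom_eq c0)
      finally show ?thesis using q by (simp add: c_def)
    qed
    have "h' = 0 \<or> degree h' < degree h"
    proof (cases "h' = 0")
      case False
      have "degree h' \<le> degree h" unfolding h'_def using dqm by (intro degree_diff_le) auto
      moreover have "coeff h' (degree h) = 0" by (simp add: h'_def lqm)
      ultimately show ?thesis using False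
        by (metis leading_coeff_0_iff le_neq_implies_less)
    qed simp
    hence "(if h' = 0 then 0 else Suc (degree h')) < (if h = 0 then 0 else Suc (degree h))"
      using False by auto
    from less.hyps[OF this h'o] obtain s r where sr: "poly_over E s" "poly_over E r" "h' = q * s + r"
      "r = 0 \<or> degree r < degree q" by blast
    show ?thesis
      by (rule exI[of _ "s + m"], rule exI[of _ r]) (use sr I m in \<open>auto simp: h'_def algebra_simps\<close>)
  qed
qed

text \<open>This is a field only if \<open>z\<close> is algebraic over \<open>E\<close>.\<close>
definition adjoin :: "complex set \<Rightarrow> complex \<Rightarrow> complex set" where
  "adjoin E z = {poly h z |h. poly_over E h}"

text \<open>Least degree takes the place of irreducibility. Without normalisation \<open>q\<close>
  is determined up to a nonzero constant from \<open>E\<close>.\<close>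

definition min_poly_over :: "complex set \<Rightarrow> complex \<Rightarrow> complex poly \<Rightarrow> bool" where
  "min_poly_over E z q \<longleftrightarrow> poly_over E q \<and> q \<noteq> 0 \<and> poly q z = 0 \<and>
     (\<forall>h. poly_over E h \<longrightarrow> h \<noteq> 0 \<longrightarrow> poly h z = 0 \<longrightarrow> degree q \<le> degree h)"

lemma min_poly_over_exists:
  assumes "poly_over E p" "p \<noteq> 0" "poly p z = 0"
  obtains q where "min_poly_over E z q"
proof -
  obtain q where "poly_over E q \<and> q \<noteq> 0 \<and> poly q z = 0"
    "\<forall>h. poly_over E h \<and> h \<noteq> 0 \<and> poly h z = 0 \<longrightarrow> degree q \<le> degree h"
    using ex_has_least_nat[of "\<lambda>h. poly_over E h \<and> h \<noteq> 0 \<and> poly h z = 0" p degree] assms by auto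
  thus ?thesis using that unfolding min_poly_over_def by blast
qed

lemma min_poly_over_dvd:
  assumes E: "csubfield E" and q: "min_poly_over E z q" and h: "poly_over E h" "poly h z = 0"
  obtains s where "poly_over E s" "h = q * s"
proof -
  obtain s r where sr: "poly_over E s" "poly_over E r" "h = q * s + r" "r = 0 \<or> degree r < degree q"
    using poly_over_division[OF E _ _ h(1), of q] q unfolding min_poly_over_def by blast
  have "poly r z = 0" using sr(3) h(2) q by (simp add: min_poly_over_def)
  hence "r = 0" using sr q unfolding min_poly_over_def by (metis linorder_not_le)
  thus ?thesis using that sr by auto
qed

lemma min_poly_over_degree:
  assumes q: "min_poly_over E z q" shows "degree q > 0"
  using q unfolding min_poly_over_def by (intro Nat.gr0I) (auto elim!: degree_eq_zeroE)

lemma adjoin_subset: "csubfield F \<Longrightarrow> E \<subseteq> F \<Longrightarrow> z \<in> F \<Longrightarrow> adjoin E z \<subseteq> F"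
  unfolding adjoin_def using poly_over_eval poly_over_mono by blast

lemma adjoin_superset: "csubfield E \<Longrightarrow> insert z E \<subseteq> adjoin E z"
proof -
  assume E: "csubfield E"
  have "z \<in> adjoin E z" unfolding adjoin_def mem_Collect_eq
    by (rule exI[of _ "[:0, 1:]"]) (use poly_over_intros[OF E] csubfieldD[OF E] in auto)
  moreover have "x \<in> adjoin E z" if "x \<in> E" for x unfolding adjoin_def mem_Collect_eq
    by (rule exI[of _ "[:x:]"]) (use that poly_over_intros[OF E] in auto)
  ultimately show ?thesis by blast
qed

text \<open>Euclid's algorithm by descent on the degree: if \<open>q = h * s + r\<close>, then
  \<open>poly r z = - (poly h z * poly s z)\<close>, so an inverse for \<open>r\<close> yields one
  for \<open>h\<close>. A zero remainder would make \<open>s\<close> a shorter polynomial vanishing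
  at \<open>z\<close>.\<close>

lemma adjoin_inverse:
  assumes E: "csubfield E" and q: "min_poly_over E z q"
    and h: "poly_over E h" "poly h z \<noteq> 0"
  shows "\<exists>b. poly_over E b \<and> poly b z * poly h z = 1"
proof -
  note I = poly_over_intros[OF E]
  have qo: "poly_over E q" "q \<noteq> 0" "poly q z = 0" using q by (auto simp: min_poly_over_def)
  have qmin: "poly r z \<noteq> 0" if "poly_over E r" "r \<noteq> 0" "degree r < degree q" for r
    using q that unfolding min_poly_over_def by (metis linorder_not_le)
  have *: "\<exists>b. poly_over E b \<and> poly b z * poly h z = 1"
    if "poly_over E h" "h \<noteq> 0" "degree h < degree q" for h
    using that
  proof (induction "degree h" arbitrary: h rule: less_induct)
    case (less h)
    show ?case
    proof (cases "degree h = 0")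
      case True
      then obtain c where c: "h = [:c:]" by (rule degree_eq_zeroE)
      have "coeff h 0 \<in> E" using less.prems(1) by (simp add: poly_over_def)
      thus ?thesis using less.prems c
        by (intro exI[of _ "[:inverse c:]"]) (auto intro: I csubfieldD[OF E])
    next
      case False
      obtain s r where sr: "poly_over E s" "poly_over E r" "q = h * s + r" "r = 0 \<or> degree r < degree h"
        using poly_over_division[OF E less.prems(1,2) qo(1)] by blast
      have "r \<noteq> 0"
      proof
        assume r: "r = 0"
        have s0: "s \<noteq> 0" using sr(3) r qo by auto
        have "poly s z = 0" using sr(3) r qo(3) qmin[OF less.prems] by simp
        hence "degree s \<ge> degree q" using s0 sr(1) q unfolding min_poly_over_def by blast
        moreover have "degree q = degree h + degree s" using sr(3) r s0 less.prems by (simp add: degree_mult_eq)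
        ultimately show False using False by simp
      qed
      then obtain b where b: "poly_over E b" "poly b z * poly r z = 1"
        using less.hyps[of r] sr less.prems by auto
      have "poly r z = - (poly h z * poly s z)"
        using qo(3) sr(3) by (simp add: eq_neg_iff_add_eq_0 add.commute)
      thus ?thesis using b sr by (intro exI[of _ "- (b * s)"]) (auto intro!: I simp: mult_ac)
    qed
  qed
  \<comment> \<open>A general \<open>h\<close> is replaced by its remainder modulo \<open>q\<close>,
    which has the same value at \<open>z\<close>.\<close>
  obtain s r where sr: "poly_over E s" "poly_over E r" "h = q * s + r" "r = 0 \<or> degree r < degree q"
    using poly_over_division[OF E qo(1,2) h(1)] by blast
  have rz: "poly r z = poly h z" using sr(3) qo(3) by simp
  have "r \<noteq> 0" using rz h(2) by auto
  thus ?thesis using *[of r] sr unfolding rz[symmetric] by auto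
qed

lemma csubfield_adjoin:
  assumes E: "csubfield E" and q: "min_poly_over E z q"
  shows "csubfield (adjoin E z)"
proof -
  note I = poly_over_intros[OF E]
  have A: "poly h z \<in> adjoin E z" if "poly_over E h" for h using that by (auto simp: adjoin_def)
  have inv: "inverse x \<in> adjoin E z" if x: "x \<in> adjoin E z" for x
  proof (cases "x = 0")
    case False
    obtain h where h: "poly_over E h" "x = poly h z" using x by (auto simp: adjoin_def)
    then obtain b where "poly_over E b" "poly b z * x = 1" using adjoin_inverse[OF E q h(1)] False by auto
    thus ?thesis using A[of b] by (metis inverse_unique mult.commute)
  qed (use A[of 0] I in auto)
  show ?thesis unfolding csubfield_def
  proof (intro conjI ballI inv)
    show "0 \<in> adjoin E z" using A[of 0] I by simp
    show "1 \<in> adjoin E z" using A[of 1] I by simp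
    show "x + y \<in> adjoin E z" if "x \<in> adjoin E z" "y \<in> adjoin E z" for x y
      using that A I(6) unfolding adjoin_def mem_Collect_eq by (metis poly_add)
    show "x * y \<in> adjoin E z" if "x \<in> adjoin E z" "y \<in> adjoin E z" for x y
      using that A I(9) unfolding adjoin_def mem_Collect_eq by (metis poly_mult)
    show "- x \<in> adjoin E z" if "x \<in> adjoin E z" for x
      using that A I(8) unfolding adjoin_def mem_Collect_eq by (metis poly_minus)
  qed
qed

text \<open>The extension evaluates at \<open>z'\<close> instead of \<open>z\<close>. Polynomials
  over \<open>E\<close> that agree at \<open>z\<close> differ by a multiple of \<open>q\<close>,
  whose image vanishes at \<open>z'\<close>; so the choice of the representative is
  harmless.\<close>

lemma hom_on_adjoin:
  assumes E: "csubfield E" and h: "hom_on E \<tau>" and q: "min_poly_over E z q"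
    and z': "poly (map_poly \<tau> q) z' = 0"
  obtains \<tau>' where "hom_on (adjoin E z) \<tau>'" "\<And>x. x \<in> E \<Longrightarrow> \<tau>' x = \<tau> x"
    "\<And>p. poly_over E p \<Longrightarrow> \<tau>' (poly p z) = poly (map_poly \<tau> p) z'"
proof -
  note I = poly_over_intros[OF E] and hE = hom_onD[OF E h]
  define \<tau>' where "\<tau>' x = poly (map_poly \<tau> (SOME p. poly_over E p \<and> poly p z = x)) z'" for x
  have eval: "\<tau>' (poly p z) = poly (map_poly \<tau> p) z'" if p: "poly_over E p" for p
  proof -
    define p' where "p' = (SOME p'. poly_over E p' \<and> poly p' z = poly p z)"
    have p': "poly_over E p' \<and> poly p' z = poly p z"
      unfolding p'_def by (rule someI[of _ p]) (use p in simp)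
    have d: "poly_over E (p' - p)" "poly (p' - p) z = 0" using p p' I by auto
    then obtain s where s: "poly_over E s" "p' - p = q * s" using min_poly_over_dvd[OF E q] by blast
    have "map_poly \<tau> p' - map_poly \<tau> p = map_poly \<tau> (p' - p)"
      using hom_on_map_poly(2)[OF E h] p p' by simp
    also have "\<dots> = map_poly \<tau> q * map_poly \<tau> s"
      unfolding s using hom_on_map_poly(3)[OF E h _ s(1)] q by (simp add: min_poly_over_def)
    finally have "poly (map_poly \<tau> p' - map_poly \<tau> p) z' = 0" using z' by simp
    thus ?thesis unfolding \<tau>'_def p'_def[symmetric] by simp
  qed
  show ?thesis
  proof (rule that[of \<tau>'])
    show "hom_on (adjoin E z) \<tau>'" unfolding hom_on_def
    proof (intro conjI ballI)
      show "\<tau>' 1 = 1" using eval[of 1] I hE by (simp add: map_poly_1)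
      fix x y assume "x \<in> adjoin E z" "y \<in> adjoin E z"
      then obtain p r where pr: "poly_over E p" "x = poly p z" "poly_over E r" "y = poly r z"
        by (auto simp: adjoin_def)
      show "\<tau>' (x + y) = \<tau>' x + \<tau>' y" unfolding pr poly_add[symmetric]
        using eval[of "p + r"] pr I by (simp add: eval hom_on_map_poly[OF E h])
      show "\<tau>' (x * y) = \<tau>' x * \<tau>' y" unfolding pr poly_mult[symmetric]
        using eval[of "p * r"] pr I by (simp add: eval hom_on_map_poly[OF E h])
    qed
    show "\<tau>' x = \<tau> x" if "x \<in> E" for x
      using eval[of "[:x:]"] that I by (simp add: hom_on_map_const[OF E h])
  qed (rule eval)
qed

section \<open>Generated subfields and homomorphisms on them\<close>

definition gen_field :: "complex set \<Rightarrow> complex set" where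
  "gen_field H = \<Inter>{F. csubfield F \<and> H \<subseteq> F}"

lemma csubfield_gen_field: "csubfield (gen_field H)"
  unfolding gen_field_def by (rule csubfield_Inter) simp

lemma gen_field_superset: "H \<subseteq> gen_field H"
  by (auto simp: gen_field_def)

lemma gen_field_subset: "csubfield F \<Longrightarrow> H \<subseteq> F \<Longrightarrow> gen_field H \<subseteq> F"
  by (auto simp: gen_field_def)

lemma gen_field_eqI: "csubfield F \<Longrightarrow> H \<subseteq> F \<Longrightarrow> F \<subseteq> gen_field H \<Longrightarrow> gen_field H = F"
  using gen_field_subset by blast

lemma gen_field_adjoin:
  assumes E: "csubfield E" and q: "min_poly_over E z q"
  shows "gen_field (adjoin E z \<union> Z) = gen_field (E \<union> insert z Z)"
proof
  have "adjoin E z \<subseteq> gen_field (E \<union> insert z Z)"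
    by (rule adjoin_subset) (use csubfield_gen_field gen_field_superset[of "E \<union> insert z Z"] in auto)
  thus "gen_field (adjoin E z \<union> Z) \<subseteq> gen_field (E \<union> insert z Z)"
    using gen_field_superset[of "E \<union> insert z Z"] by (intro gen_field_subset csubfield_gen_field) auto
  show "gen_field (E \<union> insert z Z) \<subseteq> gen_field (adjoin E z \<union> Z)"
    using gen_field_superset[of "adjoin E z \<union> Z"] adjoin_superset[OF E, of z]
    by (intro gen_field_subset csubfield_gen_field) auto
qed

text \<open>The elements of \<open>Z\<close> are adjoined one at a time; by the fundamental theorem
  of algebra the image of each minimal polynomial has a root to which the new element can be
  sent.\<close>

lemma hom_on_extend:
  assumes "finite Z" "csubfield E" "hom_on E \<tau>"
    and "\<And>z. z \<in> Z \<Longrightarrow> \<exists>p. poly_over E p \<and> p \<noteq> 0 \<and> poly p z = 0"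
  shows "\<exists>\<tau>'. hom_on (gen_field (E \<union> Z)) \<tau>' \<and> (\<forall>x\<in>E. \<tau>' x = \<tau> x)"
  using assms
proof (induction Z arbitrary: E \<tau> rule: finite_induct)
  case empty
  have "gen_field E = E" using empty by (intro gen_field_eqI gen_field_superset) auto
  thus ?case using empty by auto
next
  case (insert z Z)
  note E = insert.prems(1) and h = insert.prems(2)
  obtain q where q: "min_poly_over E z q" using insert.prems(3)[of z] min_poly_over_exists by blast
  have "degree (map_poly \<tau> q) = degree q"
    using q by (intro hom_on_degree[OF E h]) (simp add: min_poly_over_def)
  hence "degree (map_poly \<tau> q) > 0" using min_poly_over_degree[OF q] by simp
  then obtain z' where "poly (map_poly \<tau> q) z' = 0"
    using fundamental_theorem_of_algebra constant_degree by (metis less_numeral_extra(3))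
  then obtain \<tau>1 where \<tau>1: "hom_on (adjoin E z) \<tau>1" "\<And>x. x \<in> E \<Longrightarrow> \<tau>1 x = \<tau> x"
    using hom_on_adjoin[OF E h q] by metis
  have sup: "E \<subseteq> adjoin E z" using adjoin_superset[OF E] by auto
  obtain \<tau>' where "hom_on (gen_field (adjoin E z \<union> Z)) \<tau>'" "\<forall>x\<in>adjoin E z. \<tau>' x = \<tau>1 x"
    using insert.IH[OF csubfield_adjoin[OF E q] \<tau>1(1)] insert.prems(3) poly_over_mono[OF _ sup]
    by (meson insertCI)
  thus ?case using \<tau>1(2) sup unfolding gen_field_adjoin[OF E q] by (metis subsetD)
qed

text \<open>
  The identity is kept up to the first adjunction that contains \<open>x\<close>. There the adjoined root is sent to
  another root of its minimal polynomial, chosen so that \<open>x\<close> moves; separability provides enough roots.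
\<close>
lemma hom_on_moving:
  assumes "finite Z" "csubfield E"
    and "\<And>z. z \<in> Z \<Longrightarrow> \<exists>p. poly_over E p \<and> rsquarefree p \<and> poly p z = 0"
    and "x \<in> gen_field (E \<union> Z)" "x \<notin> E"
  shows "\<exists>\<tau>. hom_on (gen_field (E \<union> Z)) \<tau> \<and> (\<forall>y\<in>E. \<tau> y = y) \<and> \<tau> x \<noteq> x"
  using assms
proof (induction Z arbitrary: E rule: finite_induct)
  case empty
  have "gen_field E = E" using empty by (intro gen_field_eqI gen_field_superset) auto
  thus ?case using empty by auto
next
  case (insert z Z)
  note E = insert.prems(1) and I = poly_over_intros[OF insert.prems(1)]
  obtain p where p: "poly_over E p" "rsquarefree p" "poly p z = 0" using insert.prems(2)[of z] by blast
  obtain q where q: "min_poly_over E z q" using p min_poly_over_exists[of E p z]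
    by (auto simp: rsquarefree_def)
  have qo: "poly_over E q" "q \<noteq> 0" "poly q z = 0" using q by (auto simp: min_poly_over_def)
  have sup: "E \<subseteq> adjoin E z" using adjoin_superset[OF E] by auto
  have E': "csubfield (adjoin E z)" by (rule csubfield_adjoin[OF E q])
  have Z': "\<exists>p. poly_over (adjoin E z) p \<and> rsquarefree p \<and> poly p w = 0" if "w \<in> Z" for w
    using insert.prems(2)[of w] that poly_over_mono[OF _ sup] by (meson insertCI)
  show ?case
  proof (cases "x \<in> adjoin E z")
    case False
    thus ?thesis using insert.IH[OF E' Z'] insert.prems(3) sup unfolding gen_field_adjoin[OF E q]
      by blast
  next
    case True
    then obtain h0 where h0: "poly_over E h0" "x = poly h0 z" by (auto simp: adjoin_def)
    obtain s h where sh: "poly_over E s" "poly_over E h" "h0 = q * s + h" "h = 0 \<or> degree h < degree q"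
      using poly_over_division[OF E qo(1,2) h0(1)] by blast
    have x: "x = poly h z" using h0 sh qo by simp
    have dq: "degree q > 0" by (rule min_poly_over_degree[OF q])
    \<comment> \<open>The zeros of \<open>g\<close> are the choices of \<open>z'\<close> that would
      leave \<open>x\<close> fixed. Reduction modulo \<open>q\<close> has made the degree smaller
      than that of \<open>q\<close>.\<close>
    define g where "g = h - [:x:]"
    have g0: "g \<noteq> 0"
    proof
      assume "g = 0"
      hence "coeff h 0 = x" by (simp add: g_def)
      thus False using sh(2) insert.prems(4) by (auto simp: poly_over_def)
    qed
    have dg: "degree g < degree q" unfolding g_def using sh(4) dq by (intro degree_diff_less) auto
    \<comment> \<open>As a divisor of \<open>p\<close>, \<open>q\<close> has simple roots only, and
      therefore more roots than \<open>g\<close>.\<close>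
    obtain t where "p = q * t" using min_poly_over_dvd[OF E q p(1,3)] by blast
    hence "order a p = order a q + order a t" for a
      using p(2) by (simp add: order_mult rsquarefree_def)
    moreover have "order a p = 0 \<or> order a p = 1" for a
      using p(2) unfolding rsquarefree_def by blast
    ultimately have "order a q = 0 \<or> order a q = 1" for a
      by (metis (mono_tags) le_add1 le_zero_eq le_eq_less_or_eq less_one)
    hence "rsquarefree q" using qo(2) unfolding rsquarefree_def by blast
    hence "card {w. poly q w = 0} = degree q"
      by (metis rsquarefree_card_degree qo(2))
    moreover have "card {w. poly g w = 0} \<le> degree g" using g0 by (rule poly_roots_degree)
    ultimately have "\<not> {w. poly q w = 0} \<subseteq> {w. poly g w = 0}"
      using dg card_mono[OF poly_roots_finite[OF g0]] by (metis leD order.trans)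
    then obtain z' where z': "poly q z' = 0" "poly h z' \<noteq> x" by (auto simp: g_def)
    have mid: "map_poly (\<lambda>x. x) r = r" for r :: "complex poly" by (rule poly_eqI) (simp add: coeff_map_poly)
    obtain \<tau>1 where \<tau>1: "hom_on (adjoin E z) \<tau>1" "\<And>x. x \<in> E \<Longrightarrow> \<tau>1 x = x"
      "\<And>p. poly_over E p \<Longrightarrow> \<tau>1 (poly p z) = poly p z'"
      using hom_on_adjoin[OF E hom_on_id q, of z'] z'(1) unfolding mid by metis
    have Z'': "\<exists>p. poly_over (adjoin E z) p \<and> p \<noteq> 0 \<and> poly p w = 0" if "w \<in> Z" for w
      using Z'[OF that] by (auto simp: rsquarefree_def)
    obtain \<tau>' where "hom_on (gen_field (adjoin E z \<union> Z)) \<tau>'" "\<forall>x\<in>adjoin E z. \<tau>' x = \<tau>1 x"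
      using hom_on_extend[OF insert.hyps(1) E' \<tau>1(1) Z''] by auto
    moreover have "\<tau>1 x \<noteq> x" using \<tau>1(3)[OF sh(2)] z'(2) x by simp
    ultimately show ?thesis using \<tau>1(2) sup True unfolding gen_field_adjoin[OF E q] by (metis subsetD)
  qed
qed

section \<open>The fixed field of the Galois group\<close>

lemma ring_of_type_algebra_simps [simp]:
  "carrier ring_of_type_algebra = UNIV" "mult ring_of_type_algebra = (*)" "monoid.one ring_of_type_algebra = 1"
  "ring.zero ring_of_type_algebra = 0" "ring.add ring_of_type_algebra = (+)"
  by (simp_all add: ring_of_type_algebra_def)

lemma field_complex: "Ring.field (ring_of_type_algebra :: complex ring)"
  by (rule field_from_type_algebra)

lemma a_inv_complex: "a_inv (ring_of_type_algebra :: complex ring) x = - x"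
proof -
  interpret Ring.field "ring_of_type_algebra :: complex ring" by (rule field_complex)
  show ?thesis by (rule minus_equality) auto
qed

lemma m_inv_complex: "x \<noteq> 0 \<Longrightarrow> m_inv (ring_of_type_algebra :: complex ring) x = inverse x"
proof -
  assume "x \<noteq> 0"
  interpret Ring.field "ring_of_type_algebra :: complex ring" by (rule field_complex)
  show ?thesis by (rule comm_inv_char) (use \<open>x \<noteq> 0\<close> in auto)
qed

text \<open>Replaces the inductive closure by an intersection of subfields, for which an inclusion
  need only be checked on generators.\<close>

lemma generate_field_eq_gen_field: "generate_field ring_of_type_algebra H = gen_field H"
proof
  let ?G = "generate_field ring_of_type_algebra H"
  note G = generate_field.intros[where R = "ring_of_type_algebra :: complex ring" and H = H, simplified]
  have "csubfield ?G" unfolding csubfield_def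
  proof (intro conjI ballI)
    show "1 \<in> ?G" using G(1) .
    show neg: "- x \<in> ?G" if "x \<in> ?G" for x using G(3)[OF that] by (simp add: a_inv_complex)
    show add: "x + y \<in> ?G" if "x \<in> ?G" "y \<in> ?G" for x y using G(5)[OF that] .
    show "x * y \<in> ?G" if "x \<in> ?G" "y \<in> ?G" for x y using G(6)[OF that] .
    show 0: "0 \<in> ?G" using add[OF G(1) neg[OF G(1)]] by simp
    show "inverse x \<in> ?G" if "x \<in> ?G" for x
      using G(4)[OF that] 0 by (cases "x = 0") (auto simp: m_inv_complex)
  qed
  thus "gen_field H \<subseteq> ?G" by (rule gen_field_subset) (use G(2) in auto)
  show "?G \<subseteq> gen_field H"
  proof
    fix x assume "x \<in> ?G"
    thus "x \<in> gen_field H"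
      by induction (use csubfieldD[OF csubfield_gen_field[of H]] gen_field_superset[of H]
          in \<open>auto simp: a_inv_complex m_inv_complex\<close>)
  qed
qed

definition root_field :: "rat poly \<Rightarrow> complex set" where
  "root_field f = gen_field (\<rat> \<union> complex_roots f)"

lemma csubfield_root_field: "csubfield (root_field f)"
  by (simp add: root_field_def csubfield_gen_field)

lemma complex_roots_subset: "complex_roots f \<subseteq> root_field f"
  using gen_field_superset[of "\<rat> \<union> complex_roots f"] by (auto simp: root_field_def)

lemma carrier_splitting_field: "carrier (splitting_field f) = root_field f"
  by (simp add: splitting_field_def root_field_def generate_field_eq_gen_field)

lemma galois_automorphisms_alt:
  "\<sigma> \<in> galois_automorphisms f \<longleftrightarrow>
     hom_on (root_field f) \<sigma> \<and> bij_betw \<sigma> (root_field f) (root_field f)"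
proof -
  have "\<sigma> \<in> ring_iso (splitting_field f) (splitting_field f) \<longleftrightarrow>
      hom_on (root_field f) \<sigma> \<and> bij_betw \<sigma> (root_field f) (root_field f)"
    unfolding ring_iso_def Ring.ring_hom_def carrier_splitting_field hom_on_def bij_betw_def
    by (auto simp: splitting_field_def Pi_iff)
  thus ?thesis using hom_on_Rats[OF csubfield_root_field] by (auto simp: galois_automorphisms_def)
qed

lemma finite_complex_roots: "f \<noteq> 0 \<Longrightarrow> finite (complex_roots f)"
  unfolding complex_roots_def by (rule poly_roots_finite) simp

lemma poly_over_of_rat: "\<rat> \<subseteq> E \<Longrightarrow> poly_over E (map_poly of_rat f)"
  unfolding poly_over_def by (auto simp: coeff_map_poly)

lemma hom_on_roots:
  assumes E: "csubfield E" "hom_on E \<tau>" and z: "z \<in> complex_roots f" "z \<in> E"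
  shows "\<tau> z \<in> complex_roots f"
proof -
  have "map_poly \<tau> (map_poly of_rat f) = map_poly of_rat f"
    by (rule poly_eqI) (simp add: coeff_map_poly hom_onD[OF E] hom_on_Rats[OF E])
  thus ?thesis using hom_on_poly[OF E poly_over_of_rat[OF Rats_subset_csubfield[OF E(1)]] z(2), of f] z(1)
    by (simp add: complex_roots_def hom_onD[OF E])
qed

text \<open>Normality of the splitting field. An injective map of the finite set of roots into
  itself permutes it. The elements that \<open>\<tau>\<close> sends into the field form a subfield,
  and so does the image of \<open>\<tau>\<close>; both contain the generators, which gives the two
  inclusions.\<close>

lemma hom_on_root_field_automorphism:
  assumes f: "f \<noteq> 0" and h: "hom_on (root_field f) \<tau>"
  shows "\<tau> \<in> galois_automorphisms f"
proof -
  note S = csubfield_root_field[of f] and sub = complex_roots_subset[of f]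
  have QS: "\<rat> \<subseteq> root_field f" by (rule Rats_subset_csubfield[OF S])
  have inj: "inj_on \<tau> (root_field f)" by (rule hom_on_inj[OF S h])
  have "\<tau> ` complex_roots f \<subseteq> complex_roots f" using hom_on_roots[OF S h] sub by auto
  hence rts: "\<tau> ` complex_roots f = complex_roots f"
    using endo_inj_surj[OF finite_complex_roots[OF f]] inj_on_subset[OF inj sub] by blast
  have "csubfield {x\<in>root_field f. \<tau> x \<in> root_field f}"
    using S by (auto simp: csubfield_def hom_onD[OF S h])
  hence "root_field f \<subseteq> {x\<in>root_field f. \<tau> x \<in> root_field f}"
    unfolding root_field_def
    using QS rts sub hom_on_Rats[OF S h] by (intro gen_field_subset) (auto simp: root_field_def)
  hence into: "\<tau> ` root_field f \<subseteq> root_field f" by auto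
  have im: "csubfield (\<tau> ` root_field f)"
    unfolding csubfield_def
  proof (intro conjI ballI)
    show "0 \<in> \<tau> ` root_field f" "1 \<in> \<tau> ` root_field f"
      using csubfieldD(1,2)[OF S] hom_onD(1,2)[OF S h] by (metis image_eqI)+
    fix x assume "x \<in> \<tau> ` root_field f"
    then obtain a where a: "a \<in> root_field f" "x = \<tau> a" by auto
    show "- x \<in> \<tau> ` root_field f" "inverse x \<in> \<tau> ` root_field f"
      using a csubfieldD(5,6)[OF S a(1)] hom_onD(5,6)[OF S h a(1)] by (metis image_eqI)+
    fix y assume "y \<in> \<tau> ` root_field f"
    then obtain b where b: "b \<in> root_field f" "y = \<tau> b" by auto
    show "x + y \<in> \<tau> ` root_field f" "x * y \<in> \<tau> ` root_field f"
      using a b csubfieldD(3,4)[OF S a(1) b(1)] hom_onD(3,4)[OF S h a(1) b(1)] by (metis image_eqI)+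
  qed
  have "root_field f \<subseteq> \<tau> ` root_field f"
  proof -
    have "complex_roots f \<subseteq> \<tau> ` root_field f" using rts sub by blast
    thus ?thesis using im Rats_subset_csubfield[OF im] unfolding root_field_def
      by (intro gen_field_subset) auto
  qed
  thus ?thesis using into inj h by (auto simp: galois_automorphisms_alt bij_betw_def)
qed

text \<open>A non-rational \<open>x\<close> would be moved by a homomorphism defined on the
  splitting field, by \<open>hom_on_moving\<close> over the rationals, and this homomorphism is an
  automorphism by normality.\<close>

lemma galois_fixed_field:
  assumes f: "separable_poly f" and x: "x \<in> root_field f"
    and fixed: "\<And>\<sigma>. \<sigma> \<in> galois_automorphisms f \<Longrightarrow> \<sigma> x = x"
  shows "x \<in> \<rat>"
proof (rule ccontr)
  assume "x \<notin> \<rat>"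
  have f0: "f \<noteq> 0" using f by (auto simp: separable_poly_def rsquarefree_def)
  have "\<exists>\<tau>. hom_on (gen_field (\<rat> \<union> complex_roots f)) \<tau> \<and> (\<forall>y\<in>\<rat>. \<tau> y = y) \<and> \<tau> x \<noteq> x"
  proof (rule hom_on_moving)
    show "\<exists>p. poly_over \<rat> p \<and> rsquarefree p \<and> poly p z = 0" if "z \<in> complex_roots f" for z
      using that f poly_over_of_rat[of \<rat> f] unfolding complex_roots_def separable_poly_def by blast
  qed (use x \<open>x \<notin> \<rat>\<close> finite_complex_roots[OF f0] csubfield_Rats in \<open>auto simp: root_field_def\<close>)
  then obtain \<tau> where "hom_on (root_field f) \<tau>" "\<tau> x \<noteq> x" by (auto simp: root_field_def)
  thus False using fixed[OF hom_on_root_field_automorphism[OF f0]] by blast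
qed

lemma cnj_galois_automorphism:
  assumes "f \<noteq> 0" shows "cnj \<in> galois_automorphisms f"
  by (rule hom_on_root_field_automorphism[OF assms hom_on_cnj])

lemma galois_automorphism_roots:
  assumes f: "f \<noteq> 0" and \<sigma>: "\<sigma> \<in> galois_automorphisms f"
  shows "\<sigma> ` complex_roots f = complex_roots f" "inj_on \<sigma> (complex_roots f)"
    "(\<lambda>z. if z \<in> complex_roots f then \<sigma> z else z) \<in> galois_group f"
proof -
  note S = csubfield_root_field[of f] and sub = complex_roots_subset[of f]
  have h: "hom_on (root_field f) \<sigma>" using \<sigma> by (simp add: galois_automorphisms_alt)
  show inj: "inj_on \<sigma> (complex_roots f)" using hom_on_inj[OF S h] sub by (rule inj_on_subset)
  have "\<sigma> ` complex_roots f \<subseteq> complex_roots f" using hom_on_roots[OF S h] sub by auto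
  thus im: "\<sigma> ` complex_roots f = complex_roots f"
    using endo_inj_surj[OF finite_complex_roots[OF f]] inj by blast
  have "bij_betw (\<lambda>z. if z \<in> complex_roots f then \<sigma> z else z) (complex_roots f) (complex_roots f)"
    using inj im by (subst bij_betw_cong[where g = \<sigma>]) (auto simp: bij_betw_def)
  hence "(\<lambda>z. if z \<in> complex_roots f then \<sigma> z else z) permutes complex_roots f"
    by (rule bij_imp_permutes) auto
  thus "(\<lambda>z. if z \<in> complex_roots f then \<sigma> z else z) \<in> galois_group f"
    using \<sigma> by (auto simp: galois_group_def)
qed

section \<open>The ring of integers attached to a block system\<close>

text \<open>If the \<open>u i\<close> are the conjugates of a generator of a number field, these are
  the conjugate tuples of its integers: a single rational polynomial \<open>h\<close> serves all
  coordinates. The set depends on \<open>u\<close> alone.\<close>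

definition integral_span :: "nat \<Rightarrow> (nat \<Rightarrow> complex) \<Rightarrow> (nat \<Rightarrow> complex) set" where
  "integral_span N u = {w. (\<forall>i\<ge>N. w i = 0) \<and> (\<forall>i<N. algebraic_int (w i)) \<and>
     (\<exists>h. poly_over \<rat> h \<and> (\<forall>i<N. w i = poly h (u i)))}"

text \<open>
  The image of the ring of integers of a number field of degree \<open>N\<close> under its \<open>N\<close> embeddings.
  The map \<open>\<tau>\<close> pairs each embedding with its complex conjugate.
\<close>
definition conj_order :: "nat \<Rightarrow> (nat \<Rightarrow> complex) set \<Rightarrow> bool" where
  "conj_order N \<O> \<longleftrightarrow>
     (\<forall>w\<in>\<O>. \<forall>i\<ge>N. w i = 0) \<and>
     (\<forall>w\<in>\<O>. \<forall>w'\<in>\<O>. (\<lambda>i. w i - w' i) \<in> \<O>) \<and>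
     (\<forall>w\<in>\<O>. \<forall>k. coeff (\<Prod>i<N. [:- w i, 1:]) k \<in> \<int>) \<and>
     (\<forall>w\<in>\<O>. \<forall>i<N. w i = 0 \<longrightarrow> (\<forall>k<N. w k = 0)) \<and>
     (\<forall>w\<in>\<O>. \<forall>i<N. (\<forall>k<N. k \<noteq> i \<longrightarrow> w k \<noteq> w i) \<longrightarrow> inj_on w {..<N}) \<and>
     (\<exists>\<tau>. (\<forall>i<N. \<tau> i < N \<and> \<tau> (\<tau> i) = i) \<and> (\<forall>w\<in>\<O>. \<forall>i<N. w (\<tau> i) = cnj (w i))) \<and>
     (\<forall>u\<in>\<O>. inj_on u {..<N} \<longrightarrow> \<O> = integral_span N u)"

lemma algebraic_int_coeff_prod_linear:
  fixes z :: "'i \<Rightarrow> complex"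
  assumes "\<And>i. i \<in> I \<Longrightarrow> algebraic_int (z i)"
  shows "algebraic_int (coeff (\<Prod>i\<in>I. [:- z i, 1:]) k)"
  using assms
proof (induction I arbitrary: k rule: infinite_finite_induct)
  case (insert i I)
  have "algebraic_int (- (z i * coeff (\<Prod>i\<in>I. [:- z i, 1:]) k) + coeff (pCons 0 (\<Prod>i\<in>I. [:- z i, 1:])) k)"
    using insert by (intro algebraic_int_add algebraic_int_minus algebraic_int_mult)
      (auto simp: coeff_pCons split: nat.splits)
  thus ?case using insert by simp
qed (auto simp: coeff_1)

text \<open>The action is that of automorphisms, not of the induced permutations of the roots, since
  the maps also have to act on the coefficients of the block polynomials.\<close>

locale block_system =
  fixes f :: "rat poly" and N :: nat and \<Lambda> :: "nat \<Rightarrow> complex set"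
  assumes sep: "separable_poly f"
    and monic: "lead_coeff f = 1" and integral: "\<And>k. coeff f k \<in> \<int>"
    and block_nonempty: "\<And>i. i < N \<Longrightarrow> \<Lambda> i \<noteq> {}"
    and block_disjoint: "\<And>i k. i < N \<Longrightarrow> k < N \<Longrightarrow> i \<noteq> k \<Longrightarrow> \<Lambda> i \<inter> \<Lambda> k = {}"
    and block_cover: "(\<Union>i<N. \<Lambda> i) = complex_roots f"
    and block_perm: "\<And>\<sigma> i. \<sigma> \<in> galois_automorphisms f \<Longrightarrow> i < N \<Longrightarrow> \<exists>k<N. \<sigma> ` \<Lambda> i = \<Lambda> k"
    and block_trans: "\<And>i k. i < N \<Longrightarrow> k < N \<Longrightarrow> \<exists>\<sigma>\<in>galois_automorphisms f. \<sigma> ` \<Lambda> i = \<Lambda> k"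
begin

abbreviation "S \<equiv> root_field f"
abbreviation "\<G> \<equiv> galois_automorphisms f"

lemmas S = csubfield_root_field[of f]

lemma f_nz: "f \<noteq> 0" using monic by auto

lemma hom: "\<sigma> \<in> \<G> \<Longrightarrow> hom_on S \<sigma>" by (simp add: galois_automorphisms_alt)

lemma block_subset: "i < N \<Longrightarrow> \<Lambda> i \<subseteq> complex_roots f" using block_cover by auto

lemma finite_block: "i < N \<Longrightarrow> finite (\<Lambda> i)"
  using block_subset finite_complex_roots[OF f_nz] finite_subset by blast

lemma block_inj: "i < N \<Longrightarrow> k < N \<Longrightarrow> \<Lambda> i = \<Lambda> k \<Longrightarrow> i = k"
  using block_disjoint block_nonempty by blast

definition act :: "(complex \<Rightarrow> complex) \<Rightarrow> nat \<Rightarrow> nat" where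
  "act \<sigma> i = (SOME k. k < N \<and> \<sigma> ` \<Lambda> i = \<Lambda> k)"

lemma act: assumes "\<sigma> \<in> \<G>" "i < N" shows "act \<sigma> i < N" "\<sigma> ` \<Lambda> i = \<Lambda> (act \<sigma> i)"
  using someI_ex[OF block_perm[OF assms, unfolded Bex_def]] by (auto simp: act_def)

lemma act_eqI: "\<sigma> \<in> \<G> \<Longrightarrow> i < N \<Longrightarrow> k < N \<Longrightarrow> \<sigma> ` \<Lambda> i = \<Lambda> k \<Longrightarrow> act \<sigma> i = k"
  using act block_inj by metis

lemma act_bij: assumes "\<sigma> \<in> \<G>" shows "bij_betw (act \<sigma>) {..<N} {..<N}"
proof -
  have "inj_on (act \<sigma>) {..<N}"
  proof (rule inj_onI)
    fix i k assume ik: "i \<in> {..<N}" "k \<in> {..<N}" "act \<sigma> i = act \<sigma> k"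
    hence "\<sigma> ` \<Lambda> i = \<sigma> ` \<Lambda> k" using act[OF assms] by simp
    hence "\<Lambda> i = \<Lambda> k"
      using galois_automorphism_roots(2)[OF f_nz assms] block_subset ik
      by (subst (asm) inj_on_image_eq_iff) auto
    thus "i = k" using block_inj ik by auto
  qed
  moreover have "act \<sigma> ` {..<N} \<subseteq> {..<N}" using act[OF assms] by auto
  ultimately show ?thesis by (simp add: bij_betw_def endo_inj_surj)
qed

text \<open>Equivariance makes \<open>w\<close> determined by one coordinate, which is fixed by the
  stabiliser of its block; conversely, each integer of that fixed field gives such a tuple. The
  stabiliser has index \<open>N\<close>, so this is the ring of integers of a field of degree
  \<open>N\<close>.\<close>

definition order_ring :: "(nat \<Rightarrow> complex) set" where
  "order_ring = {w. (\<forall>i\<ge>N. w i = 0) \<and> (\<forall>i<N. w i \<in> S \<and> algebraic_int (w i)) \<and>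
     (\<forall>\<sigma>\<in>\<G>. \<forall>i<N. \<sigma> (w i) = w (act \<sigma> i))}"

lemma fixed_poly_rational:
  assumes p: "poly_over S p" and fixed: "\<And>\<sigma>. \<sigma> \<in> \<G> \<Longrightarrow> map_poly \<sigma> p = p"
  shows "poly_over \<rat> p"
  unfolding poly_over_def
proof
  fix k
  show "coeff p k \<in> \<rat>"
  proof (rule galois_fixed_field[OF sep])
    fix \<sigma> assume s: "\<sigma> \<in> \<G>"
    have "coeff (map_poly \<sigma> p) k = \<sigma> (coeff p k)" by (simp add: coeff_map_poly hom_onD[OF S hom[OF s]])
    thus "\<sigma> (coeff p k) = coeff p k" using fixed[OF s] by simp
  qed (use p in \<open>simp add: poly_over_def\<close>)
qed

text \<open>Automorphisms permute the linear factors, so the coefficients are rational; they are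
  also algebraic integers.\<close>

lemma order_ring_charpoly:
  assumes w: "w \<in> order_ring" shows "coeff (\<Prod>i<N. [:- w i, 1:]) k \<in> \<int>"
proof (rule rational_algebraic_int_is_int)
  show "algebraic_int (coeff (\<Prod>i<N. [:- w i, 1:]) k)"
    using w by (intro algebraic_int_coeff_prod_linear) (auto simp: order_ring_def)
  have "poly_over \<rat> (\<Prod>i<N. [:- w i, 1:])"
  proof (rule fixed_poly_rational)
    show "poly_over S (\<Prod>i<N. [:- w i, 1:])"
      using w by (intro poly_over_prod[OF S] poly_over_intros[OF S]) (auto simp: order_ring_def intro: csubfieldD[OF S])
    fix \<sigma> assume s: "\<sigma> \<in> \<G>"
    have "map_poly \<sigma> (\<Prod>i<N. [:- w i, 1:]) = (\<Prod>i<N. [:- \<sigma> (w i), 1:])"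
      using w by (intro map_poly_prod_linear[OF S hom[OF s]]) (auto simp: order_ring_def)
    also have "\<dots> = (\<Prod>i<N. [:- w (act \<sigma> i), 1:])"
      using w s by (intro prod.cong) (auto simp: order_ring_def)
    also have "\<dots> = (\<Prod>i<N. [:- w i, 1:])"
      by (rule prod.reindex_bij_betw[OF act_bij[OF s]])
    finally show "map_poly \<sigma> (\<Prod>i<N. [:- w i, 1:]) = (\<Prod>i<N. [:- w i, 1:])" .
  qed
  thus "coeff (\<Prod>i<N. [:- w i, 1:]) k \<in> \<rat>" by (simp add: poly_over_def)
qed

text \<open>Lagrange interpolation with nodes \<open>u i\<close> and values \<open>w i\<close>. An
  automorphism permutes nodes and values alike, hence merely permutes the summands, so the
  interpolating polynomial is rational.\<close>

lemma order_ring_interpolation: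
  assumes u: "u \<in> order_ring" "inj_on u {..<N}" and w: "w \<in> order_ring"
  shows "\<exists>h. poly_over \<rat> h \<and> (\<forall>i<N. w i = poly h (u i))"
proof -
  define lag where "lag i = (\<Prod>k\<in>{..<N} - {i}. [:- u k, 1:])" for i
  define c where "c i = w i / poly (lag i) (u i)" for i
  define h where "h = (\<Sum>i<N. Polynomial.smult (c i) (lag i))"
  have uS: "u i \<in> S" and wS: "w i \<in> S" if "i < N" for i using u w that by (auto simp: order_ring_def)
  have lagS: "poly_over S (lag i)" for i unfolding lag_def
    using uS by (intro poly_over_prod[OF S] poly_over_intros[OF S]) (auto intro: csubfieldD[OF S])
  have cS: "c i \<in> S" if "i < N" for i unfolding c_def
    using wS uS that lagS by (intro csubfieldD(8)[OF S] poly_over_eval[OF S]) auto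
  have lag0: "poly (lag i) (u k) = 0" if "i < N" "k < N" "i \<noteq> k" for i k
    using that by (auto simp: lag_def poly_prod)
  have lag1: "poly (lag i) (u i) \<noteq> 0" if "i < N" for i
    using that u(2) by (auto simp: lag_def poly_prod inj_on_def)
  have eval: "w i = poly h (u i)" if i: "i < N" for i
  proof -
    have "poly h (u i) = (\<Sum>k<N. c k * poly (lag k) (u i))" by (simp add: h_def poly_sum)
    also have "\<dots> = (\<Sum>k\<in>{i}. c k * poly (lag k) (u i))"
      by (rule sum.mono_neutral_right) (use i lag0 in auto)
    finally show ?thesis using lag1[OF i] by (simp add: c_def)
  qed
  have "poly_over \<rat> h"
  proof (rule fixed_poly_rational)
    show "poly_over S h" unfolding poly_over_def h_def coeff_sum coeff_smult
      using cS lagS by (intro allI csubfield_sum[OF S] csubfieldD(4)[OF S]) (auto simp: poly_over_def)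
    fix \<sigma> assume s: "\<sigma> \<in> \<G>"
    note H = hom_onD[OF S hom[OF s]]
    have lagmap: "map_poly \<sigma> (lag i) = lag (act \<sigma> i)" if i: "i < N" for i
    proof -
      have "map_poly \<sigma> (lag i) = (\<Prod>k\<in>{..<N} - {i}. [:- \<sigma> (u k), 1:])"
        unfolding lag_def using uS by (intro map_poly_prod_linear[OF S hom[OF s]]) auto
      also have "\<dots> = (\<Prod>k\<in>{..<N} - {i}. [:- u (act \<sigma> k), 1:])"
        using u(1) s by (intro prod.cong) (auto simp: order_ring_def)
      also have "\<dots> = (\<Prod>k\<in>{..<N} - {act \<sigma> i}. [:- u k, 1:])"
        using bij_betw_subset[OF act_bij[OF s], of "{..<N} - {i}"] i act_bij[OF s]
        by (intro prod.reindex_bij_betw) (auto simp: bij_betw_def inj_on_image_set_diff[of "act \<sigma>" "{..<N}"])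
      finally show ?thesis by (simp add: lag_def)
    qed
    have lagco: "\<sigma> (coeff (lag i) k) = coeff (lag (act \<sigma> i)) k" if "i < N" for i k
      unfolding lagmap[OF that, symmetric] by (simp add: coeff_map_poly H)
    have cmap: "\<sigma> (c i) = c (act \<sigma> i)" if i: "i < N" for i
    proof -
      have "poly (lag i) (u i) \<in> S" using lagS uS[OF i] by (rule poly_over_eval[OF S])
      hence "\<sigma> (c i) = \<sigma> (w i) / \<sigma> (poly (lag i) (u i))" unfolding c_def using wS[OF i] by (intro H(8))
      also have "\<sigma> (poly (lag i) (u i)) = poly (lag (act \<sigma> i)) (\<sigma> (u i))"
        using hom_on_poly[OF S hom[OF s] lagS uS[OF i]] lagmap[OF i] by simp
      finally show ?thesis using u(1) w s i by (simp add: c_def order_ring_def)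
    qed
    show "map_poly \<sigma> h = h"
    proof (rule poly_eqI)
      fix k
      have "coeff (map_poly \<sigma> h) k = \<sigma> (\<Sum>i<N. c i * coeff (lag i) k)"
        by (simp add: coeff_map_poly H(1) h_def coeff_sum)
      also have "\<dots> = (\<Sum>i<N. \<sigma> (c i * coeff (lag i) k))"
        using cS lagS by (intro hom_on_sum[OF S hom[OF s]] csubfieldD(4)[OF S]) (auto simp: poly_over_def)
      also have "\<dots> = (\<Sum>i<N. c (act \<sigma> i) * coeff (lag (act \<sigma> i)) k)"
      proof (rule sum.cong)
        fix i assume i: "i \<in> {..<N}"
        have "\<sigma> (c i * coeff (lag i) k) = \<sigma> (c i) * \<sigma> (coeff (lag i) k)"
          using cS lagS i by (intro H(4)) (auto simp: poly_over_def)
        thus "\<sigma> (c i * coeff (lag i) k) = c (act \<sigma> i) * coeff (lag (act \<sigma> i)) k"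
          using i cmap lagco by simp
      qed simp
      also have "\<dots> = (\<Sum>i<N. c i * coeff (lag i) k)" by (rule sum.reindex_bij_betw[OF act_bij[OF s]])
      finally show "coeff (map_poly \<sigma> h) k = coeff h k" by (simp add: h_def coeff_sum)
    qed
  qed
  thus ?thesis using eval by blast
qed

lemma order_ring_span:
  assumes u: "u \<in> order_ring" "inj_on u {..<N}"
  shows "order_ring = integral_span N u"
proof
  show "order_ring \<subseteq> integral_span N u"
    using order_ring_interpolation[OF u] by (auto simp: integral_span_def order_ring_def)
  show "integral_span N u \<subseteq> order_ring"
  proof
    fix w assume w: "w \<in> integral_span N u"
    then obtain h where h: "poly_over \<rat> h" "\<And>i. i < N \<Longrightarrow> w i = poly h (u i)"
      by (auto simp: integral_span_def)
    have hS: "poly_over S h" using h(1) Rats_subset_csubfield[OF S] by (rule poly_over_mono)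
    have uS: "u i \<in> S" if "i < N" for i using u that by (auto simp: order_ring_def)
    have "\<sigma> (w i) = w (act \<sigma> i)" if "\<sigma> \<in> \<G>" "i < N" for \<sigma> i
    proof -
      have "map_poly \<sigma> h = h"
        by (rule poly_eqI) (use h(1) hom_on_Rats[OF S hom[OF that(1)]] in
          \<open>simp add: coeff_map_poly hom_onD(1)[OF S hom[OF that(1)]] poly_over_def\<close>)
      moreover have "\<sigma> (u i) = u (act \<sigma> i)" using u that by (simp add: order_ring_def)
      ultimately show ?thesis
        using hom_on_poly[OF S hom[OF that(1)] hS uS[OF that(2)]] h(2) that act by simp
    qed
    thus "w \<in> order_ring" using w h(2) poly_over_eval[OF S hS uS]
      by (auto simp: order_ring_def integral_span_def)
  qed
qed

lemma conj_order_ring: "conj_order N order_ring"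
  unfolding conj_order_def
proof (intro conjI ballI allI impI)
  fix w assume w: "w \<in> order_ring"
  show "w i = 0" if "i \<ge> N" for i using w that by (simp add: order_ring_def)
  show "coeff (\<Prod>i<N. [:- w i, 1:]) k \<in> \<int>" for k by (rule order_ring_charpoly[OF w])
  show "w k = 0" if ik: "i < N" "w i = 0" "k < N" for i k
  proof -
    obtain \<sigma> where s: "\<sigma> \<in> \<G>" "\<sigma> ` \<Lambda> i = \<Lambda> k" using block_trans ik by blast
    have "\<sigma> (w i) = w (act \<sigma> i)" using w s(1) ik(1) unfolding order_ring_def by blast
    hence "\<sigma> (w i) = w k" using act_eqI[OF s(1) ik(1,3) s(2)] by simp
    thus ?thesis using hom_onD(1)[OF S hom[OF s(1)]] ik by simp
  qed
  \<comment> \<open>Transitivity moves the position \<open>k\<close> of a supposed coincidence to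
    \<open>i\<close>, where the value is known to be isolated.\<close>
  show "inj_on w {..<N}" if i: "i < N" "\<forall>k<N. k \<noteq> i \<longrightarrow> w k \<noteq> w i" for i
  proof (rule inj_onI)
    fix k l assume kl: "k \<in> {..<N}" "l \<in> {..<N}" "w k = w l"
    obtain \<sigma> where s: "\<sigma> \<in> \<G>" "\<sigma> ` \<Lambda> k = \<Lambda> i" using block_trans kl i by blast
    have "act \<sigma> k = i" using act_eqI[OF s(1) _ i(1) s(2)] kl by simp
    have "w (act \<sigma> l) = w (act \<sigma> k)" using w s kl unfolding order_ring_def mem_Collect_eq by (metis lessThan_iff)
    hence "act \<sigma> l = act \<sigma> k" using i(2) act(1)[OF s(1)] kl \<open>act \<sigma> k = i\<close> by auto
    thus "k = l" using act_bij[OF s(1)] kl by (auto simp: bij_betw_def inj_on_def)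
  qed
  fix w' assume w': "w' \<in> order_ring"
  show "(\<lambda>i. w i - w' i) \<in> order_ring"
    using w w' by (auto simp: order_ring_def hom_onD(7)[OF S hom] intro: csubfieldD[OF S] algebraic_int_diff)
next
  \<comment> \<open>Complex conjugation acts as an automorphism of the splitting field; its action
    on the block indices is the required involution.\<close>
  have c: "cnj \<in> \<G>" by (rule cnj_galois_automorphism[OF f_nz])
  have cc: "act cnj (act cnj i) = i" if "i < N" for i
  proof (rule act_eqI[OF c])
    have "cnj ` \<Lambda> (act cnj i) = cnj ` cnj ` \<Lambda> i" using act[OF c that] by simp
    also have "\<dots> = \<Lambda> i" by (simp add: image_image)
    finally show "cnj ` \<Lambda> (act cnj i) = \<Lambda> i" .
  qed (use act[OF c that] that in auto)
  show "\<exists>\<tau>. (\<forall>i<N. \<tau> i < N \<and> \<tau> (\<tau> i) = i) \<and> (\<forall>w\<in>order_ring. \<forall>i<N. w (\<tau> i) = cnj (w i))"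
  proof (intro exI[of _ "act cnj"] conjI allI impI ballI)
    show "act cnj i < N" "act cnj (act cnj i) = i" if "i < N" for i
      using act(1)[OF c that] cc[OF that] .
    show "w (act cnj i) = cnj (w i)" if "w \<in> order_ring" "i < N" for w i
    proof -
      have "\<forall>\<sigma>\<in>\<G>. \<forall>i<N. \<sigma> (w i) = w (act \<sigma> i)" using that(1) by (simp add: order_ring_def)
      hence "cnj (w i) = w (act cnj i)" using c that(2) by blast
      thus ?thesis by (rule sym)
    qed
  qed
qed (rule order_ring_span)

text \<open>The index of the coefficient comes first, so that \<open>block_coeff j\<close> is a
  tuple of conjugates indexed by the blocks.\<close>

definition block_coeff :: "nat \<Rightarrow> nat \<Rightarrow> complex" where
  "block_coeff j i = (if i < N then coeff (\<Prod>z\<in>\<Lambda> i. [:- z, 1:]) j else 0)"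

lemma of_rat_integer: "of_rat (coeff f k) \<in> (\<int> :: complex set)"
proof -
  obtain m where "coeff f k = of_int m" using integral[of k] by (auto elim: Ints_cases)
  thus ?thesis by simp
qed

lemma algebraic_int_root: "z \<in> complex_roots f \<Longrightarrow> algebraic_int z"
  by (rule algebraic_int.intros[of "map_poly of_rat f"])
    (use monic integral of_rat_integer in \<open>auto simp: complex_roots_def coeff_map_poly degree_map_poly\<close>)

lemma block_coeff_in_order_ring: "block_coeff j \<in> order_ring"
proof -
  have rS: "\<Lambda> i \<subseteq> S" if "i < N" for i using block_subset[OF that] complex_roots_subset by blast
  have "\<sigma> (block_coeff j i) = block_coeff j (act \<sigma> i)" if s: "\<sigma> \<in> \<G>" and i: "i < N" for \<sigma> i
  proof -
    have "map_poly \<sigma> (\<Prod>z\<in>\<Lambda> i. [:- z, 1:]) = (\<Prod>z\<in>\<Lambda> i. [:- \<sigma> z, 1:])"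
      using rS[OF i] by (intro map_poly_prod_linear[OF S hom[OF s]]) auto
    also have "\<dots> = (\<Prod>z\<in>\<sigma> ` \<Lambda> i. [:- z, 1:])"
      using inj_on_subset[OF galois_automorphism_roots(2)[OF f_nz s] block_subset[OF i]]
      by (simp add: prod.reindex)
    finally have "coeff (map_poly \<sigma> (\<Prod>z\<in>\<Lambda> i. [:- z, 1:])) j = coeff (\<Prod>z\<in>\<Lambda> (act \<sigma> i). [:- z, 1:]) j"
      using act[OF s i] by simp
    thus ?thesis using i act[OF s i] by (simp add: block_coeff_def coeff_map_poly hom_onD[OF S hom[OF s]])
  qed
  moreover have "block_coeff j i \<in> S" if i: "i < N" for i
  proof -
    have "poly_over S (\<Prod>z\<in>\<Lambda> i. [:- z, 1:])"
      using rS[OF i] by (intro poly_over_prod[OF S] poly_over_intros[OF S]) (auto intro: csubfieldD[OF S])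
    thus ?thesis using i by (simp add: block_coeff_def poly_over_def)
  qed
  moreover have "algebraic_int (block_coeff j i)" if i: "i < N" for i
    unfolding block_coeff_def using i block_subset[OF i]
    by (simp, intro algebraic_int_coeff_prod_linear algebraic_int_root) auto
  ultimately show ?thesis by (auto simp: order_ring_def block_coeff_def)
qed

lemma poly_eq_prod_blocks: "map_poly of_rat f = (\<Prod>i<N. \<Prod>z\<in>\<Lambda> i. [:- z, 1:])"
proof -
  have "map_poly of_rat f = (\<Prod>z\<in>complex_roots f. [:- z, 1:])"
    using complex_poly_decompose_rsquarefree[OF sep[unfolded separable_poly_def]] monic
    by (simp add: complex_roots_def degree_map_poly coeff_map_poly)
  also have "\<dots> = (\<Prod>i<N. \<Prod>z\<in>\<Lambda> i. [:- z, 1:])"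
    unfolding block_cover[symmetric] using finite_block block_disjoint
    by (intro prod.UNION_disjoint) auto
  finally show ?thesis .
qed

end

section \<open>Roots and coefficients\<close>

text \<open>Write p for the product. Then \<open>coeff q k\<close> is
  \<open>coeff p (Suc k) + z * coeff q (Suc k)\<close>. For \<open>norm z \<le> 2\<close> this is
  run downwards from the top, about doubling the bound at each step; for larger \<open>z\<close> it
  is solved for \<open>z * coeff q (Suc k)\<close> and run upwards, where it contracts.\<close>

lemma coeff_linear_factor_bound:
  fixes q :: "complex poly"
  assumes deg: "degree q < n" and H: "\<And>k. norm (coeff ([:- z, 1:] * q) k) \<le> H"
  shows "norm (coeff q k) * max 1 (norm z) \<le> 2 ^ (n + 1) * H"
proof -
  define p where "p = [:- z, 1:] * q"
  have p0: "coeff p 0 = - (z * coeff q 0)" by (simp add: p_def)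
  have pS: "coeff p (Suc k) = coeff q k - z * coeff q (Suc k)" for k by (simp add: p_def coeff_pCons)
  have H': "norm (coeff p k) \<le> H" for k using H by (simp add: p_def)
  have H0: "H \<ge> 0" using H'[of 0] norm_ge_zero order_trans by blast
  show ?thesis
  proof (cases "norm z \<le> 2")
    case True
    \<comment> \<open>The recursion starts at index \<open>n\<close>, where the coefficient of
      \<open>q\<close> is 0 by the degree bound.\<close>
    have *: "norm (coeff q (n - j)) \<le> (2 ^ j - 1) * H" if "j \<le> n" for j
      using that
    proof (induction j)
      case 0
      thus ?case using deg by (simp add: coeff_eq_0)
    next
      case (Suc j)
      define k where "k = n - Suc j"
      have nj: "n - j = Suc k" using Suc.prems by (simp add: k_def)
      have "coeff q k = coeff p (Suc k) + z * coeff q (Suc k)" by (simp add: pS)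
      hence "norm (coeff q k) \<le> norm (coeff p (Suc k)) + norm (z * coeff q (Suc k))"
        by (simp add: norm_triangle_ineq)
      also have "norm (z * coeff q (Suc k)) \<le> 2 * ((2 ^ j - 1) * H)"
        unfolding norm_mult using True Suc nj by (intro mult_mono) auto
      also have "norm (coeff p (Suc k)) + 2 * ((2 ^ j - 1) * H) \<le> (2 ^ Suc j - 1) * H"
        using H'[of "Suc k"] by (simp add: algebra_simps)
      finally show ?case by (simp add: k_def)
    qed
    have "norm (coeff q k) \<le> 2 ^ n * H"
    proof (cases "k \<le> n")
      case True
      have "norm (coeff q (n - (n - k))) \<le> (2 ^ (n - k) - 1) * H" by (rule *) simp
      also have "\<dots> \<le> 2 ^ (n - k) * H" using H0 by (intro mult_right_mono) auto
      also have "\<dots> \<le> 2 ^ n * H" using H0 by (intro mult_right_mono power_increasing) auto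
      finally show ?thesis using True by simp
    qed (use deg H0 in \<open>simp add: coeff_eq_0\<close>)
    hence "norm (coeff q k) * max 1 (norm z) \<le> (2 ^ n * H) * 2"
      using True H0 by (intro mult_mono) auto
    thus ?thesis by simp
  next
    case False
    have *: "norm z * norm (coeff q k) \<le> 2 * H" for k
    proof (induction k)
      case 0
      thus ?case using H'[of 0] H0 by (simp add: p0 norm_mult)
    next
      case (Suc k)
      have "2 * norm (coeff q k) \<le> norm z * norm (coeff q k)" using False by (intro mult_right_mono) auto
      hence "norm (coeff q k) \<le> H" using Suc.IH by simp
      have "z * coeff q (Suc k) = coeff q k - coeff p (Suc k)" by (simp add: pS)
      hence "norm z * norm (coeff q (Suc k)) \<le> norm (coeff q k) + norm (coeff p (Suc k))"
        by (metis norm_mult norm_triangle_ineq4)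
      thus ?case using \<open>norm (coeff q k) \<le> H\<close> H'[of "Suc k"] by simp
    qed
    have "norm (coeff q k) * max 1 (norm z) \<le> 2 * H" using *[of k] False by (simp add: mult.commute max_def)
    also have "\<dots> \<le> 2 ^ (n + 1) * H" using H0 by (intro mult_right_mono) auto
    finally show ?thesis .
  qed
qed

lemma degree_prod_linear: "degree (\<Prod>z\<in>Z. [:- g z, 1 :: complex:]) = card Z"
  by (subst degree_prod_sum_eq) auto

lemma lead_coeff_prod_linear: "coeff (\<Prod>z\<in>Z. [:- g z, 1 :: complex:]) (card Z) = 1"
  using lead_coeff_prod[of "\<lambda>z. [:- g z, 1 :: complex:]" Z] by (simp add: degree_prod_linear)

text \<open>The Mahler measure is bounded by the height: peel off the roots one by one. By the
  preceding lemma each removal divides the height bound by \<open>max 1 (norm z)\<close>, at the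
  cost of a constant factor.\<close>

lemma prod_roots_bound:
  fixes Z :: "complex set"
  assumes "finite Z" "card Z \<le> n" "\<And>k. norm (coeff (\<Prod>z\<in>Z. [:- z, 1:]) k) \<le> H"
  shows "(\<Prod>z\<in>Z. max 1 (norm z)) \<le> (2 ^ (n + 1)) ^ card Z * H"
  using assms
proof (induction Z arbitrary: H rule: finite_induct)
  case empty
  thus ?case using empty(2)[of 0] by simp
next
  case (insert z Z)
  let ?m = "max 1 (norm z)"
  let ?q = "\<Prod>z\<in>Z. [:- z, 1 :: complex:]"
  have "norm (coeff ?q k) * ?m \<le> 2 ^ (n + 1) * H" for k
  proof (rule coeff_linear_factor_bound)
    show "degree ?q < n" using insert degree_prod_linear[of "\<lambda>z. z" Z] by simp
    show "norm (coeff ([:- z, 1:] * ?q) k) \<le> H" for k using insert.prems(2)[of k] insert.hyps by simp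
  qed
  hence "norm (coeff ?q k) \<le> 2 ^ (n + 1) * H / ?m" for k by (simp add: pos_le_divide_eq)
  hence "(\<Prod>z\<in>Z. max 1 (norm z)) \<le> (2 ^ (n + 1)) ^ card Z * (2 ^ (n + 1) * H / ?m)"
    using insert by (intro insert.IH) auto
  hence "?m * (\<Prod>z\<in>Z. max 1 (norm z)) \<le> ?m * ((2 ^ (n + 1)) ^ card Z * (2 ^ (n + 1) * H / ?m))"
    by (intro mult_left_mono) auto
  also have "\<dots> = (2 ^ (n + 1)) ^ Suc (card Z) * H" by (simp add: mult_ac)
  finally show ?case using insert.hyps by simp
qed

text \<open>The converse comparison of height and Mahler measure: each linear factor multiplies the
  bound by at most \<open>1 + norm (z i)\<close>, hence by at most
  \<open>2 * max 1 (norm (z i))\<close>.\<close>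

lemma coeff_prod_linear_bound:
  fixes z :: "'i \<Rightarrow> complex"
  assumes "finite I"
  shows "norm (coeff (\<Prod>i\<in>I. [:- z i, 1:]) k) \<le> 2 ^ card I * (\<Prod>i\<in>I. max 1 (norm (z i)))"
  using assms
proof (induction I arbitrary: k rule: finite_induct)
  case empty
  show ?case by (simp add: coeff_1)
next
  case (insert i I)
  let ?q = "\<Prod>i\<in>I. [:- z i, 1:]"
  define B where "B = 2 ^ card I * (\<Prod>i\<in>I. max 1 (norm (z i)))"
  have B0: "B \<ge> 0" unfolding B_def by (intro mult_nonneg_nonneg prod_nonneg) auto
  have "norm (coeff (pCons 0 ?q) k) \<le> B"
    using insert.IH B0 by (auto simp: coeff_pCons B_def split: nat.splits)
  moreover have "norm (z i * coeff ?q k) \<le> norm (z i) * B"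
    unfolding norm_mult using insert.IH by (intro mult_left_mono) (auto simp: B_def)
  moreover have "norm (coeff ([:- z i, 1:] * ?q) k) \<le> norm (coeff (pCons 0 ?q) k) + norm (z i * coeff ?q k)"
    by (simp add: norm_triangle_ineq4)
  moreover have "B + norm (z i) * B \<le> 2 * (max 1 (norm (z i)) * B)"
  proof -
    have "1 * B \<le> max 1 (norm (z i)) * B" "norm (z i) * B \<le> max 1 (norm (z i)) * B"
      using B0 by (intro mult_right_mono; simp)+
    thus ?thesis by simp
  qed
  moreover have "2 * (max 1 (norm (z i)) * B) = 2 ^ card (insert i I) * (\<Prod>i\<in>insert i I. max 1 (norm (z i)))"
    using insert.hyps by (simp add: B_def)
  ultimately show ?case using insert.hyps by simp
qed

section \<open>From imprimitive Galois groups to factorizations\<close>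

lemma transitive_imprimitive_blocks:
  assumes sep: "separable_poly f" and monic: "lead_coeff f = 1" and int: "\<And>k. coeff f k \<in> \<int>"
    and imp: "transitive_imprimitive N M (complex_roots f) (galois_group f)" and N: "N > 0"
  obtains \<Lambda> where "block_system f N \<Lambda>" "\<And>i. i < N \<Longrightarrow> card (\<Lambda> i) = M"
proof -
  have f0: "f \<noteq> 0" using monic by auto
  obtain P where P: "partition_on (complex_roots f) P" "card P = N"
    "\<And>g B. g \<in> galois_group f \<Longrightarrow> B \<in> P \<Longrightarrow> g ` B \<in> P"
    and cR: "card (complex_roots f) = N * M" and tr: "transitive_on (complex_roots f) (galois_group f)"
    using imp unfolding transitive_imprimitive_def by blast
  have "finite P" using P(2) N card_ge_0_finite by blast
  then obtain \<Lambda> where L: "bij_betw \<Lambda> {..<N} P" using ex_bij_betw_nat_finite P(2) by (metis atLeast0LessThan)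
  have LP: "\<Lambda> i \<in> P" if "i < N" for i using L that by (auto simp: bij_betw_def)
  have sub: "B \<subseteq> complex_roots f" if "B \<in> P" for B using P(1) that by (auto simp: partition_on_def)
  have uniq: "B = C" if "B \<in> P" "C \<in> P" "x \<in> B" "x \<in> C" for B C x
    using P(1) that by (auto simp: partition_on_def disjoint_def)
  have im: "\<sigma> ` B \<in> P" if "\<sigma> \<in> galois_automorphisms f" "B \<in> P" for \<sigma> B
  proof -
    have "(\<lambda>z. if z \<in> complex_roots f then \<sigma> z else z) ` B = \<sigma> ` B"
      using sub[OF that(2)] by (intro image_cong) auto
    thus ?thesis using P(3)[OF galois_automorphism_roots(3)[OF f0 that(1)] that(2)] by simp
  qed
  have move: "\<exists>\<sigma>\<in>galois_automorphisms f. \<sigma> ` B = C" if B: "B \<in> P" and C: "C \<in> P" for B C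
  proof -
    have "B \<noteq> {}" "C \<noteq> {}" using P(1) that by (auto simp: partition_on_def)
    then obtain x y where xy: "x \<in> B" "y \<in> C" by blast
    have rts: "x \<in> complex_roots f" "y \<in> complex_roots f" using sub B C xy by auto
    obtain g where g: "g \<in> galois_group f" "g x = y" using tr rts unfolding transitive_on_def by blast
    obtain \<sigma> where s: "\<sigma> \<in> galois_automorphisms f" "\<forall>z\<in>complex_roots f. g z = \<sigma> z"
      using g(1) unfolding galois_group_def by blast
    have "y \<in> \<sigma> ` B" using g(2) s(2) xy rts by auto
    hence "\<sigma> ` B = C" using uniq[OF im[OF s(1) B] C] xy by blast
    thus ?thesis using s(1) by blast
  qed
  have un: "(\<Union>i<N. \<Lambda> i) = complex_roots f" using L P(1) by (auto simp: bij_betw_def partition_on_def)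
  have ne: "\<Lambda> i \<noteq> {}" if "i < N" for i using LP[OF that] P(1) by (auto simp: partition_on_def)
  have disj: "\<Lambda> i \<inter> \<Lambda> k = {}" if "i < N" "k < N" "i \<noteq> k" for i k
  proof (rule ccontr)
    assume "\<Lambda> i \<inter> \<Lambda> k \<noteq> {}"
    hence "\<Lambda> i = \<Lambda> k" using uniq[OF LP[OF that(1)] LP[OF that(2)]] by blast
    thus False using L that by (auto simp: bij_betw_def inj_on_def)
  qed
  have bs: "block_system f N \<Lambda>"
  proof
    show "\<exists>k<N. \<sigma> ` \<Lambda> i = \<Lambda> k" if "\<sigma> \<in> galois_automorphisms f" "i < N" for \<sigma> i
    proof -
      have "\<sigma> ` \<Lambda> i \<in> \<Lambda> ` {..<N}" using im[OF that(1) LP[OF that(2)]] L by (simp add: bij_betw_def)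
      thus ?thesis by auto
    qed
  qed (use sep monic int ne disj un move[OF LP LP] in auto)
  \<comment> \<open>The definition of imprimitivity prescribes only the number of blocks; their
    sizes agree because automorphisms carry any block onto any other.\<close>
  have "card (\<Lambda> i) = M" if i: "i < N" for i
  proof -
    have eq: "card (\<Lambda> k) = card (\<Lambda> i)" if k: "k < N" for k
    proof -
      obtain \<sigma> where s: "\<sigma> \<in> galois_automorphisms f" "\<sigma> ` \<Lambda> i = \<Lambda> k" using move[OF LP[OF i] LP[OF k]] by blast
      have "inj_on \<sigma> (\<Lambda> i)"
        using galois_automorphism_roots(2)[OF f0 s(1)] sub[OF LP[OF i]] by (rule inj_on_subset)
      thus ?thesis using card_image[of \<sigma> "\<Lambda> i"] s(2) by simp
    qed
    have "N * M = card (\<Union>k<N. \<Lambda> k)" using un cR by simp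
    also have "\<dots> = (\<Sum>k<N. card (\<Lambda> k))"
      using disj block_system.finite_block[OF bs] by (intro card_UN_disjoint) auto
    also have "\<dots> = N * card (\<Lambda> i)" using eq by simp
    finally show ?thesis using N by simp
  qed
  thus ?thesis using that bs by blast
qed

text \<open>The 1 is the leading coefficient of the block polynomial; it keeps all radii at least
  1.\<close>

definition coeff_height :: "nat \<Rightarrow> (nat \<Rightarrow> nat \<Rightarrow> complex) \<Rightarrow> nat \<Rightarrow> real" where
  "coeff_height M v i = Max (insert 1 ((\<lambda>j. norm (v j i)) ` {..<M}))"

definition factored_poly :: "nat \<Rightarrow> nat \<Rightarrow> (nat \<Rightarrow> nat \<Rightarrow> complex) \<Rightarrow> complex poly" where
  "factored_poly N M v = (\<Prod>i<N. Polynomial.monom 1 M + (\<Sum>j<M. Polynomial.monom (v j i) j))"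

text \<open>In bounded degree, heights and Mahler measures agree up to constants, and Mahler
  measures are multiplicative. So the heights of the block polynomials multiply to at most a
  constant times the Mahler measure of \<open>f\<close>, which is at most a constant times
  \<open>H\<close>.\<close>

lemma imprimitive_factorization:
  assumes sep: "separable_poly f" and monic: "lead_coeff f = 1" and int: "\<And>k. coeff f k \<in> \<int>"
    and imp: "transitive_imprimitive N M (complex_roots f) (galois_group f)" and N: "N > 0"
    and H: "\<And>k. norm (of_rat (coeff f k) :: complex) \<le> H"
  obtains \<O> v where "conj_order N \<O>" "\<And>j. v j \<in> \<O>" "map_poly of_rat f = factored_poly N M v"
    "\<And>i k. i < N \<Longrightarrow> k < N \<Longrightarrow> i \<noteq> k \<Longrightarrow> \<exists>j<M. v j i \<noteq> v j k"
    "(\<Prod>i<N. coeff_height M v i) \<le> 2 ^ (M * N) * (2 ^ (N * M + 1)) ^ (N * M) * H"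
proof -
  obtain \<Lambda> where bs: "block_system f N \<Lambda>" and cM: "\<And>i. i < N \<Longrightarrow> card (\<Lambda> i) = M"
    using transitive_imprimitive_blocks[OF sep monic int imp N] by blast
  interpret block_system f N \<Lambda> by (rule bs)
  let ?g = "\<lambda>i. \<Prod>z\<in>\<Lambda> i. [:- z, 1:]"
  have g: "?g i = Polynomial.monom 1 M + (\<Sum>j<M. Polynomial.monom (block_coeff j i) j)" if i: "i < N" for i
  proof -
    have "?g i = (\<Sum>j\<le>M. Polynomial.monom (coeff (?g i) j) j)"
      using poly_as_sum_of_monoms[of "?g i"] degree_prod_linear[of "\<lambda>z. z" "\<Lambda> i"] cM[OF i] by simp
    also have "\<dots> = (\<Sum>j<M. Polynomial.monom (coeff (?g i) j) j) + Polynomial.monom (coeff (?g i) M) M"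
      by (simp add: lessThan_Suc_atMost[symmetric])
    also have "coeff (?g i) M = 1"
      using lead_coeff_prod_linear[of "\<lambda>z. z" "\<Lambda> i"] cM[OF i] by simp
    finally have eq: "?g i = (\<Sum>j<M. Polynomial.monom (coeff (?g i) j) j) + Polynomial.monom 1 M" .
    have "block_coeff j i = coeff (?g i) j" for j using i by (simp add: block_coeff_def)
    thus ?thesis using eq by (simp only: add.commute)
  qed
  show ?thesis
  proof (rule that[of order_ring block_coeff])
    show "map_poly of_rat f = factored_poly N M block_coeff"
      unfolding poly_eq_prod_blocks factored_poly_def using g by (intro prod.cong) auto
    \<comment> \<open>Two blocks with equal polynomials would share a root.\<close>
    show "\<exists>j<M. block_coeff j i \<noteq> block_coeff j k" if ik: "i < N" "k < N" "i \<noteq> k" for i k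
    proof (rule ccontr)
      assume "\<not> ?thesis"
      hence "?g i = ?g k" unfolding g[OF ik(1)] g[OF ik(2)] by simp
      obtain z where z: "z \<in> \<Lambda> i" using block_nonempty ik by blast
      hence "poly (?g i) z = 0" using finite_block ik by (auto simp: poly_prod)
      hence "poly (?g k) z = 0" using \<open>?g i = ?g k\<close> by simp
      hence "z \<in> \<Lambda> k" using finite_block ik by (auto simp: poly_prod)
      thus False using z block_disjoint ik by blast
    qed
    have h: "coeff_height M block_coeff i \<le> 2 ^ M * (\<Prod>z\<in>\<Lambda> i. max 1 (norm z))" if i: "i < N" for i
    proof -
      have "1 \<le> 2 ^ M * (\<Prod>z\<in>\<Lambda> i. max 1 (norm z))"
        using mult_mono[of "1::real" "2 ^ M" 1 "\<Prod>z\<in>\<Lambda> i. max 1 (norm z)"] by (simp add: prod_ge_1)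
      thus ?thesis unfolding coeff_height_def
        using coeff_prod_linear_bound[OF finite_block[OF i], of "\<lambda>z. z"] cM[OF i] i
        by (subst Max_le_iff) (auto simp: block_coeff_def)
    qed
    have "(\<Prod>i<N. coeff_height M block_coeff i) \<le> (\<Prod>i<N. 2 ^ M * (\<Prod>z\<in>\<Lambda> i. max 1 (norm z)))"
    proof (rule prod_mono)
      fix i assume "i \<in> {..<N}"
      moreover have "(1::real) \<le> coeff_height M block_coeff i" unfolding coeff_height_def by (rule Max_ge) auto
      ultimately show "0 \<le> coeff_height M block_coeff i \<and> coeff_height M block_coeff i \<le> 2 ^ M * (\<Prod>z\<in>\<Lambda> i. max 1 (norm z))"
        using h[of i] by auto
    qed
    also have "\<dots> = 2 ^ (M * N) * (\<Prod>i<N. \<Prod>z\<in>\<Lambda> i. max 1 (norm z))"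
      by (simp add: prod.distrib power_mult)
    also have "(\<Prod>i<N. \<Prod>z\<in>\<Lambda> i. max 1 (norm z)) = (\<Prod>z\<in>complex_roots f. max 1 (norm z))"
      unfolding block_cover[symmetric] using finite_block block_disjoint
      by (intro prod.UNION_disjoint[symmetric]) auto
    also have "\<dots> \<le> (2 ^ (N * M + 1)) ^ card (complex_roots f) * H"
    proof (rule prod_roots_bound)
      show "finite (complex_roots f)" by (rule finite_complex_roots[OF f_nz])
      show "card (complex_roots f) \<le> N * M" using imp by (simp add: transitive_imprimitive_def)
      have "map_poly of_rat f = (\<Prod>z\<in>complex_roots f. [:- z, 1:])"
        using complex_poly_decompose_rsquarefree[OF sep[unfolded separable_poly_def]] monic
        by (simp add: complex_roots_def degree_map_poly coeff_map_poly)
      thus "norm (coeff (\<Prod>z\<in>complex_roots f. [:- z, 1:]) k) \<le> H" for k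
        using H[of k] by (metis coeff_map_poly of_rat_0)
    qed
    also have "card (complex_roots f) = N * M" using imp by (simp add: transitive_imprimitive_def)
    finally show "(\<Prod>i<N. coeff_height M block_coeff i) \<le> 2 ^ (M * N) * (2 ^ (N * M + 1)) ^ (N * M) * H"
      by (simp add: mult.assoc)
  qed (use conj_order_ring block_coeff_in_order_ring in auto)
qed

section \<open>Small generators\<close>

lemma conj_orderD:
  assumes "conj_order N \<O>"
  shows "w \<in> \<O> \<Longrightarrow> i \<ge> N \<Longrightarrow> w i = 0"
    "w \<in> \<O> \<Longrightarrow> w' \<in> \<O> \<Longrightarrow> (\<lambda>i. w i - w' i) \<in> \<O>"
    "w \<in> \<O> \<Longrightarrow> coeff (\<Prod>i<N. [:- w i, 1:]) k \<in> \<int>"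
    "w \<in> \<O> \<Longrightarrow> i < N \<Longrightarrow> w i = 0 \<Longrightarrow> k < N \<Longrightarrow> w k = 0"
    "w \<in> \<O> \<Longrightarrow> i < N \<Longrightarrow> (\<And>k. k < N \<Longrightarrow> k \<noteq> i \<Longrightarrow> w k \<noteq> w i) \<Longrightarrow> inj_on w {..<N}"
    "w \<in> \<O> \<Longrightarrow> inj_on w {..<N} \<Longrightarrow> \<O> = integral_span N w"
proof -
  note c1 = assms[unfolded conj_order_def] note c2 = conjunct2[OF c1] note c3 = conjunct2[OF c2]
  note c4 = conjunct2[OF c3] note c5 = conjunct2[OF c4] note c6 = conjunct2[OF c5]
  show "w \<in> \<O> \<Longrightarrow> i \<ge> N \<Longrightarrow> w i = 0" using conjunct1[OF c1] by blast
  show "w \<in> \<O> \<Longrightarrow> w' \<in> \<O> \<Longrightarrow> (\<lambda>i. w i - w' i) \<in> \<O>" using conjunct1[OF c2] by blast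
  show "w \<in> \<O> \<Longrightarrow> coeff (\<Prod>i<N. [:- w i, 1:]) k \<in> \<int>" using conjunct1[OF c3] by blast
  show "w \<in> \<O> \<Longrightarrow> i < N \<Longrightarrow> w i = 0 \<Longrightarrow> k < N \<Longrightarrow> w k = 0" using conjunct1[OF c4] by blast
  show "w \<in> \<O> \<Longrightarrow> i < N \<Longrightarrow> (\<And>k. k < N \<Longrightarrow> k \<noteq> i \<Longrightarrow> w k \<noteq> w i) \<Longrightarrow> inj_on w {..<N}"
    using conjunct1[OF c5] by blast
  show "w \<in> \<O> \<Longrightarrow> inj_on w {..<N} \<Longrightarrow> \<O> = integral_span N w" using conjunct2[OF c6] by blast
qed

lemma conj_order_cnj:
  assumes "conj_order N \<O>"
  shows "\<exists>\<tau>. (\<forall>i<N. \<tau> i < N \<and> \<tau> (\<tau> i) = i) \<and> (\<forall>w\<in>\<O>. \<forall>i<N. w (\<tau> i) = cnj (w i))"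
  using assms unfolding conj_order_def by (elim conjE)

text \<open>\<open>conj_order\<close> records closure under differences; zero, sums and natural
  multiples are derived from it.\<close>

lemma conj_order_comb:
  fixes v :: "nat \<Rightarrow> nat \<Rightarrow> complex" and M :: nat
  assumes "conj_order N \<O>" "\<And>j. v j \<in> \<O>"
  shows "(\<lambda>i. \<Sum>j<M. of_nat (c j) * v j i) \<in> \<O>"
proof -
  note D = conj_orderD(2)[OF assms(1)]
  have zero: "(\<lambda>i. 0) \<in> \<O>" using D[OF assms(2)[of undefined] assms(2)[of undefined]] by simp
  have add: "(\<lambda>i. w i + w' i) \<in> \<O>" if "w \<in> \<O>" "w' \<in> \<O>" for w w'
    using D[OF that(1) D[OF zero that(2)]] by simp
  have mult: "(\<lambda>i. of_nat n * w i) \<in> \<O>" if w: "w \<in> \<O>" for w n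
  proof (induction n)
    case (Suc n)
    show ?case using add[OF Suc w] by (simp add: algebra_simps)
  qed (simp add: zero)
  show ?thesis
  proof (induction M)
    case (Suc M)
    show ?case using add[OF Suc mult[OF assms(2)[of M]]] by simp
  qed (simp add: zero)
qed

text \<open>Up to sign the norm is the constant coefficient of the characteristic polynomial, hence
  an integer, and no conjugate of a nonzero element vanishes.\<close>

lemma conj_order_norm_ge_1:
  assumes \<O>: "conj_order N \<O>" and w: "w \<in> \<O>" and nz: "k < N" "w k \<noteq> 0"
  shows "(\<Prod>i<N. norm (w i)) \<ge> 1"
proof -
  have "coeff (\<Prod>i<N. [:- w i, 1:]) 0 = (\<Prod>i<N. - w i)"
    by (simp add: poly_0_coeff_0[symmetric] poly_prod)
  then obtain m where m: "(\<Prod>i<N. - w i) = of_int m"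
    using conj_orderD(3)[OF \<O> w, of 0] by (metis Ints_cases)
  have "w i \<noteq> 0" if "i < N" for i using conj_orderD(4)[OF \<O> w that _ nz(1)] nz(2) by blast
  hence "(\<Prod>i<N. - w i) \<noteq> 0" by auto
  hence "m \<noteq> 0" using m by auto
  hence "1 \<le> norm (of_int m :: complex)" by simp
  also have "\<dots> = (\<Prod>i<N. norm (w i))" unfolding m[symmetric] by (simp add: prod_norm[symmetric])
  finally show ?thesis .
qed

text \<open>The coordinates of a tuple are roots of its characteristic polynomial: the factors
  \<open>2 * b k + 1\<close> count integral polynomials, and \<open>N ^ N\<close> the ways to assign
  a root to each coordinate.\<close>

lemma count_charpoly:
  fixes W :: "(nat \<Rightarrow> complex) set"
  assumes W: "\<And>w i. w \<in> W \<Longrightarrow> i \<ge> N \<Longrightarrow> w i = 0"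
    "\<And>w k. w \<in> W \<Longrightarrow> k < N \<Longrightarrow> coeff (\<Prod>i<N. [:- w i, 1:]) k \<in> \<int>"
    "\<And>w k. w \<in> W \<Longrightarrow> k < N \<Longrightarrow> norm (coeff (\<Prod>i<N. [:- w i, 1:]) k) \<le> b k"
    and b: "\<And>k. k < N \<Longrightarrow> b k \<ge> 0"
  shows "finite W" "real (card W) \<le> real N ^ N * (\<Prod>k<N. 2 * b k + 1)"
proof -
  define B where "B k = (of_int ` {-\<lfloor>b k\<rfloor>..\<lfloor>b k\<rfloor>} :: complex set)" for k
  define p where "p c = Polynomial.monom 1 N + (\<Sum>k<N. Polynomial.monom (c k) k)" for c :: "nat \<Rightarrow> complex"
  have degp: "degree (p c) = N" and p0: "p c \<noteq> 0" for c
  proof -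
    have co: "coeff (p c) k = (if k = N then 1 else if k < N then c k else 0)" for k
      by (auto simp: p_def coeff_sum)
    show "degree (p c) = N"
    proof (rule antisym)
      show "degree (p c) \<le> N" by (rule degree_le) (simp add: co)
      show "N \<le> degree (p c)" by (rule le_degree) (simp add: co)
    qed
    show "p c \<noteq> 0" using co[of N] by auto
  qed
  have pw: "p (\<lambda>k. coeff (\<Prod>i<N. [:- w i, 1:]) k) = (\<Prod>i<N. [:- w i, 1:])" for w :: "nat \<Rightarrow> complex"
  proof (rule poly_eqI)
    fix k
    have d: "degree (\<Prod>i<N. [:- w i, 1:]) = N" "coeff (\<Prod>i<N. [:- w i, 1:]) N = 1"
      using degree_prod_linear[of w "{..<N}"] lead_coeff_prod_linear[of w "{..<N}"] by auto
    show "coeff (p (\<lambda>k. coeff (\<Prod>i<N. [:- w i, 1:]) k)) k = coeff (\<Prod>i<N. [:- w i, 1:]) k"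
      using d by (cases k N rule: linorder_cases) (auto simp: p_def coeff_sum coeff_eq_0)
  qed
  \<comment> \<open>The default 0 matches the convention that tuples vanish from \<open>N\<close>
    on.\<close>
  define F where "F c = PiE_dflt {..<N} (0::complex) (\<lambda>_. {z. poly (p c) z = 0})" for c
  have fr: "finite {z. poly (p c) z = 0}" and cr: "card {z. poly (p c) z = 0} \<le> N" for c
    using poly_roots_finite[OF p0] poly_roots_degree[OF p0] degp by auto
  have finF: "finite (F c)" for c unfolding F_def by (intro finite_PiE_dflt fr) auto
  have cardF: "card (F c) \<le> N ^ N" for c
  proof -
    have "card (F c) = (\<Prod>i<N. card {z. poly (p c) z = 0})" unfolding F_def by (rule card_PiE_dflt) (auto simp: fr)
    also have "\<dots> \<le> (\<Prod>i<N. N)" by (intro prod_mono) (simp add: cr)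
    finally show ?thesis by simp
  qed
  define I where "I = PiE_dflt {..<N} (0::complex) B"
  have finB: "finite (B k)" for k by (simp add: B_def)
  have finI: "finite I" unfolding I_def by (intro finite_PiE_dflt finB) auto
  have cardI: "real (card I) \<le> (\<Prod>k<N. 2 * b k + 1)"
  proof -
    have "real (card I) = (\<Prod>k<N. real (card (B k)))" unfolding I_def by (simp add: card_PiE_dflt finB)
    also have "\<dots> \<le> (\<Prod>k<N. 2 * b k + 1)"
    proof (rule prod_mono)
      fix k assume "k \<in> {..<N}"
      hence "b k \<ge> 0" using b by auto
      hence f0: "\<lfloor>b k\<rfloor> \<ge> 0" by simp
      have "card (B k) \<le> card {-\<lfloor>b k\<rfloor>..\<lfloor>b k\<rfloor>}" unfolding B_def by (rule card_image_le) simp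
      also have "\<dots> = nat (2 * \<lfloor>b k\<rfloor> + 1)" by simp
      finally have "real (card (B k)) \<le> real_of_int (2 * \<lfloor>b k\<rfloor> + 1)" using f0 by linarith
      also have "\<dots> \<le> 2 * b k + 1" by simp
      finally show "0 \<le> real (card (B k)) \<and> real (card (B k)) \<le> 2 * b k + 1" by simp
    qed
    finally show ?thesis .
  qed
  have sub: "W \<subseteq> (\<Union>c\<in>I. F c)"
  proof
    fix w assume w: "w \<in> W"
    define c where "c k = (if k < N then coeff (\<Prod>i<N. [:- w i, 1:]) k else 0)" for k
    have "p c = p (\<lambda>k. coeff (\<Prod>i<N. [:- w i, 1:]) k)" by (simp add: p_def c_def)
    hence pc: "p c = (\<Prod>i<N. [:- w i, 1:])" by (simp only: pw)
    have "c k \<in> B k" if k: "k < N" for k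
    proof -
      obtain m where m: "coeff (\<Prod>i<N. [:- w i, 1:]) k = of_int m" using W(2)[OF w k] by (auto elim: Ints_cases)
      hence "\<bar>real_of_int m\<bar> \<le> b k" using W(3)[OF w k] by simp
      hence "m \<le> \<lfloor>b k\<rfloor>" "- m \<le> \<lfloor>b k\<rfloor>" unfolding le_floor_iff by auto
      thus ?thesis using m k by (auto simp: B_def c_def)
    qed
    hence "c \<in> I" by (auto simp: I_def PiE_dflt_def c_def)
    moreover have "w \<in> F c" using W(1)[OF w] by (auto simp: F_def PiE_dflt_def pc poly_prod)
    ultimately show "w \<in> (\<Union>c\<in>I. F c)" by blast
  qed
  have finU: "finite (\<Union>c\<in>I. F c)" using finI finF by blast
  show "finite W" by (rule finite_subset[OF sub finU])
  have "card W \<le> card (\<Union>c\<in>I. F c)" by (rule card_mono[OF finU sub])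
  also have "\<dots> \<le> (\<Sum>c\<in>I. card (F c))" by (rule card_UN_le[OF finI])
  also have "\<dots> \<le> (\<Sum>c\<in>I. N ^ N)" by (intro sum_mono cardF)
  finally have "real (card W) \<le> real (card I * N ^ N)" unfolding of_nat_le_iff by simp
  also have "\<dots> = real N ^ N * real (card I)" by simp
  also have "\<dots> \<le> real N ^ N * (\<Prod>k<N. 2 * b k + 1)" by (intro mult_left_mono cardI) auto
  finally show "real (card W) \<le> real N ^ N * (\<Prod>k<N. 2 * b k + 1)" .
qed

definition polydisc :: "nat \<Rightarrow> (nat \<Rightarrow> real) \<Rightarrow> (nat \<Rightarrow> complex) set" where
  "polydisc N A = {w. \<forall>i<N. norm (w i) \<le> A i}"

lemma coeff_bound_polydisc:
  assumes "w \<in> polydisc N A" "\<And>i. i < N \<Longrightarrow> A i \<ge> 1"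
  shows "norm (coeff (\<Prod>i<N. [:- w i, 1:]) k) \<le> 2 ^ N * (\<Prod>i<N. A i)"
proof -
  have "norm (coeff (\<Prod>i<N. [:- w i, 1:]) k) \<le> 2 ^ N * (\<Prod>i<N. max 1 (norm (w i)))"
    using coeff_prod_linear_bound[of "{..<N}" w k] by simp
  also have "\<dots> \<le> 2 ^ N * (\<Prod>i<N. A i)"
    using assms by (intro mult_left_mono prod_mono) (auto simp: polydisc_def)
  finally show ?thesis .
qed

lemma finite_conj_order_polydisc:
  assumes "conj_order N \<O>" "\<And>i. i < N \<Longrightarrow> A i \<ge> 1"
  shows "finite (\<O> \<inter> polydisc N A)"
proof (rule count_charpoly(1))
  show "norm (coeff (\<Prod>i<N. [:- w i, 1:]) k) \<le> 2 ^ N * (\<Prod>i<N. A i)" if "w \<in> \<O> \<inter> polydisc N A" for w k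
    using coeff_bound_polydisc that assms(2) by blast
  show "0 \<le> 2 ^ N * (\<Prod>i<N. A i)" using assms(2) order_trans[OF zero_le_one]
    by (intro mult_nonneg_nonneg prod_nonneg) auto
qed (use conj_orderD[OF assms(1)] in auto)

lemma floor_range:
  fixes x a :: real assumes "\<bar>x\<bar> \<le> a"
  shows "\<lfloor>x\<rfloor> \<in> {\<lfloor>- a\<rfloor>..\<lfloor>a\<rfloor>}"
  using assms by (auto intro: floor_mono)

lemma floor_range_card:
  fixes a :: real assumes "0 \<le> a"
  shows "real (card {\<lfloor>- a\<rfloor>..\<lfloor>a\<rfloor>}) \<le> 2 * a + 2"
proof -
  have "real (card {\<lfloor>- a\<rfloor>..\<lfloor>a\<rfloor>}) = real_of_int (\<lfloor>a\<rfloor> - \<lfloor>- a\<rfloor> + 1)"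
    using assms floor_mono[of "-a" a] by simp
  also have "\<dots> \<le> 2 * a + 2"
    using of_int_floor_le[of a] real_of_int_floor_gt_diff_one[of "- a"] by linarith
  finally show ?thesis .
qed

text \<open>
  If the order has many points in the polydisc, two of them lie in a common cell that is long only in the
  direction \<open>i0\<close> of the largest side. Their difference has all other conjugates inside the unit disc,
  so its norm being at least 1 forces it to generate the field.
\<close>
lemma small_generator:
  fixes A :: "nat \<Rightarrow> real"
  assumes \<O>: "conj_order N \<O>" and N: "N > 0" and A: "\<And>i. i < N \<Longrightarrow> A i \<ge> 1"
    and sym: "\<And>i k. i < N \<Longrightarrow> k < N \<Longrightarrow> (\<And>w. w \<in> \<O> \<Longrightarrow> norm (w k) = norm (w i)) \<Longrightarrow> A k = A i"
    and n: "n = real (card (\<O> \<inter> polydisc N A))" and P: "P = (\<Prod>i<N. A i)"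
    and many: "n > 4 * 6 ^ N * P powr (1 - 1 / N)"
  shows "\<exists>d h. d \<in> \<O> \<and> inj_on d {..<N} \<and> 1 \<le> h \<and> h \<le> 8 * 6 ^ N * P / n \<and>
    (\<forall>i<N. norm (d i) \<le> h) \<and> (\<Prod>i<N. max 1 (norm (d i))) \<le> h ^ 2"
proof -
  obtain \<tau> where \<tau>: "\<And>i. i < N \<Longrightarrow> \<tau> i < N" "\<And>i. i < N \<Longrightarrow> \<tau> (\<tau> i) = i"
    "\<And>w i. w \<in> \<O> \<Longrightarrow> i < N \<Longrightarrow> w (\<tau> i) = cnj (w i)"
    using conj_order_cnj[OF \<O>] by auto
  define W where "W = \<O> \<inter> polydisc N A"
  have finW: "finite W" unfolding W_def by (rule finite_conj_order_polydisc[OF \<O> A])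
  have A\<tau>: "A (\<tau> i) = A i" if "i < N" for i 
  proof (rule sym[OF that \<tau>(1)[OF that]])
    show "norm (w (\<tau> i)) = norm (w i)" if "w \<in> \<O>" for w using \<tau>(3)[OF that \<open>i < N\<close>] by simp
  qed
  obtain i1 where i1: "i1 < N" "\<And>i. i < N \<Longrightarrow> A i \<le> A i1"
  proof -
    have "Max (A ` {..<N}) \<in> A ` {..<N}" using N by (intro Max_in) auto
    then obtain i1 where "i1 < N" "A i1 = Max (A ` {..<N})" by auto
    thus ?thesis using that[of i1] by auto
  qed
  \<comment> \<open>In a complex conjugate pair the larger index is taken: there
    \<open>\<rho>\<close> below reads off the imaginary part. The cells are then long in the
    imaginary direction and short in the real one, which will make \<open>d i0\<close> non-real and
    so distinct from its conjugate.\<close>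
  define i0 where "i0 = max i1 (\<tau> i1)"
  have i0: "i0 < N" "\<tau> i0 \<le> i0" "A i0 = A i1" using i1(1) \<tau> A\<tau> by (auto simp: i0_def max_def)
  have P1: "P \<ge> 1" unfolding P using A by (intro prod_ge_1) auto
  have A0: "A i0 \<ge> 1" using A[OF i0(1)] by simp
  have PA: "P powr (1 / N) \<le> A i0"
  proof -
    have "P \<le> (\<Prod>i<N. A i0)" unfolding P using i1(2) i0(3) A order_trans[OF zero_le_one]
      by (intro prod_mono) auto
    hence "P \<le> A i0 powr N" using A0 by (simp add: powr_realpow)
    hence "P powr (1 / N) \<le> (A i0 powr N) powr (1 / N)" using P1 by (intro powr_mono2) auto
    thus ?thesis using N A0 by (simp add: powr_powr)
  qed
  have n0: "n > 0" 
  proof -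
    have "0 \<le> 4 * 6 ^ N * P powr (1 - 1 / N)" by simp
    thus ?thesis using many by linarith
  qed
  \<comment> \<open>With this length the main term of the number of cells is \<open>n / 2\<close>,
    and by \<open>many\<close> the other term is less than \<open>n / 2\<close>.\<close>
  define B where "B = 4 * 6 ^ N * P / n"
  have B0: "B > 0" using n0 P1 by (simp add: B_def)
  \<comment> \<open>Real and imaginary parts below 1/2 give modulus below 1.\<close>
  define s where "s i = (if i = i0 then B else 1 / 2)" for i
  have s0: "s i > 0" for i using B0 by (simp add: s_def)
  \<comment> \<open>\<open>N\<close> real parameters of a conjugate tuple: the real part at a real
    coordinate or at the smaller index of a conjugate pair, the imaginary part at the larger
    index.\<close>
  define \<rho> where "\<rho> i w = (if i \<le> \<tau> i then Re (w i) else Im (w i))" for i and w :: "nat \<Rightarrow> complex"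
  have \<rho>_le: "\<bar>\<rho> i w\<bar> \<le> norm (w i)" for i w by (simp add: \<rho>_def abs_Re_le_cmod abs_Im_le_cmod)
  define cell where "cell w = (\<lambda>i\<in>{..<N}. \<lfloor>\<rho> i w / s i\<rfloor>)" for w
  define cells where "cells = PiE {..<N} (\<lambda>i. {\<lfloor>- (A i / s i)\<rfloor>..\<lfloor>A i / s i\<rfloor>})"
  have "cell ` W \<subseteq> cells"
  proof (rule image_subsetI)
    fix w assume w: "w \<in> W"
    have "\<lfloor>\<rho> i w / s i\<rfloor> \<in> {\<lfloor>- (A i / s i)\<rfloor>..\<lfloor>A i / s i\<rfloor>}" if "i < N" for i
    proof (rule floor_range)
      have "\<bar>\<rho> i w\<bar> \<le> A i" using \<rho>_le[of i w] w that by (auto simp: W_def polydisc_def)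
      thus "\<bar>\<rho> i w / s i\<bar> \<le> A i / s i" using s0[of i] by (simp add: divide_right_mono)
    qed
    thus "cell w \<in> cells" by (auto simp: cell_def cells_def)
  qed
  moreover have "card cells < card W"
  proof -
    have "real (card cells) = (\<Prod>i<N. real (card {\<lfloor>- (A i / s i)\<rfloor>..\<lfloor>A i / s i\<rfloor>}))"
      unfolding cells_def by (simp add: card_PiE)
    also have "\<dots> = real (card {\<lfloor>- (A i0 / s i0)\<rfloor>..\<lfloor>A i0 / s i0\<rfloor>}) *
        (\<Prod>i\<in>{..<N} - {i0}. real (card {\<lfloor>- (A i / s i)\<rfloor>..\<lfloor>A i / s i\<rfloor>}))"
      using i0(1) by (intro prod.remove) auto
    \<comment> \<open>A short side contributes \<open>2 * (2 * A i) + 2\<close>, which is at most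
      \<open>6 * A i\<close> because radii are at least 1.\<close>
    also have "\<dots> \<le> (2 * (A i0 / B) + 2) * (\<Prod>i\<in>{..<N} - {i0}. 6 * A i)"
    proof (rule mult_mono)
      show "real (card {\<lfloor>- (A i0 / s i0)\<rfloor>..\<lfloor>A i0 / s i0\<rfloor>}) \<le> 2 * (A i0 / B) + 2"
        using floor_range_card[of "A i0 / B"] A0 B0 by (simp add: s_def)
      show "(\<Prod>i\<in>{..<N} - {i0}. real (card {\<lfloor>- (A i / s i)\<rfloor>..\<lfloor>A i / s i\<rfloor>})) \<le> (\<Prod>i\<in>{..<N} - {i0}. 6 * A i)"
      proof (rule prod_mono)
        fix i assume i: "i \<in> {..<N} - {i0}"
        hence "real (card {\<lfloor>- (A i / s i)\<rfloor>..\<lfloor>A i / s i\<rfloor>}) \<le> 2 * (A i / s i) + 2"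
          using A[of i] s0[of i] by (intro floor_range_card) auto
        also have "\<dots> \<le> 6 * A i" using i A[of i] by (simp add: s_def)
        finally show "0 \<le> real (card {\<lfloor>- (A i / s i)\<rfloor>..\<lfloor>A i / s i\<rfloor>}) \<and>
            real (card {\<lfloor>- (A i / s i)\<rfloor>..\<lfloor>A i / s i\<rfloor>}) \<le> 6 * A i" by simp
      qed
    qed (use A0 B0 in \<open>auto intro!: prod_nonneg\<close>)
    also have "(\<Prod>i\<in>{..<N} - {i0}. 6 * A i) = 6 ^ (N - 1) * (P / A i0)"
    proof -
      have "P = A i0 * (\<Prod>i\<in>{..<N} - {i0}. A i)" unfolding P using i0(1) by (intro prod.remove) auto
      hence "P / A i0 = (\<Prod>i\<in>{..<N} - {i0}. A i)" using A0 by simp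
      thus ?thesis using i0(1) by (simp add: prod.distrib card_Diff_singleton)
    qed
    also have "(2 * (A i0 / B) + 2) * (6 ^ (N - 1) * (P / A i0)) = 6 ^ (N - 1) * (2 * P / B + 2 * (P / A i0))"
    proof -
      have e: "A i0 / B * (P / A i0) = P / B" using A0 by simp
      have "(2 * x + 2) * (c * y) = c * (2 * (x * y) + 2 * y)" for x y c :: real
        by (simp add: algebra_simps)
      from this[of "A i0 / B" "6 ^ (N - 1)" "P / A i0"] show ?thesis unfolding e by (simp only: times_divide_eq_right)
    qed
    \<comment> \<open>The largest radius is at least the geometric mean
      \<open>P powr (1 / N)\<close>.\<close>
    also have "\<dots> \<le> 6 ^ N * (2 * P / B + 2 * P powr (1 - 1 / N))"
    proof (rule mult_mono)
      have "P / A i0 \<le> P / P powr (1 / N)" using PA P1 A0 by (intro divide_left_mono mult_pos_pos) auto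
      also have "\<dots> = P powr (1 - 1 / N)" using P1 by (simp add: powr_diff)
      finally show "2 * P / B + 2 * (P / A i0) \<le> 2 * P / B + 2 * P powr (1 - 1 / N)" by simp
      show "0 \<le> 2 * P / B + 2 * (P / A i0)" using P1 A0 B0 by simp
    qed (auto intro: power_increasing)
    also have "\<dots> = n / 2 + 2 * 6 ^ N * P powr (1 - 1 / N)"
      using n0 P1 by (simp add: B_def field_simps)
    also have "\<dots> < n" using many by simp
    finally show ?thesis by (simp add: n W_def)
  qed
  ultimately have "\<not> inj_on cell W"
    using card_inj_on_le[of cell W cells] by (auto simp: cells_def intro: finite_PiE)
  then obtain w w' where w: "w \<in> W" "w' \<in> W" "w \<noteq> w'" "cell w = cell w'" by (auto simp: inj_on_def)
  define d where "d = (\<lambda>i. w i - w' i)"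
  have dO: "d \<in> \<O>" unfolding d_def using w(1,2) by (intro conj_orderD(2)[OF \<O>]) (auto simp: W_def)
  have \<rho>d: "\<bar>\<rho> i d\<bar> < s i" if i: "i < N" for i
  proof -
    have "\<lfloor>\<rho> i w / s i\<rfloor> = \<lfloor>\<rho> i w' / s i\<rfloor>"
      using fun_cong[OF w(4), of i] i by (simp add: cell_def)
    hence "\<bar>\<rho> i w / s i - \<rho> i w' / s i\<bar> < 1" by linarith
    moreover have "\<rho> i w / s i - \<rho> i w' / s i = \<rho> i d / s i" by (simp add: \<rho>_def d_def diff_divide_distrib)
    ultimately show ?thesis using s0[of i] by (simp add: field_simps)
  qed
  obtain k0 where k0: "k0 < N" "d k0 \<noteq> 0"
  proof -
    obtain k where "w k \<noteq> w' k" using w(3) by blast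
    moreover have "k < N" using calculation conj_orderD(1)[OF \<O>] w by (metis IntD1 W_def leI)
    ultimately show ?thesis using that[of k] by (simp add: d_def)
  qed
  have real: "Im (d i) = 0" if "i < N" "\<tau> i = i" for i
    using \<tau>(3)[OF dO that(1)] that(2) by (metis add.inverse_neutral cnj.simps(2) equal_neg_zero)
  have norm_d: "norm (d i) \<le> \<bar>\<rho> i d\<bar> + (if \<tau> i = i then 0 else \<bar>\<rho> (\<tau> i) d\<bar>)" if i: "i < N" for i
  proof (cases "\<tau> i = i")
    case True
    thus ?thesis using real[OF i True] by (simp add: \<rho>_def cmod_eq_Re)
  next
    case False
    have "\<bar>\<rho> i d\<bar> + \<bar>\<rho> (\<tau> i) d\<bar> = \<bar>Re (d i)\<bar> + \<bar>Im (d i)\<bar>"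
      using False \<tau>(2)[OF i] \<tau>(3)[OF dO i] by (auto simp: \<rho>_def)
    thus ?thesis using False cmod_le[of "d i"] by simp
  qed
  have small: "norm (d i) < 1" if i: "i < N" "i \<noteq> i0" "i \<noteq> \<tau> i0" for i
  proof -
    have "\<tau> i \<noteq> i0" using \<tau>(2)[OF i(1)] i by auto
    thus ?thesis using norm_d[OF i(1)] \<rho>d[OF i(1)] \<rho>d[OF \<tau>(1)[OF i(1)]] i by (auto simp: s_def split: if_splits)
  qed
  define h where "h = norm (d i0)"
  have h\<tau>: "norm (d (\<tau> i0)) = h" using \<tau>(3)[OF dO i0(1)] by (simp add: h_def)
  \<comment> \<open>The number of coordinates that may be large: 1 at a real coordinate, otherwise
    2. Hence the exponent 2 in the conclusion.\<close>
  define c where "c = card {i0, \<tau> i0}"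
  have c: "0 < c" "c \<le> 2" by (auto simp: c_def card_insert_if)
  have cprod: "(\<Prod>i<N. if i \<in> {i0, \<tau> i0} then x else 1) = x ^ c" for x :: real
  proof -
    have "(\<Prod>i<N. if i \<in> {i0, \<tau> i0} then x else 1) = (\<Prod>i\<in>{i0, \<tau> i0}. x)"
      using i0(1) \<tau>(1)[OF i0(1)] by (intro prod.mono_neutral_cong_right) auto
    thus ?thesis by (simp add: c_def)
  qed
  have h1: "h \<ge> 1"
  proof (rule ccontr)
    assume "\<not> h \<ge> 1"
    have "1 \<le> (\<Prod>i<N. norm (d i))" by (rule conj_order_norm_ge_1[OF \<O> dO k0])
    also have "\<dots> \<le> (\<Prod>i<N. if i \<in> {i0, \<tau> i0} then h else 1)"
      using small h\<tau> by (intro prod_mono) (auto simp: h_def less_imp_le)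
    also have "\<dots> = h ^ c" by (rule cprod)
    also have "\<dots> < 1" using \<open>\<not> h \<ge> 1\<close> c by (intro power_Suc_less_one power_less_one_iff[THEN iffD2]) (auto simp: h_def)
    finally show False by simp
  qed
  have le_h: "norm (d i) \<le> h" if "i < N" for i
    using small[OF that] h\<tau> h1 by (cases "i = i0 \<or> i = \<tau> i0") (auto simp: h_def)
  have "(\<Prod>i<N. max 1 (norm (d i))) \<le> (\<Prod>i<N. if i \<in> {i0, \<tau> i0} then h else 1)"
    using small h\<tau> h1 by (intro prod_mono) (auto simp: h_def less_imp_le)
  also have "\<dots> = h ^ c" by (rule cprod)
  also have "\<dots> \<le> h ^ 2" using h1 c by (intro power_increasing) auto
  finally have maxprod: "(\<Prod>i<N. max 1 (norm (d i))) \<le> h ^ 2" .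
  \<comment> \<open>In the complex case \<open>h\<close> is at most \<open>B + 1 / 2\<close>, and
    \<open>h \<ge> 1\<close> then forces \<open>B \<ge> 1 / 2\<close>.\<close>
  have "h \<le> 2 * B"
  proof -
    have "h \<le> B + (if \<tau> i0 = i0 then 0 else 1 / 2)"
      unfolding h_def using norm_d[OF i0(1)] \<rho>d[OF i0(1)] \<rho>d[OF \<tau>(1)[OF i0(1)]] by (auto simp: s_def split: if_splits)
    thus ?thesis using h1 by (auto split: if_splits)
  qed
  hence hB: "h \<le> 8 * 6 ^ N * P / n" by (simp add: B_def)
  have "inj_on d {..<N}"
  proof (rule conj_orderD(5)[OF \<O> dO i0(1)])
    fix k assume k: "k < N" "k \<noteq> i0"
    show "d k \<noteq> d i0"
    proof (cases "k = \<tau> i0")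
      case True
      hence "\<tau> i0 < i0" using i0(2) k by simp
      hence "\<bar>\<rho> (\<tau> i0) d\<bar> = \<bar>Re (d i0)\<bar>" using \<tau>(2)[OF i0(1)] \<tau>(3)[OF dO i0(1)] by (simp add: \<rho>_def)
      hence "\<bar>Re (d i0)\<bar> < 1 / 2" using \<rho>d[OF \<tau>(1)[OF i0(1)]] \<open>\<tau> i0 < i0\<close> by (simp add: s_def)
      hence "Im (d i0) \<noteq> 0" using h1 cmod_le[of "d i0"] by (auto simp: h_def)
      thus ?thesis using True \<tau>(3)[OF dO i0(1)] by (auto simp: complex_eq_iff)
    next
      case False
      thus ?thesis using small[OF k(1,2) False] h1 by (auto simp: h_def)
    qed
  qed
  thus ?thesis using dO h1 hB le_h maxprod by blast
qed

section \<open>Counting factorizations\<close>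

lemma factored_poly_cong:
  "(\<And>j i. j < M \<Longrightarrow> i < N \<Longrightarrow> v j i = v' j i) \<Longrightarrow> factored_poly N M v = factored_poly N M v'"
  unfolding factored_poly_def by (intro prod.cong arg_cong2[of _ _ _ _ "(+)"] sum.cong) auto

text \<open>The last clause applies in particular to complex conjugate coordinates;
  \<open>small_generator\<close> relies on it when it moves its long direction within a conjugate
  pair.\<close>

definition blocks_in :: "nat \<Rightarrow> nat \<Rightarrow> (nat \<Rightarrow> real) \<Rightarrow> (nat \<Rightarrow> complex) set \<Rightarrow> (nat \<Rightarrow> nat \<Rightarrow> complex) \<Rightarrow> bool" where
  "blocks_in N M A \<O> v \<longleftrightarrow> conj_order N \<O> \<and> (\<forall>j. v j \<in> \<O>) \<and>
     (\<forall>i<N. \<forall>k<N. i \<noteq> k \<longrightarrow> (\<exists>j<M. v j i \<noteq> v j k)) \<and> (\<forall>j<M. v j \<in> polydisc N A) \<and>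
     (\<forall>i<N. \<forall>k<N. (\<forall>w\<in>\<O>. norm (w k) = norm (w i)) \<longrightarrow> A k = A i)"

lemma blocks_inD:
  assumes "blocks_in N M A \<O> v"
  shows "conj_order N \<O>" "v j \<in> \<O>" "i < N \<Longrightarrow> k < N \<Longrightarrow> i \<noteq> k \<Longrightarrow> \<exists>j<M. v j i \<noteq> v j k"
    "j < M \<Longrightarrow> v j \<in> polydisc N A"
    "i < N \<Longrightarrow> k < N \<Longrightarrow> (\<And>w. w \<in> \<O> \<Longrightarrow> norm (w k) = norm (w i)) \<Longrightarrow> A k = A i"
proof -
  note c1 = assms[unfolded blocks_in_def] note c2 = conjunct2[OF c1] note c3 = conjunct2[OF c2]
  note c4 = conjunct2[OF c3]
  show "conj_order N \<O>" by (rule conjunct1[OF c1])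
  show "v j \<in> \<O>" using conjunct1[OF c2] by simp
  show "i < N \<Longrightarrow> k < N \<Longrightarrow> i \<noteq> k \<Longrightarrow> \<exists>j<M. v j i \<noteq> v j k" using conjunct1[OF c3] by simp
  show "j < M \<Longrightarrow> v j \<in> polydisc N A" using conjunct1[OF c4] by simp
  show "A k = A i" if "i < N" "k < N" "\<And>w. w \<in> \<O> \<Longrightarrow> norm (w k) = norm (w i)"
    by (rule conjunct2[OF c4, rule_format, OF that])
qed

text \<open>The multipliers are powers of a single \<open>t\<close>. Coordinates \<open>i\<close>
  and \<open>k\<close> coincide only if \<open>t\<close> is a root of a nonzero polynomial with at
  most \<open>M\<close> roots, so at most \<open>N * N * M\<close> of the
  \<open>N * N * M + 1\<close> candidates fail.\<close>

lemma separating_combination: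
  fixes v :: "nat \<Rightarrow> nat \<Rightarrow> complex"
  assumes sep: "\<And>i k. i < N \<Longrightarrow> k < N \<Longrightarrow> i \<noteq> k \<Longrightarrow> \<exists>j<M. v j i \<noteq> v j k"
  shows "\<exists>t\<le>N * N * M. inj_on (\<lambda>i. \<Sum>j<M. of_nat (t ^ j) * v j i) {..<N}"
proof (rule ccontr)
  assume neg: "\<not> ?thesis"
  define q where "q i k = (\<Sum>j<M. Polynomial.monom (v j i - v j k) j)" for i k
  define T where "T i k = {t::nat. poly (q i k) (of_nat t) = 0}" for i k
  define I where "I = {(i, k). i < N \<and> k < N \<and> i \<noteq> k}"
  have finI: "finite I" and cI: "card I \<le> N * N"
  proof -
    have s: "I \<subseteq> {..<N} \<times> {..<N}" by (auto simp: I_def)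
    show "finite I" by (rule finite_subset[OF s]) simp
    have "card I \<le> card ({..<N} \<times> {..<N})" by (rule card_mono[OF _ s]) simp
    thus "card I \<le> N * N" by simp
  qed
  have T: "finite (T i k)" "card (T i k) \<le> M" if ik: "(i, k) \<in> I" for i k
  proof -
    obtain j where j: "j < M" "v j i \<noteq> v j k" using sep ik by (auto simp: I_def)
    have "coeff (q i k) j = v j i - v j k" using j(1) by (simp add: q_def coeff_sum)
    hence q0: "q i k \<noteq> 0" using j(2) by auto
    have deg: "degree (q i k) \<le> M"
      by (rule degree_le) (auto simp: q_def coeff_sum)
    have im: "of_nat ` T i k \<subseteq> {z. poly (q i k) z = 0}" by (auto simp: T_def)
    have inj: "inj_on (of_nat :: nat \<Rightarrow> complex) (T i k)" by (simp add: inj_on_def)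
    show "finite (T i k)" by (rule inj_on_finite[OF inj im poly_roots_finite[OF q0]])
    have "card (T i k) \<le> card {z. poly (q i k) z = 0}"
      by (rule card_inj_on_le[OF inj im poly_roots_finite[OF q0]])
    thus "card (T i k) \<le> M" using poly_roots_degree[OF q0] deg by linarith
  qed
  have "{..N * N * M} \<subseteq> (\<Union>x\<in>I. T (fst x) (snd x))"
  proof
    fix t assume "t \<in> {..N * N * M}"
    hence "\<not> inj_on (\<lambda>i. \<Sum>j<M. of_nat (t ^ j) * v j i) {..<N}" using neg by auto
    then obtain i k where ik: "i < N" "k < N" "i \<noteq> k"
      "(\<Sum>j<M. of_nat (t ^ j) * v j i) = (\<Sum>j<M. of_nat (t ^ j) * v j k)" by (auto simp: inj_on_def)
    have "poly (q i k) (of_nat t) = (\<Sum>j<M. of_nat (t ^ j) * v j i) - (\<Sum>j<M. of_nat (t ^ j) * v j k)"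
      by (simp add: q_def poly_sum poly_monom sum_subtractf[symmetric] algebra_simps)
    hence "t \<in> T i k" using ik by (simp add: T_def)
    thus "t \<in> (\<Union>x\<in>I. T (fst x) (snd x))" using ik by (intro UN_I[of "(i, k)"]) (auto simp: I_def)
  qed
  hence "card {..N * N * M} \<le> card (\<Union>x\<in>I. T (fst x) (snd x))"
    using finI T(1) by (intro card_mono) auto
  also have "\<dots> \<le> (\<Sum>x\<in>I. card (T (fst x) (snd x)))" by (rule card_UN_le[OF finI])
  also have "\<dots> \<le> (\<Sum>x\<in>I. M)" by (intro sum_mono) (use T(2) in auto)
  also have "\<dots> \<le> N * N * M" using cI by simp
  finally show False by simp
qed

lemma card_UN_le_real:
  fixes B :: real
  assumes "finite I" "\<And>i. i \<in> I \<Longrightarrow> finite (F i)" "\<And>i. i \<in> I \<Longrightarrow> real (card (F i)) \<le> B"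
  shows "finite (\<Union>i\<in>I. F i)" "real (card (\<Union>i\<in>I. F i)) \<le> real (card I) * B"
proof -
  show "finite (\<Union>i\<in>I. F i)" using assms by blast
  have "real (card (\<Union>i\<in>I. F i)) \<le> real (\<Sum>i\<in>I. card (F i))"
    using card_UN_le[OF assms(1), of F] by (simp only: of_nat_le_iff)
  also have "\<dots> = (\<Sum>i\<in>I. real (card (F i)))" by simp
  also have "\<dots> \<le> (\<Sum>i\<in>I. B)" by (intro sum_mono assms(3))
  finally show "real (card (\<Union>i\<in>I. F i)) \<le> real (card I) * B" by simp
qed

lemma card_image_PiE_le:
  fixes Y :: real
  assumes "finite W" "real (card W) \<le> Y" "finite J"
  shows "finite (g ` PiE J (\<lambda>_. W))" "real (card (g ` PiE J (\<lambda>_. W))) \<le> Y ^ card J"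
proof -
  have f: "finite (PiE J (\<lambda>_. W))" using assms by (intro finite_PiE) auto
  show "finite (g ` PiE J (\<lambda>_. W))" using f by simp
  have "real (card (g ` PiE J (\<lambda>_. W))) \<le> real (card (PiE J (\<lambda>_. W)))"
    using card_image_le[OF f, of g] by simp
  also have "\<dots> = real (card W) ^ card J" using assms(3) by (simp add: card_PiE)
  also have "\<dots> \<le> Y ^ card J" using assms(2) by (intro power_mono) auto
  finally show "real (card (g ` PiE J (\<lambda>_. W))) \<le> Y ^ card J" .
qed

text \<open>
  Here the order is recovered from a generator that is a small combination of the coefficient
  vectors; it replaces one of them, so that only \<open>M - 1\<close> free points of the order remain.
\<close>
lemma count_few_points:
  fixes A :: "nat \<Rightarrow> real" and Y :: real
  assumes N: "N > 0" and M: "M > 0" and A: "\<And>i. i < N \<Longrightarrow> A i \<ge> 1" and P: "P = (\<Prod>i<N. A i)"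
    and T: "T = N * N * M" and K: "K = real M * real T ^ M"
    and Y: "Y \<ge> 0"
    and F: "F = {factored_poly N M v |v \<O>. blocks_in N M A \<O> v \<and> real (card (\<O> \<inter> polydisc N A)) \<le> Y}"
  shows "finite F"
    "real (card F) \<le> (real T + 1) * ((real N ^ N * (2 * (2 ^ N * (K ^ N * P)) + 1) ^ N) * Y ^ (M - 1))"
proof -
  have T1: "T \<ge> 1" using N M by (simp add: T)
  have K1: "K \<ge> 1" unfolding K using M T1 mult_mono[of 1 "real M" 1 "real T ^ M"] by simp
  have P1: "P \<ge> 1" unfolding P using A by (intro prod_ge_1) auto
  have KA: "K * A i \<ge> 1" if "i < N" for i using K1 A[OF that] mult_mono[of 1 K 1 "A i"] by simp
  have PK: "(\<Prod>i<N. K * A i) = K ^ N * P" by (simp add: prod.distrib P)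
  \<comment> \<open>The point count refers to \<open>integral_span N u\<close>, so that a generator
    still carries the bound once its order is forgotten.\<close>
  define U where "U = {u. \<exists>\<O>. conj_order N \<O> \<and> u \<in> \<O> \<and> u \<in> polydisc N (\<lambda>i. K * A i) \<and>
    finite (integral_span N u \<inter> polydisc N A) \<and> real (card (integral_span N u \<inter> polydisc N A)) \<le> Y}"
  have U\<O>: "\<exists>\<O>. conj_order N \<O> \<and> w \<in> \<O> \<and> w \<in> polydisc N (\<lambda>i. K * A i)" if "w \<in> U" for w
    using that unfolding U_def by blast
  have u1: "w i = 0" if "w \<in> U" "i \<ge> N" for w i
    using U\<O>[OF that(1)] conj_orderD(1) that(2) by blast
  have u2: "coeff (\<Prod>i<N. [:- w i, 1:]) k \<in> \<int>" if "w \<in> U" "k < N" for w k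
    using U\<O>[OF that(1)] conj_orderD(3) by blast
  have u3: "norm (coeff (\<Prod>i<N. [:- w i, 1:]) k) \<le> 2 ^ N * (K ^ N * P)" if "w \<in> U" "k < N" for w k
    using U\<O>[OF that(1)] coeff_bound_polydisc[of w N "\<lambda>i. K * A i" k] KA unfolding PK by blast
  have u4: "0 \<le> 2 ^ N * (K ^ N * P)" using K1 P1 by simp
  have U: "finite U" "real (card U) \<le> real N ^ N * (2 * (2 ^ N * (K ^ N * P)) + 1) ^ N"
  proof -
    show "finite U"
      by (rule count_charpoly(1)[where W = U and N = N and b = "\<lambda>_. 2 ^ N * (K ^ N * P)"])
        (simp_all only: u1 u2 u3 u4)
    have "real (card U) \<le> real N ^ N * (\<Prod>k<N. 2 * (2 ^ N * (K ^ N * P)) + 1)"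
      by (rule count_charpoly(2)[where W = U and N = N and b = "\<lambda>_. 2 ^ N * (K ^ N * P)"])
        (simp_all only: u1 u2 u3 u4)
    thus "real (card U) \<le> real N ^ N * (2 * (2 ^ N * (K ^ N * P)) + 1) ^ N" by simp
  qed
  \<comment> \<open>Solves the combination for coefficient vector 0, whose multiplier is
    \<open>t ^ 0 = 1\<close>, also for \<open>t = 0\<close>; no division occurs.\<close>
  define \<Psi> where "\<Psi> t u v = factored_poly N M (\<lambda>j i. if j = 0 then u i - (\<Sum>j\<in>{1..<M}. of_nat (t ^ j) * v j i) else v j i)"
    for t :: nat and u and v :: "nat \<Rightarrow> nat \<Rightarrow> complex"
  define G where "G = (\<Union>t\<in>{..T}. \<Union>u\<in>U. \<Psi> t u ` PiE {1..<M} (\<lambda>_. integral_span N u \<inter> polydisc N A))"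
  have Gu: "finite (\<Psi> t u ` PiE {1..<M} (\<lambda>_. integral_span N u \<inter> polydisc N A))"
    "real (card (\<Psi> t u ` PiE {1..<M} (\<lambda>_. integral_span N u \<inter> polydisc N A))) \<le> Y ^ (M - 1)" if "u \<in> U" for t u
    using card_image_PiE_le[of "integral_span N u \<inter> polydisc N A" Y "{1..<M}" "\<Psi> t u"] that by (auto simp: U_def)
  have Gt: "finite (\<Union>u\<in>U. \<Psi> t u ` PiE {1..<M} (\<lambda>_. integral_span N u \<inter> polydisc N A))"
    "real (card (\<Union>u\<in>U. \<Psi> t u ` PiE {1..<M} (\<lambda>_. integral_span N u \<inter> polydisc N A))) \<le> real (card U) * Y ^ (M - 1)" for t
    by (rule card_UN_le_real[OF U(1) Gu]; assumption)+
  have G: "finite G" "real (card G) \<le> real (card {..T}) * (real (card U) * Y ^ (M - 1))"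
    unfolding G_def by (rule card_UN_le_real[OF _ Gt]; simp)+
  have FG: "F \<subseteq> G"
  proof
    fix p assume "p \<in> F"
    then obtain v \<O> where v: "p = factored_poly N M v" "blocks_in N M A \<O> v"
      "real (card (\<O> \<inter> polydisc N A)) \<le> Y" unfolding F by blast
    note D = blocks_inD[OF v(2)]
    obtain t where t: "t \<le> T" "inj_on (\<lambda>i. \<Sum>j<M. of_nat (t ^ j) * v j i) {..<N}"
      using separating_combination[of N M v, OF D(3)] unfolding T by blast
    define u where "u = (\<lambda>i. \<Sum>j<M. of_nat (t ^ j) * v j i)"
    have uO: "u \<in> \<O>" unfolding u_def by (rule conj_order_comb[OF D(1,2)])
    have span: "\<O> = integral_span N u" using conj_orderD(6)[OF D(1) uO] t(2) by (simp add: u_def)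
    have "norm (u i) \<le> K * A i" if i: "i < N" for i
    proof -
      have "norm (u i) \<le> (\<Sum>j<M. norm (of_nat (t ^ j) * v j i))" unfolding u_def by (rule norm_sum)
      also have "\<dots> \<le> (\<Sum>j<M. real T ^ M * A i)"
      proof (rule sum_mono)
        fix j assume j: "j \<in> {..<M}"
        have "real t ^ j \<le> real T ^ j" using t(1) by (intro power_mono) auto
        also have "\<dots> \<le> real T ^ M" using T1 j by (intro power_increasing) auto
        finally have "real t ^ j \<le> real T ^ M" .
        moreover have "norm (v j i) \<le> A i" using D(4)[of j] j i by (simp add: polydisc_def)
        ultimately show "norm (of_nat (t ^ j) * v j i) \<le> real T ^ M * A i"
          by (simp add: norm_mult norm_power mult_mono)
      qed
      finally show ?thesis by (simp add: K)
    qed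
    hence uB: "u \<in> polydisc N (\<lambda>i. K * A i)" by (simp add: polydisc_def)
    have fin: "finite (\<O> \<inter> polydisc N A)" by (rule finite_conj_order_polydisc[OF D(1) A])
    have uU: "u \<in> U" unfolding U_def using D(1) uO uB fin v(3) span[symmetric] by auto
    have pe: "p = \<Psi> t u (restrict v {1..<M})"
      unfolding v(1) \<Psi>_def
    proof (rule factored_poly_cong)
      fix j i assume ji: "j < M" "i < N"
      have "{..<M} = insert 0 {1..<M}" using M by auto
      hence "u i = v 0 i + (\<Sum>j\<in>{1..<M}. of_nat (t ^ j) * v j i)" by (simp add: u_def)
      thus "v j i = (if j = 0 then u i - (\<Sum>j\<in>{1..<M}. of_nat (t ^ j) * restrict v {1..<M} j i)
          else restrict v {1..<M} j i)" using ji by simp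
    qed
    have "restrict v {1..<M} \<in> PiE {1..<M} (\<lambda>_. integral_span N u \<inter> polydisc N A)"
      using D(2,4) span by auto
    thus "p \<in> G" unfolding G_def pe using t(1) uU by blast
  qed
  show "finite F" by (rule finite_subset[OF FG G(1)])
  have "real (card F) \<le> real (card G)" using card_mono[OF G(1) FG] by simp
  also have "\<dots> \<le> (real T + 1) * (real (card U) * Y ^ (M - 1))"
    using G(2) by (simp add: add.commute)
  also have "\<dots> \<le> (real T + 1) * ((real N ^ N * (2 * (2 ^ N * (K ^ N * P)) + 1) ^ N) * Y ^ (M - 1))"
    using U(2) Y by (intro mult_left_mono mult_right_mono) auto
  finally show "real (card F) \<le> (real T + 1) * ((real N ^ N * (2 * (2 ^ N * (K ^ N * P)) + 1) ^ N) * Y ^ (M - 1))" .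
qed


text \<open>The trace is linear in the conjugates, whereas the other coefficients of a small
  generator are bounded by a square. Without this saving of one factor the exponent for
  \<open>N = M = 2\<close> would be 7/2 instead of 3.\<close>

lemma coeff_prod_linear_subleading:
  fixes w :: "nat \<Rightarrow> complex"
  shows "coeff (\<Prod>i<Suc n. [:- w i, 1:]) n = - (\<Sum>i<Suc n. w i)"
proof (induction n)
  case (Suc n)
  have "coeff (\<Prod>i<Suc n. [:- w i, 1:]) (Suc n) = 1"
    using lead_coeff_prod_linear[of w "{..<Suc n}"] by simp
  moreover have "(\<Prod>i<Suc (Suc n). [:- w i, 1:]) = [:- w (Suc n), 1:] * (\<Prod>i<Suc n. [:- w i, 1:])"
    by (simp only: prod.lessThan_Suc mult.commute)
  ultimately show ?case using Suc by (simp del: prod.lessThan_Suc)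
qed simp

text \<open>
  Here the order is recovered from the small generator instead. The number \<open>k\<close> bounds the size of its
  conjugates; the smaller \<open>k\<close>, the more points but the fewer generators.
\<close>
lemma count_many_points:
  fixes A :: "nat \<Rightarrow> real"
  assumes N: "N > 0" and A: "\<And>i. i < N \<Longrightarrow> A i \<ge> 1" and P: "P = (\<Prod>i<N. A i)"
    and F: "F = {factored_poly N M v |v \<O>. blocks_in N M A \<O> v \<and>
      real (card (\<O> \<inter> polydisc N A)) > 4 * 6 ^ N * P powr (1 - 1 / N)}"
  shows "finite F"
    "real (card F) \<le> (\<Sum>k\<in>{1..nat \<lfloor>4 * P powr (1 / N)\<rfloor>}.
       (real N ^ N * ((2 * (real N * real k) + 1) * (2 * (2 ^ N * real k ^ 2) + 1) ^ (N - 1))) * (16 * 6 ^ N * P / real k) ^ M)"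
proof -
  have P1: "P \<ge> 1" unfolding P using A by (intro prod_ge_1) auto
  obtain N' where N': "N = Suc N'" using N by (cases N) auto
  \<comment> \<open>Index \<open>N'\<close> belongs to the trace. The other coefficients involve
    products of conjugates, of which at most two leave the unit disc.\<close>
  define b where "b k j = (if j = N' then real N * real k else 2 ^ N * real k ^ 2)" for k j :: nat
  define D where "D k = {d. (\<forall>i\<ge>N. d i = 0) \<and>
    (\<forall>j<N. coeff (\<Prod>i<N. [:- d i, 1:]) j \<in> \<int> \<and> norm (coeff (\<Prod>i<N. [:- d i, 1:]) j) \<le> b k j) \<and>
    finite (integral_span N d \<inter> polydisc N A) \<and>
    real (card (integral_span N d \<inter> polydisc N A)) \<le> 16 * 6 ^ N * P / real k}" for k :: nat
  define B1 where "B1 k = real N ^ N * ((2 * (real N * real k) + 1) * (2 * (2 ^ N * real k ^ 2) + 1) ^ (N - 1))" for k :: nat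
  define B2 where "B2 k = (16 * 6 ^ N * P / real k) ^ M" for k :: nat
  have D: "finite (D k)" "real (card (D k)) \<le> B1 k" for k
  proof -
    have u: "\<forall>w\<in>D k. \<forall>i\<ge>N. w i = 0" "\<forall>w\<in>D k. \<forall>j<N. coeff (\<Prod>i<N. [:- w i, 1:]) j \<in> \<int>"
      "\<forall>w\<in>D k. \<forall>j<N. norm (coeff (\<Prod>i<N. [:- w i, 1:]) j) \<le> b k j" "\<forall>j<N. 0 \<le> b k j"
      by (simp_all add: D_def b_def)
    show "finite (D k)"
      by (rule count_charpoly(1)[where W = "D k" and N = N and b = "b k"]) (simp_all only: u)
    have "real (card (D k)) \<le> real N ^ N * (\<Prod>j<N. 2 * b k j + 1)"
      by (rule count_charpoly(2)[where W = "D k" and N = N and b = "b k"]) (simp_all only: u)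
    also have "(\<Prod>j<N. 2 * b k j + 1) = (\<Prod>j<N'. 2 * b k j + 1) * (2 * b k N' + 1)"
      unfolding N' by simp
    also have "(\<Prod>j<N'. 2 * b k j + 1) = (\<Prod>j<N'. 2 * (2 ^ N * real k ^ 2) + 1)"
      by (intro prod.cong) (auto simp: b_def)
    finally show "real (card (D k)) \<le> B1 k" unfolding B1_def
      by (simp add: N' b_def mult.commute mult.left_commute)
  qed
  \<comment> \<open>The constant is \<open>2 * 8 / 4\<close>: from \<open>k \<le> 2 * h\<close>, the
    bound on \<open>h\<close> in \<open>small_generator\<close>, and the threshold for
    \<open>n\<close>.\<close>
  define J where "J = {1..nat \<lfloor>4 * P powr (1 / N)\<rfloor>}"
  define G1 where "G1 d = factored_poly N M ` PiE {..<M} (\<lambda>_. integral_span N d \<inter> polydisc N A)" for d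
  define G where "G k = (\<Union>d\<in>D k. G1 d)" for k
  have G1: "finite (G1 d)" "real (card (G1 d)) \<le> B2 k" if "d \<in> D k" for d k
    using card_image_PiE_le[of "integral_span N d \<inter> polydisc N A" "16 * 6 ^ N * P / real k" "{..<M}" "factored_poly N M"]
      that by (simp_all add: D_def G1_def B2_def)
  have B20: "B2 k \<ge> 0" for k unfolding B2_def using P1 by simp
  have G: "finite (G k)" "real (card (G k)) \<le> B1 k * B2 k" for k
  proof -
    show "finite (G k)" unfolding G_def by (rule card_UN_le_real(1)[OF D(1) G1])
    have "real (card (G k)) \<le> real (card (D k)) * B2 k" unfolding G_def by (rule card_UN_le_real(2)[OF D(1) G1])
    also have "\<dots> \<le> B1 k * B2 k" by (intro mult_right_mono D B20)
    finally show "real (card (G k)) \<le> B1 k * B2 k" .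
  qed
  have FG: "F \<subseteq> (\<Union>k\<in>J. G k)"
  proof
    fix p assume "p \<in> F"
    then obtain v \<O> where v: "p = factored_poly N M v" "blocks_in N M A \<O> v"
      "real (card (\<O> \<inter> polydisc N A)) > 4 * 6 ^ N * P powr (1 - 1 / N)" unfolding F by blast
    note E = blocks_inD[OF v(2)]
    define n where "n = real (card (\<O> \<inter> polydisc N A))"
    have n: "n > 4 * 6 ^ N * P powr (1 - 1 / N)" using v(3) by (simp add: n_def)
    have n0: "n > 0"
    proof -
      have "0 \<le> 4 * 6 ^ N * P powr (1 - 1 / N)" by simp
      thus ?thesis using n by linarith
    qed
    obtain d h where d: "d \<in> \<O>" "inj_on d {..<N}" "1 \<le> h" "h \<le> 8 * 6 ^ N * P / n"
      "\<forall>i<N. norm (d i) \<le> h" "(\<Prod>i<N. max 1 (norm (d i))) \<le> h ^ 2"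
      using small_generator[OF E(1) N A E(5) n_def P n] by blast
    \<comment> \<open>Rounding up leaves finitely many sizes; as \<open>h \<ge> 1\<close>, it at
      most doubles the bound.\<close>
    define k where "k = nat \<lceil>h\<rceil>"
    have hk: "h \<le> real k" "real k \<le> 2 * h" using d(3) unfolding k_def by linarith+
    have k1: "k \<ge> 1" using hk(1) d(3) by linarith
    have span: "\<O> = integral_span N d" by (rule conj_orderD(6)[OF E(1) d(1,2)])
    have n_le: "n \<le> 16 * 6 ^ N * P / real k"
    proof -
      have "real k * n \<le> 2 * h * n" using hk(2) n0 by (intro mult_right_mono) auto
      also have "\<dots> \<le> 2 * (8 * 6 ^ N * P / n) * n" using d(4) n0 by (intro mult_right_mono mult_left_mono) auto
      also have "\<dots> = 16 * 6 ^ N * P" using n0 by simp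
      finally show ?thesis using k1 by (simp add: pos_le_divide_eq mult.commute)
    qed
    have "k \<in> J"
    proof -
      have "real k \<le> 2 * (8 * 6 ^ N * P / n)" using hk(2) d(4) by linarith
      also have "\<dots> \<le> 2 * (8 * 6 ^ N * P / (4 * 6 ^ N * P powr (1 - 1 / N)))"
        using n P1 n0 by (intro mult_left_mono divide_left_mono mult_pos_pos) auto
      also have "\<dots> = 4 * (P / P powr (1 - 1 / N))" by simp
      also have "P / P powr (1 - 1 / N) = P powr (1 / N)" using P1 by (simp add: powr_diff)
      finally have "real k \<le> 4 * P powr (1 / N)" .
      thus ?thesis using k1 by (simp add: J_def le_nat_floor)
    qed
    have "d \<in> D k" unfolding D_def mem_Collect_eq
    proof (intro conjI allI impI)
      show "d i = 0" if "i \<ge> N" for i by (rule conj_orderD(1)[OF E(1) d(1) that])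
      show "coeff (\<Prod>i<N. [:- d i, 1:]) j \<in> \<int>" for j by (rule conj_orderD(3)[OF E(1) d(1)])
      show "finite (integral_span N d \<inter> polydisc N A)" unfolding span[symmetric] by (rule finite_conj_order_polydisc[OF E(1) A])
      show "real (card (integral_span N d \<inter> polydisc N A)) \<le> 16 * 6 ^ N * P / real k"
        using n_le unfolding n_def span .
      show "norm (coeff (\<Prod>i<N. [:- d i, 1:]) j) \<le> b k j" for j
      proof (cases "j = N'")
        case True
        have "norm (coeff (\<Prod>i<N. [:- d i, 1:]) j) = norm (\<Sum>i<N. d i)"
          unfolding True N' coeff_prod_linear_subleading norm_minus_cancel ..
        also have "\<dots> \<le> (\<Sum>i<N. norm (d i))" by (rule norm_sum)
        also have "\<dots> \<le> (\<Sum>i<N. real k)" using d(5) hk(1) by (intro sum_mono) (auto intro: order_trans)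
        finally show ?thesis using True by (simp add: b_def)
      next
        case False
        have "norm (coeff (\<Prod>i<N. [:- d i, 1:]) j) \<le> 2 ^ N * (\<Prod>i<N. max 1 (norm (d i)))"
          using coeff_prod_linear_bound[of "{..<N}" d j] by simp
        also have "\<dots> \<le> 2 ^ N * h ^ 2" using d(6) by (intro mult_left_mono) auto
        also have "\<dots> \<le> 2 ^ N * real k ^ 2" using hk(1) d(3) by (intro mult_left_mono power_mono) auto
        finally show ?thesis using False by (simp add: b_def)
      qed
    qed
    moreover have "p \<in> G1 d"
    proof -
      have "restrict v {..<M} \<in> PiE {..<M} (\<lambda>_. integral_span N d \<inter> polydisc N A)"
        using E(2,4) span by auto
      moreover have "p = factored_poly N M (restrict v {..<M})" unfolding v(1) by (rule factored_poly_cong) simp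
      ultimately show ?thesis by (simp add: G1_def)
    qed
    ultimately show "p \<in> (\<Union>k\<in>J. G k)" using \<open>k \<in> J\<close> by (auto simp: G_def)
  qed
  have finJ: "finite J" by (simp add: J_def)
  have finG: "finite (\<Union>k\<in>J. G k)" using finJ G(1) by blast
  show "finite F" by (rule finite_subset[OF FG finG])
  have "card F \<le> card (\<Union>k\<in>J. G k)" by (rule card_mono[OF finG FG])
  also have "\<dots> \<le> (\<Sum>k\<in>J. card (G k))" by (rule card_UN_le[OF finJ])
  finally have "real (card F) \<le> real (\<Sum>k\<in>J. card (G k))" by (simp only: of_nat_le_iff)
  also have "\<dots> = (\<Sum>k\<in>J. real (card (G k)))" by simp
  also have "\<dots> \<le> (\<Sum>k\<in>J. B1 k * B2 k)" by (intro sum_mono G(2))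
  finally show "real (card F) \<le> (\<Sum>k\<in>{1..nat \<lfloor>4 * P powr (1 / N)\<rfloor>}.
       (real N ^ N * ((2 * (real N * real k) + 1) * (2 * (2 ^ N * real k ^ 2) + 1) ^ (N - 1))) * (16 * 6 ^ N * P / real k) ^ M)"
    by (simp only: J_def B1_def B2_def)
qed

text \<open>There are about \<open>k ^ (2 * N - 1)\<close> generators, so a summand is of order
  \<open>P ^ M * k powr e\<close>. It is estimated at an end of the range, with
  \<open>1 + Y powr e\<close> covering both signs of \<open>e\<close>, and multiplied by the number
  of summands, which costs \<open>P powr (1 / N)\<close>.\<close>

lemma sum_many_points_bound:
  fixes P :: real and N M :: nat
  assumes N: "N > 0" and P1: "P \<ge> 1"
  defines "e \<equiv> 2 * real N - 1 - real M"
  shows "(\<Sum>k\<in>{1..nat \<lfloor>4 * P powr (1 / N)\<rfloor>}.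
       (real N ^ N * ((2 * (real N * real k) + 1) * (2 * (2 ^ N * real k ^ 2) + 1) ^ (N - 1))) * (16 * 6 ^ N * P / real k) ^ M)
    \<le> 4 * (real N ^ N * (3 * real N * (3 * 2 ^ N) ^ (N - 1)) * (16 * 6 ^ N) ^ M) *
        (P powr (M + 1 / N) + 4 powr e * P powr (M + 1 / N + e / N))"
proof -
  define c where "c = real N ^ N * (3 * real N * (3 * 2 ^ N) ^ (N - 1)) * (16 * 6 ^ N) ^ M"
  define Y where "Y = 4 * P powr (1 / N)"
  have Y1: "Y \<ge> 1" unfolding Y_def using ge_one_powr_ge_zero[OF P1, of "1 / N"] by simp
  have c0: "c \<ge> 0" by (simp add: c_def)
  have term_le: "(real N ^ N * ((2 * (real N * real k) + 1) * (2 * (2 ^ N * real k ^ 2) + 1) ^ (N - 1))) * (16 * 6 ^ N * P / real k) ^ M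
      \<le> c * (P ^ M * (1 + Y powr e))" if k: "k \<in> {1..nat \<lfloor>Y\<rfloor>}" for k
  proof -
    have k1: "real k \<ge> 1" using k by simp
    have kY: "real k \<le> Y" using k Y1 by (simp add: le_nat_iff le_floor_iff)
    have a: "2 * (real N * real k) + 1 \<le> 3 * real N * real k"
      using mult_mono[of 1 "real N" 1 "real k"] N k1 by simp
    have b: "2 * (2 ^ N * real k ^ 2) + 1 \<le> 3 * 2 ^ N * real k ^ 2"
      using mult_mono[of 1 "2 ^ N :: real" 1 "real k ^ 2"] k1 by simp
    have "(2 * (real N * real k) + 1) * (2 * (2 ^ N * real k ^ 2) + 1) ^ (N - 1)
        \<le> (3 * real N * real k) * (3 * 2 ^ N * real k ^ 2) ^ (N - 1)"
      using a b by (intro mult_mono power_mono) auto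
    also have "\<dots> = (3 * real N * (3 * 2 ^ N) ^ (N - 1)) * (real k * (real k ^ 2) ^ (N - 1))"
      by (simp add: power_mult_distrib mult_ac)
    also have "real k * (real k ^ 2) ^ (N - 1) = real k powr (2 * real N - 1)"
    proof -
      have "real k * (real k ^ 2) ^ (N - 1) = real k ^ (2 * N - 1)"
        using N by (cases N) (auto simp: power_mult[symmetric])
      also have "\<dots> = real k powr real (2 * N - 1)" using k1 by (simp add: powr_realpow)
      also have "real (2 * N - 1) = 2 * real N - 1" using N by simp
      finally show ?thesis .
    qed
    finally have "(real N ^ N * ((2 * (real N * real k) + 1) * (2 * (2 ^ N * real k ^ 2) + 1) ^ (N - 1))) * (16 * 6 ^ N * P / real k) ^ M
      \<le> (real N ^ N * ((3 * real N * (3 * 2 ^ N) ^ (N - 1)) * real k powr (2 * real N - 1))) * (16 * 6 ^ N * P / real k) ^ M"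
      using P1 by (intro mult_right_mono mult_left_mono) auto
    also have "\<dots> = c * (P ^ M * (real k powr (2 * real N - 1) / real k ^ M))"
      by (simp add: c_def power_mult_distrib power_divide mult_ac)
    also have "real k powr (2 * real N - 1) / real k ^ M = real k powr e"
      using k1 by (simp add: e_def powr_diff powr_realpow)
    also have "real k powr e \<le> 1 + Y powr e"
    proof (cases "e \<ge> 0")
      case True
      have "real k powr e \<le> Y powr e" using True kY k1 by (intro powr_mono2) auto
      thus ?thesis by simp
    next
      case False
      have "real k powr e \<le> real k powr 0" using False k1 by (intro powr_mono) auto
      also have "\<dots> = 1" using k1 by simp
      finally show ?thesis using powr_ge_zero[of Y e] by linarith
    qed
    finally show ?thesis using c0 P1 by (simp add: mult_left_mono)
  qed
  have "(\<Sum>k\<in>{1..nat \<lfloor>Y\<rfloor>}.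
       (real N ^ N * ((2 * (real N * real k) + 1) * (2 * (2 ^ N * real k ^ 2) + 1) ^ (N - 1))) * (16 * 6 ^ N * P / real k) ^ M)
    \<le> (\<Sum>k\<in>{1..nat \<lfloor>Y\<rfloor>}. c * (P ^ M * (1 + Y powr e)))"
    by (rule sum_mono[OF term_le])
  also have "\<dots> = real (nat \<lfloor>Y\<rfloor>) * (c * (P ^ M * (1 + Y powr e)))" by simp
  also have "\<dots> \<le> Y * (c * (P ^ M * (1 + Y powr e)))"
    using Y1 c0 P1 by (intro mult_right_mono mult_nonneg_nonneg add_nonneg_nonneg) auto
  also have "\<dots> = 4 * c * (P powr (1 / N) * P ^ M * (1 + Y powr e))" by (simp add: Y_def mult_ac)
  also have "P powr (1 / N) * P ^ M = P powr (M + 1 / N)"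
    using P1 by (simp add: powr_add powr_realpow mult.commute)
  also have "Y powr e = 4 powr e * P powr (e / N)"
    unfolding Y_def using P1 by (subst powr_mult) (auto simp: powr_powr mult.commute)
  also have "P powr (M + 1 / N) * (1 + 4 powr e * P powr (e / N)) =
      P powr (M + 1 / N) + 4 powr e * P powr (M + 1 / N + e / N)"
    by (simp add: powr_add distrib_left mult_ac)
  finally show ?thesis by (simp only: c_def Y_def)
qed

text \<open>The three lower bounds for \<open>\<mu>\<close> are the exponent of the few-point case
  and the two exponents of \<open>sum_many_points_bound\<close>, the last one being
  \<open>M + 1 / N + e / N\<close>.\<close>

lemma count_polydisc:
  assumes N: "N > 0" and M: "M > 0"
    and \<mu>: "real N + (1 - 1 / N) * (real M - 1) \<le> \<mu>" "real M + 1 / N \<le> \<mu>" "real M + (2 * real N - real M) / N \<le> \<mu>"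
  shows "\<exists>C>0. \<forall>A. (\<forall>i<N. A i \<ge> 1) \<longrightarrow> finite {factored_poly N M v |v \<O>. blocks_in N M A \<O> v} \<and>
    real (card {factored_poly N M v |v \<O>. blocks_in N M A \<O> v}) \<le> C * (\<Prod>i<N. A i) powr \<mu>"
proof -
  define T where "T = N * N * M"
  define K where "K = real M * real T ^ M"
  define e where "e = 2 * real N - 1 - real M"
  define C1 where "C1 = (real T + 1) * (real N ^ N * (2 * (2 ^ N * K ^ N) + 1) ^ N * (4 * 6 ^ N) ^ (M - 1))"
  define C2 where "C2 = 4 * (real N ^ N * (3 * real N * (3 * 2 ^ N) ^ (N - 1)) * (16 * 6 ^ N) ^ M)"
  have C10: "C1 \<ge> 0" unfolding C1_def K_def by simp
  have C20: "C2 \<ge> 0" unfolding C2_def by simp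
  show ?thesis
  proof (intro exI[of _ "C1 + C2 * (1 + 4 powr e) + 1"] conjI allI impI)
    show "C1 + C2 * (1 + 4 powr e) + 1 > 0"
      using C10 C20 by (intro add_nonneg_pos add_nonneg_nonneg mult_nonneg_nonneg) auto
    fix A :: "nat \<Rightarrow> real" assume A: "\<forall>i<N. A i \<ge> 1"
    hence A': "A i \<ge> 1" if "i < N" for i using that by blast
    define P where "P = (\<Prod>i<N. A i)"
    have P1: "P \<ge> 1" unfolding P_def using A' by (intro prod_ge_1) auto
    define Y where "Y = 4 * 6 ^ N * P powr (1 - 1 / N)"
    have Y0: "Y \<ge> 0" by (simp add: Y_def)
    define F1 where "F1 = {factored_poly N M v |v \<O>. blocks_in N M A \<O> v \<and> real (card (\<O> \<inter> polydisc N A)) \<le> Y}"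
    define F2 where "F2 = {factored_poly N M v |v \<O>. blocks_in N M A \<O> v \<and>
      real (card (\<O> \<inter> polydisc N A)) > 4 * 6 ^ N * P powr (1 - 1 / N)}"
    let ?F = "{factored_poly N M v |v \<O>. blocks_in N M A \<O> v}"
    have sub: "?F \<subseteq> F1 \<union> F2"
    proof
      fix p assume "p \<in> ?F"
      then obtain v \<O> where v: "p = factored_poly N M v" "blocks_in N M A \<O> v" by blast
      show "p \<in> F1 \<union> F2"
      proof (cases "real (card (\<O> \<inter> polydisc N A)) \<le> Y")
        case True
        thus ?thesis using v unfolding F1_def by blast
      next
        case False
        thus ?thesis using v unfolding F2_def Y_def not_le by blast
      qed
    qed
    have f1: "finite F1" by (rule count_few_points(1)[OF N M A' P_def T_def K_def Y0 F1_def])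
    have f2: "finite F2" by (rule count_many_points(1)[OF N A' P_def F2_def])
    show "finite ?F" by (rule finite_subset[OF sub]) (use f1 f2 in simp)
    have c1: "real (card F1) \<le> C1 * P powr \<mu>"
    proof -
      have "real (card F1) \<le> (real T + 1) * ((real N ^ N * (2 * (2 ^ N * (K ^ N * P)) + 1) ^ N) * Y ^ (M - 1))"
        by (rule count_few_points(2)[OF N M A' P_def T_def K_def Y0 F1_def])
      also have "\<dots> \<le> (real T + 1) * ((real N ^ N * ((2 * (2 ^ N * K ^ N) + 1) * P) ^ N) * Y ^ (M - 1))"
      proof (intro mult_left_mono mult_right_mono power_mono)
        show "2 * (2 ^ N * (K ^ N * P)) + 1 \<le> (2 * (2 ^ N * K ^ N) + 1) * P"
          using P1 by (simp add: algebra_simps)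
        show "0 \<le> 2 * (2 ^ N * (K ^ N * P)) + 1" using P1 by (simp add: K_def)
      qed (use Y0 in auto)
      also have "\<dots> = C1 * (P ^ N * (P powr (1 - 1 / N)) ^ (M - 1))"
        by (simp add: C1_def Y_def power_mult_distrib mult_ac)
      also have "P ^ N * (P powr (1 - 1 / N)) ^ (M - 1) = P powr (real N + (1 - 1 / N) * (real M - 1))"
        using P1 M by (simp add: powr_add powr_realpow powr_powr of_nat_diff flip: powr_realpow[of "P powr (1 - 1 / N)"])
      also have "C1 * \<dots> \<le> C1 * P powr \<mu>"
        using C10 P1 \<mu>(1) by (intro mult_left_mono powr_mono) auto
      finally show ?thesis .
    qed
    have c2: "real (card F2) \<le> C2 * (1 + 4 powr e) * P powr \<mu>"
    proof -
      have "real (card F2) \<le> C2 * (P powr (M + 1 / N) + 4 powr e * P powr (M + 1 / N + e / N))"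
        unfolding C2_def e_def
        by (rule order_trans[OF count_many_points(2)[OF N A' P_def F2_def] sum_many_points_bound[OF N P1]])
      also have "\<dots> \<le> C2 * (P powr \<mu> + 4 powr e * P powr \<mu>)"
      proof (intro mult_left_mono add_mono powr_mono)
        have "M + 1 / N + e / N = real M + (2 * real N - real M) / N" by (simp add: e_def diff_divide_distrib)
        thus "M + 1 / N + e / N \<le> \<mu>" using \<mu>(3) by simp
      qed (use \<mu> P1 C20 in auto)
      finally show ?thesis by (simp add: algebra_simps)
    qed
    have "card ?F \<le> card (F1 \<union> F2)" by (rule card_mono) (use f1 f2 sub in auto)
    also have "\<dots> \<le> card F1 + card F2" by (rule card_Un_le)
    finally have "real (card ?F) \<le> real (card F1) + real (card F2)" by (simp only: of_nat_add[symmetric] of_nat_le_iff)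
    also have "\<dots> \<le> (C1 + C2 * (1 + 4 powr e)) * P powr \<mu>" using c1 c2 by (simp add: distrib_right)
    also have "\<dots> \<le> (C1 + C2 * (1 + 4 powr e) + 1) * P powr \<mu>" by (intro mult_right_mono) auto
    finally show "real (card ?F) \<le> (C1 + C2 * (1 + 4 powr e) + 1) * (\<Prod>i<N. A i) powr \<mu>" unfolding P_def .
  qed
qed

section \<open>Dyadic decomposition of the heights\<close>

definition bounded_factored :: "nat \<Rightarrow> nat \<Rightarrow> real \<Rightarrow> complex poly set" where
  "bounded_factored N M Q = {factored_poly N M v |v \<O>. conj_order N \<O> \<and> (\<forall>j. v j \<in> \<O>) \<and>
     (\<forall>i<N. \<forall>k<N. i \<noteq> k \<longrightarrow> (\<exists>j<M. v j i \<noteq> v j k)) \<and> (\<Prod>i<N. coeff_height M v i) \<le> Q}"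

lemma coeff_height_ge: "1 \<le> coeff_height M v i" "j < M \<Longrightarrow> norm (v j i) \<le> coeff_height M v i"
  unfolding coeff_height_def by (rule Max_ge; simp)+

lemma dyadic_round:
  fixes a :: real assumes "a \<ge> 1"
  shows "a \<le> 2 ^ nat \<lceil>log 2 a\<rceil>" "2 ^ nat \<lceil>log 2 a\<rceil> \<le> 2 * a"
proof -
  have l0: "log 2 a \<ge> 0" using assms by simp
  have p: "(2::real) ^ nat \<lceil>log 2 a\<rceil> = 2 powr real (nat \<lceil>log 2 a\<rceil>)" by (simp add: powr_realpow)
  have "a = 2 powr (log 2 a)" using assms by simp
  also have "\<dots> \<le> 2 powr real (nat \<lceil>log 2 a\<rceil>)" by (intro powr_mono) (auto simp: real_nat_ceiling_ge)
  finally show "a \<le> 2 ^ nat \<lceil>log 2 a\<rceil>" unfolding p .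
  have "real (nat \<lceil>log 2 a\<rceil>) \<le> log 2 a + 1" using l0 by linarith
  hence "2 powr real (nat \<lceil>log 2 a\<rceil>) \<le> 2 powr (log 2 a + 1)" by (intro powr_mono) auto
  also have "\<dots> = 2 * a" using assms by (simp add: powr_add)
  finally show "2 ^ nat \<lceil>log 2 a\<rceil> \<le> 2 * a" unfolding p .
qed

text \<open>Bounds the number of dyadic boxes. The logarithm is compared with
  \<open>Q powr (\<epsilon> / N)\<close>, so that its \<open>N\<close>-th power costs
  \<open>Q powr \<epsilon>\<close>.\<close>

lemma log_power_bound:
  fixes \<epsilon> :: real
  assumes "\<epsilon> > 0" "N > 0"
  shows "\<exists>C>0. \<forall>Q\<ge>1. (real (nat \<lceil>log 2 Q\<rceil>) + 1) ^ N \<le> C * Q powr \<epsilon>"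
proof -
  define a where "a = \<epsilon> / N"
  have a0: "a > 0" using assms by (simp add: a_def)
  define c where "c = 1 / (a * ln 2) + 2"
  have c0: "c > 0" unfolding c_def using a0 by (intro add_nonneg_pos) auto
  show ?thesis
  proof (intro exI[of _ "c ^ N"] conjI allI impI)
    fix Q :: real assume Q: "Q \<ge> 1"
    have q1: "Q powr a \<ge> 1" using Q a0 by (intro ge_one_powr_ge_zero) auto
    have "log 2 Q \<ge> 0" using Q by simp
    hence "real (nat \<lceil>log 2 Q\<rceil>) + 1 \<le> log 2 Q + 2" by linarith
    also have "log 2 Q + 2 \<le> (Q powr a / a) / ln 2 + 2"
      using ln_powr_bound[OF Q a0] unfolding log_def by (intro add_right_mono divide_right_mono) auto
    also have "\<dots> \<le> c * Q powr a"
      using q1 a0 by (simp add: c_def algebra_simps)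
    finally have "(real (nat \<lceil>log 2 Q\<rceil>) + 1) ^ N \<le> (c * Q powr a) ^ N" by (intro power_mono) auto
    also have "\<dots> = c ^ N * (Q powr a) powr N"
      using Q by (simp add: power_mult_distrib powr_realpow)
    also have "(Q powr a) powr N = Q powr \<epsilon>" using assms by (simp add: powr_powr a_def)
    finally show "(real (nat \<lceil>log 2 Q\<rceil>) + 1) ^ N \<le> c ^ N * Q powr \<epsilon>" .
  qed (use c0 in simp)
qed

lemma count_bounded_factored:
  assumes N: "N > 0" and M: "M > 0" and \<epsilon>: "\<epsilon> > 0"
    and \<mu>: "real N + (1 - 1 / N) * (real M - 1) \<le> \<mu>" "real M + 1 / N \<le> \<mu>" "real M + (2 * real N - real M) / N \<le> \<mu>"
  shows "\<exists>C>0. \<forall>Q\<ge>1. finite (bounded_factored N M Q) \<and>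
    real (card (bounded_factored N M Q)) \<le> C * Q powr (\<mu> + \<epsilon>)"
proof -
  obtain C where C: "C > 0" "\<And>A. (\<forall>i<N. A i \<ge> 1) \<Longrightarrow> finite {factored_poly N M v |v \<O>. blocks_in N M A \<O> v} \<and>
    real (card {factored_poly N M v |v \<O>. blocks_in N M A \<O> v}) \<le> C * (\<Prod>i<N. A i) powr \<mu>"
    using count_polydisc[OF N M \<mu>] by blast
  obtain C' where C': "C' > 0" "\<And>Q. Q \<ge> 1 \<Longrightarrow> (real (nat \<lceil>log 2 Q\<rceil>) + 1) ^ N \<le> C' * Q powr \<epsilon>"
    using log_power_bound[OF \<epsilon> N] by blast
  have \<mu>0: "\<mu> \<ge> 0" using \<mu>(2) order_trans[of 0 "real M + 1 / N" \<mu>] by simp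
  show ?thesis
  proof (intro exI[of _ "C' * (C * (2 ^ N) powr \<mu>)"] conjI allI impI)
    show "C' * (C * (2 ^ N) powr \<mu>) > 0" using C C' by simp
    fix Q :: real assume Q: "Q \<ge> 1"
    define E where "E = nat \<lceil>log 2 Q\<rceil>"
    \<comment> \<open>Rounding up to a power of 2 at most doubles each of the \<open>N\<close>
      heights, hence the factor \<open>2 ^ N\<close>.\<close>
    define Ix where "Ix = {x \<in> PiE_dflt {..<N} (0::nat) (\<lambda>_. {..E}). (\<Prod>i<N. 2 ^ x i :: real) \<le> 2 ^ N * Q}"
    define Fx where "Fx x = {factored_poly N M v |v \<O>. blocks_in N M (\<lambda>i. 2 ^ x i) \<O> v}" for x :: "nat \<Rightarrow> nat"
    have fD: "finite (PiE_dflt {..<N} (0::nat) (\<lambda>_. {..E}))" by (intro finite_PiE_dflt) auto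
    hence fI: "finite Ix" by (simp add: Ix_def)
    have cI: "real (card Ix) \<le> C' * Q powr \<epsilon>"
    proof -
      have "card Ix \<le> card (PiE_dflt {..<N} (0::nat) (\<lambda>_. {..E}))" unfolding Ix_def by (intro card_mono fD) auto
      also have "\<dots> = (E + 1) ^ N" by (subst card_PiE_dflt) auto
      finally have "real (card Ix) \<le> real ((E + 1) ^ N)" by (simp only: of_nat_le_iff)
      also have "\<dots> = (real (nat \<lceil>log 2 Q\<rceil>) + 1) ^ N" by (simp add: E_def add.commute)
      also have "\<dots> \<le> C' * Q powr \<epsilon>" by (rule C'(2)[OF Q])
      finally show ?thesis .
    qed
    define Bd where "Bd = C * (2 ^ N * Q) powr \<mu>"
    have fF: "finite (Fx x)" and cF: "real (card (Fx x)) \<le> Bd" if x: "x \<in> Ix" for x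
    proof -
      have "\<forall>i<N. (1::real) \<le> 2 ^ x i" by simp
      note c = C(2)[OF this]
      show "finite (Fx x)" using c by (simp add: Fx_def)
      have "real (card (Fx x)) \<le> C * (\<Prod>i<N. 2 ^ x i) powr \<mu>" using c by (simp add: Fx_def)
      also have "\<dots> \<le> Bd" unfolding Bd_def using x C(1) \<mu>0
        by (intro mult_left_mono powr_mono2 prod_nonneg) (auto simp: Ix_def)
      finally show "real (card (Fx x)) \<le> Bd" .
    qed
    have U: "finite (\<Union>x\<in>Ix. Fx x)" "real (card (\<Union>x\<in>Ix. Fx x)) \<le> real (card Ix) * Bd"
      by (rule card_UN_le_real[OF fI fF cF]; assumption)+
    have sub: "bounded_factored N M Q \<subseteq> (\<Union>x\<in>Ix. Fx x)"
    proof
      fix p assume "p \<in> bounded_factored N M Q"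
      then obtain v \<O> where v: "p = factored_poly N M v" "conj_order N \<O>" "\<forall>j. v j \<in> \<O>"
        "\<forall>i<N. \<forall>k<N. i \<noteq> k \<longrightarrow> (\<exists>j<M. v j i \<noteq> v j k)" "(\<Prod>i<N. coeff_height M v i) \<le> Q"
        unfolding bounded_factored_def by blast
      define a where "a = coeff_height M v"
      have a1: "a i \<ge> 1" for i by (simp add: a_def coeff_height_ge)
      define x where "x i = (if i < N then nat \<lceil>log 2 (a i)\<rceil> else 0)" for i
      \<comment> \<open>The other heights are at least 1, so each one is at most the whole
        product.\<close>
      have aQ: "a i \<le> Q" if i: "i < N" for i
      proof -
        have "a i * 1 \<le> a i * (\<Prod>k\<in>{..<N} - {i}. a k)"
          using a1 order_trans[OF zero_le_one a1] by (intro mult_left_mono prod_ge_1) auto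
        also have "\<dots> = (\<Prod>k<N. a k)" using i by (intro prod.remove[symmetric]) auto
        finally show ?thesis using v(5) by (simp add: a_def)
      qed
      have "x i \<le> E" if i: "i < N" for i
      proof -
        have "log 2 (a i) \<le> log 2 Q" using aQ[OF i] a1[of i] by (subst log_le_cancel_iff) auto
        hence "nat \<lceil>log 2 (a i)\<rceil> \<le> nat \<lceil>log 2 Q\<rceil>" by (intro nat_mono ceiling_mono)
        thus ?thesis using i by (simp only: x_def E_def if_True)
      qed
      moreover have "(\<Prod>i<N. 2 ^ x i :: real) \<le> 2 ^ N * Q"
      proof -
        have "(\<Prod>i<N. 2 ^ x i :: real) \<le> (\<Prod>i<N. 2 * a i)"
          using dyadic_round(2)[OF a1] by (intro prod_mono) (auto simp: x_def)
        also have "\<dots> = 2 ^ N * (\<Prod>i<N. a i)" by (simp add: prod.distrib)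
        also have "\<dots> \<le> 2 ^ N * Q" using v(5) by (simp add: a_def)
        finally show ?thesis .
      qed
      ultimately have "x \<in> Ix" by (auto simp: Ix_def PiE_dflt_def x_def)
      moreover have "blocks_in N M (\<lambda>i. 2 ^ x i) \<O> v"
        unfolding blocks_in_def
      proof (intro conjI)
        show "\<forall>j<M. v j \<in> polydisc N (\<lambda>i. 2 ^ x i)"
        proof (intro allI impI)
          fix j assume j: "j < M"
          have "norm (v j i) \<le> 2 ^ x i" if "i < N" for i
            using coeff_height_ge(2)[OF j, of v i] dyadic_round(1)[OF a1[of i]] that by (simp add: x_def a_def)
          thus "v j \<in> polydisc N (\<lambda>i. 2 ^ x i)" by (simp add: polydisc_def)
        qed
        \<comment> \<open>Equal moduli give equal heights, which are rounded to equal radii; so the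
          symmetry survives the decomposition.\<close>
        show "\<forall>i<N. \<forall>k<N. (\<forall>w\<in>\<O>. norm (w k) = norm (w i)) \<longrightarrow> 2 ^ x k = (2 ^ x i :: real)"
        proof (intro allI impI)
          fix i k assume ik: "i < N" "k < N" "\<forall>w\<in>\<O>. norm (w k) = norm (w i)"
          have "a k = a i" using ik(3) v(3) by (simp add: a_def coeff_height_def)
          thus "2 ^ x k = (2 ^ x i :: real)" using ik by (simp add: x_def)
        qed
      qed (rule v)+
      ultimately show "p \<in> (\<Union>x\<in>Ix. Fx x)" unfolding Fx_def using v(1) by blast
    qed
    show "finite (bounded_factored N M Q)" by (rule finite_subset[OF sub U(1)])
    have "real (card (bounded_factored N M Q)) \<le> real (card (\<Union>x\<in>Ix. Fx x))"
      using card_mono[OF U(1) sub] by (simp only: of_nat_le_iff)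
    also have "\<dots> \<le> real (card Ix) * Bd" by (rule U(2))
    also have "\<dots> \<le> (C' * Q powr \<epsilon>) * Bd" using cI C(1) by (intro mult_right_mono) (auto simp: Bd_def)
    also have "\<dots> = C' * (C * (2 ^ N) powr \<mu>) * Q powr (\<mu> + \<epsilon>)"
      using Q by (simp add: Bd_def powr_mult powr_add mult_ac)
    finally show "real (card (bounded_factored N M Q)) \<le> C' * (C * (2 ^ N) powr \<mu>) * Q powr (\<mu> + \<epsilon>)" .
  qed
qed


lemma coeff_random_poly:
  "coeff (Polynomial.monom 1 n + (\<Sum>i<n. Polynomial.monom (of_int (a i)) i) :: rat poly) k =
     (if k = n then 1 else if k < n then of_int (a k) else 0)"
  by (auto simp: coeff_sum)

lemma prob_random_monic_poly_le:
  fixes B :: "complex poly set"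
  assumes L: "L \<ge> 1" and fin: "finite B"
    and sub: "\<And>f. f \<in> E \<Longrightarrow> lead_coeff f = 1 \<Longrightarrow> (\<And>k. coeff f k \<in> \<int>) \<Longrightarrow>
      (\<And>k. norm (of_rat (coeff f k) :: complex) \<le> L) \<Longrightarrow> map_poly of_rat f \<in> B"
  shows "measure_pmf.prob (random_monic_poly n L) E \<le> real (card B) * L powr (- real n)"
proof -
  define g :: "(nat \<Rightarrow> int) \<Rightarrow> rat poly"
    where "g a = Polynomial.monom 1 n + (\<Sum>i<n. Polynomial.monom (of_int (a i)) i)" for a
  define K where "K = {k::int. real_of_int k \<in> {-L..L}}"
  have K: "K = {-\<lfloor>L\<rfloor>..\<lfloor>L\<rfloor>}" by (auto simp: K_def le_floor_iff) linarith+
  have finK: "finite K" and neK: "K \<noteq> {}" using L by (auto simp: K)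
  have cardK: "real (card K) \<ge> L"
  proof -
    have "real (card K) = 2 * real_of_int \<lfloor>L\<rfloor> + 1" using L by (simp add: K)
    thus ?thesis using L by linarith
  qed
  define \<Omega> where "\<Omega> = PiE_dflt {..<n} (0::int) (\<lambda>_. K)"
  have fin\<Omega>: "finite \<Omega>" unfolding \<Omega>_def by (intro finite_PiE_dflt finK) auto
  have ne\<Omega>: "\<Omega> \<noteq> {}" unfolding \<Omega>_def using neK by (auto simp: PiE_dflt_empty_iff)
  have card\<Omega>: "card \<Omega> = card K ^ n" unfolding \<Omega>_def by (subst card_PiE_dflt) (auto simp: finK)
  have co: "coeff (g a) k = (if k = n then 1 else if k < n then of_int (a k) else 0)" for a k
    unfolding g_def by (rule coeff_random_poly)
  have deg: "degree (g a) = n" for a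
  proof (rule antisym)
    show "degree (g a) \<le> n" by (rule degree_le) (simp add: co)
    show "n \<le> degree (g a)" by (rule le_degree) (simp add: co)
  qed
  have inj: "inj_on (\<lambda>a. map_poly of_rat (g a) :: complex poly) \<Omega>"
  proof (rule inj_onI)
    fix a b assume ab: "a \<in> \<Omega>" "b \<in> \<Omega>" "map_poly of_rat (g a) = (map_poly of_rat (g b) :: complex poly)"
    show "a = b"
    proof
      fix i
      have "of_rat (coeff (g a) i) = (of_rat (coeff (g b) i) :: complex)"
        using arg_cong[OF ab(3), of "\<lambda>p. coeff p i"] by (simp add: coeff_map_poly)
      thus "a i = b i" using ab(1,2) by (cases "i < n") (auto simp: co \<Omega>_def PiE_dflt_def)
    qed
  qed
  have img: "map_poly of_rat (g a) \<in> B" if a: "a \<in> \<Omega>" "g a \<in> E" for a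
  proof (rule sub[OF a(2)])
    show "lead_coeff (g a) = 1" by (simp add: deg co)
    show "coeff (g a) k \<in> \<int>" for k by (simp add: co)
    show "norm (of_rat (coeff (g a) k) :: complex) \<le> L" for k
    proof (cases "k < n")
      case True
      hence "a k \<in> K" using a(1) by (auto simp: \<Omega>_def PiE_dflt_def)
      hence "\<bar>real_of_int (a k)\<bar> \<le> L" by (auto simp: K_def)
      thus ?thesis using True by (simp add: co)
    qed (use L in \<open>auto simp: co\<close>)
  qed
  have "random_monic_poly n L = map_pmf g (pmf_of_set \<Omega>)"
  proof -
    have "Pi_pmf {..<n} 0 (\<lambda>_. pmf_of_set K) = pmf_of_set \<Omega>"
      unfolding \<Omega>_def by (rule Pi_pmf_of_set) (use finK neK in auto)
    moreover have "random_monic_poly n L = map_pmf g (Pi_pmf {..<n} 0 (\<lambda>_. pmf_of_set K))"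
      unfolding random_monic_poly_def g_def K_def ..
    ultimately show ?thesis by simp
  qed
  hence "measure_pmf.prob (random_monic_poly n L) E = real (card (\<Omega> \<inter> g -` E)) / real (card \<Omega>)"
    by (simp add: measure_pmf_of_set[OF ne\<Omega> fin\<Omega>])
  also have "\<dots> \<le> real (card B) / L ^ n"
  proof (intro frac_le)
    have "inj_on (\<lambda>a. map_poly of_rat (g a) :: complex poly) (\<Omega> \<inter> g -` E)"
      using inj by (rule inj_on_subset) auto
    hence "card (\<Omega> \<inter> g -` E) \<le> card B"
      by (rule card_inj_on_le[OF _ _ fin]) (use img in auto)
    thus "real (card (\<Omega> \<inter> g -` E)) \<le> real (card B)" by simp
    show "L ^ n \<le> real (card \<Omega>)" unfolding card\<Omega> of_nat_power using cardK L by (intro power_mono) auto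
  qed (use L in auto)
  also have "\<dots> = real (card B) * L powr (- real n)"
    using L by (simp add: powr_minus powr_realpow divide_inverse)
  finally show ?thesis .
qed

text \<open>For \<open>M = 2\<close> the special exponent \<open>n / 2 - 2 / n + 1\<close> equals
  \<open>N + 1 - 1 / N\<close>, which is exactly the exponent of the few-point case.\<close>

lemma imprimitive_exponent_ge:
  assumes N: "N > 1" and M: "M > 1"
  shows "real N + (1 - 1 / N) * (real M - 1) \<le> imprimitive_exponent N M" (is "?a \<le> _")
    "real M + 1 / N \<le> imprimitive_exponent N M"
    "real M + (2 * real N - real M) / N \<le> imprimitive_exponent N M"
proof -
  have a: "real N + (1 - 1 / N) * (real M - 1) \<le> imprimitive_exponent N M \<and>
    real M + 1 / N \<le> imprimitive_exponent N M \<and>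
    real M + (2 * real N - real M) / N \<le> imprimitive_exponent N M"
  proof (cases "M = 2 \<and> N * M \<ge> 10")
    case True
    hence M2: "M = 2" and N5: "N \<ge> 5" by auto
    define q where "q = 1 / real N"
    have m: "imprimitive_exponent N M = real N - q + 1"
      using N5 by (simp add: imprimitive_exponent_def Let_def M2 q_def)
    have q: "q \<le> 1 / 5" "q \<ge> 0" using N5 by (simp_all add: q_def field_simps)
    have "(2 * real N - real M) / N = 2 - 2 * q" using N M2 by (simp add: diff_divide_distrib q_def)
    moreover have "(1 - 1 / real N) * (real M - 1) = 1 - q" using M2 by (simp add: q_def)
    moreover have "1 / real N = q" by (simp add: q_def)
    moreover have "real M = 2" "real N \<ge> 5" using M2 N5 by auto
    ultimately show ?thesis using m q by simp
  next
    case False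
    have m: "imprimitive_exponent N M = Max {real M + 1 / 2 + 1 / real N,
        real N + (1 - 1 / real N) * (real M - 1), real N + real M / 2}"
      using False by (auto simp: imprimitive_exponent_def Let_def)
    have m1: "real M + 1 / 2 + 1 / real N \<le> imprimitive_exponent N M"
      and m2: "real N + (1 - 1 / real N) * (real M - 1) \<le> imprimitive_exponent N M"
      unfolding m by (rule Max_ge; simp)+
    have e: "(2 * real N - real M) / N = 2 - real M / N" using N by (simp add: diff_divide_distrib)
    have "real M + (2 - real M / N) \<le> imprimitive_exponent N M"
    \<comment> \<open>For \<open>N = 2\<close> the first term of the maximum suffices, as the
      inequality reduces to \<open>M \<ge> 2\<close>; for \<open>N \<ge> 3\<close> the second one
      does, because \<open>N - 1 \<ge> 2\<close>.\<close>
    proof (cases "N = 2")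
      case True
      have "real M + (2 - real M / 2) \<le> real M + 1 / 2 + 1 / 2" using M by simp
      thus ?thesis using m1 True by simp
    next
      case False
      hence "N \<ge> 3" using N by simp
      hence "real N \<ge> 3" by simp
      moreover have "1 / real N \<ge> 0" by simp
      moreover have "real N + (1 - 1 / real N) * (real M - 1) = real N + real M - 1 - real M / N + 1 / N"
        by (simp add: algebra_simps diff_divide_distrib)
      ultimately show ?thesis using m2 by linarith
    qed
    thus ?thesis using m1 m2 unfolding e by simp
  qed
  show "?a \<le> imprimitive_exponent N M" "real M + 1 / N \<le> imprimitive_exponent N M"
    "real M + (2 * real N - real M) / N \<le> imprimitive_exponent N M" using a by blast+
qed

theorem theorem1p6:
  fixes n n1 n2 :: nat
  assumes "n1 > 1" and "n2 > 1" and "n = n1 * n2"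
  shows "\<forall>\<epsilon>>0. \<exists>C>0. \<forall>L\<ge>(1::real).
           measure_pmf.prob (random_monic_poly n L)
             {f. separable_poly f \<and>
                 transitive_imprimitive n1 n2 (complex_roots f) (galois_group f)}
           \<le> C * L powr (- real n + imprimitive_exponent n1 n2 + \<epsilon>)"
proof (intro allI impI)
  fix \<epsilon> :: real assume \<epsilon>: "\<epsilon> > 0"
  let ?m = "imprimitive_exponent n1 n2"
  have pos: "n1 > 0" "n2 > 0" using assms by auto
  \<comment> \<open>The constant of \<open>imprimitive_factorization\<close>: coefficients up to
    \<open>L\<close> give heights with product at most \<open>c * L\<close>.\<close>
  define c :: real where "c = 2 ^ (n2 * n1) * (2 ^ (n1 * n2 + 1)) ^ (n1 * n2)"
  have "1 * 1 \<le> c" unfolding c_def by (intro mult_mono one_le_power) auto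
  hence c1: "c \<ge> 1" by simp
  obtain C where C: "C > 0" "\<And>Q. Q \<ge> 1 \<Longrightarrow> finite (bounded_factored n1 n2 Q) \<and>
    real (card (bounded_factored n1 n2 Q)) \<le> C * Q powr (?m + \<epsilon>)"
    using count_bounded_factored[OF pos \<epsilon> imprimitive_exponent_ge[OF assms(1,2)]] by blast
  show "\<exists>C>0. \<forall>L\<ge>(1::real). measure_pmf.prob (random_monic_poly n L)
             {f. separable_poly f \<and> transitive_imprimitive n1 n2 (complex_roots f) (galois_group f)}
           \<le> C * L powr (- real n + ?m + \<epsilon>)"
  proof (intro exI[of _ "C * c powr (?m + \<epsilon>)"] conjI allI impI)
    show "C * c powr (?m + \<epsilon>) > 0" using C(1) c1 by simp
    fix L :: real assume L: "L \<ge> 1"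
    have cL: "c * L \<ge> 1" using mult_mono[OF c1 L] c1 by simp
    have "measure_pmf.prob (random_monic_poly n L)
        {f. separable_poly f \<and> transitive_imprimitive n1 n2 (complex_roots f) (galois_group f)}
      \<le> real (card (bounded_factored n1 n2 (c * L))) * L powr (- real n)"
    proof (rule prob_random_monic_poly_le[OF L])
      show "finite (bounded_factored n1 n2 (c * L))" using C(2)[OF cL] by blast
      fix f assume f: "f \<in> {f. separable_poly f \<and> transitive_imprimitive n1 n2 (complex_roots f) (galois_group f)}"
        "lead_coeff f = 1" "\<And>k. coeff f k \<in> \<int>" "\<And>k. norm (of_rat (coeff f k) :: complex) \<le> L"
      have f1: "separable_poly f" and f2: "transitive_imprimitive n1 n2 (complex_roots f) (galois_group f)"
        using f(1) by auto
      obtain \<O> v where v: "conj_order n1 \<O>" "\<And>j. v j \<in> \<O>" "map_poly of_rat f = factored_poly n1 n2 v"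
        "\<And>i k. i < n1 \<Longrightarrow> k < n1 \<Longrightarrow> i \<noteq> k \<Longrightarrow> \<exists>j<n2. v j i \<noteq> v j k"
        "(\<Prod>i<n1. coeff_height n2 v i) \<le> c * L"
        using imprimitive_factorization[OF f1 f(2,3) f2 pos(1) f(4)] unfolding c_def by blast
      show "map_poly of_rat f \<in> bounded_factored n1 n2 (c * L)"
        unfolding bounded_factored_def v(3) using v(1,2,4,5) by blast
    qed
    also have "\<dots> \<le> (C * (c * L) powr (?m + \<epsilon>)) * L powr (- real n)"
      using C(2)[OF cL] by (intro mult_right_mono) auto
    also have "\<dots> = C * c powr (?m + \<epsilon>) * L powr (- real n + ?m + \<epsilon>)"
    proof -
      have "L powr (- real n + ?m + \<epsilon>) = L powr (?m + \<epsilon>) * L powr (- real n)"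
        by (simp flip: powr_add add: algebra_simps)
      thus ?thesis using L c1 by (simp add: powr_mult)
    qed
    finally show "measure_pmf.prob (random_monic_poly n L)
        {f. separable_poly f \<and> transitive_imprimitive n1 n2 (complex_roots f) (galois_group f)}
      \<le> C * c powr (?m + \<epsilon>) * L powr (- real n + ?m + \<epsilon>)" .
  qed
qed

end
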